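(* Let $\mathcal{H}_1$ and $\mathcal{H}_2$ be Hilbert spaces, and let $$T=\begin{bmatrix}A&D_{A^*}LD_B\\0&B\end{bmatrix}:\Big(\bigoplus_1^n\mathcal{H}_1\Big)\oplus\Big(\bigoplus_1^n\mathcal{H}_2\Big)\to\mathcal{H}_1\oplus\mathcal{H}_2$$ be a row contraction on $\mathcal{H}_1\oplus\mathcal{H}_2$, where $A=(A_1,\dots,A_n)$ on $\mathcal{H}_1$ and $B=(B_1,\dots,B_n)$ on $\mathcal{H}_2$ are row contractions, and $L\in B(\mathcal{D}_B,\mathcal{D}_{A^*})$ is a contraction. Let $\sigma\in B(\mathcal{D}_T,\mathcal{D}_A\oplus\mathcal{D}_L)$ and $\sigma_*\in B(\mathcal{D}_{T^*},\mathcal{D}_{B^*}\oplus\mathcal{D}_{L^*})$ be unitary operators such that $\Theta_T=\Theta_3'\Theta_2'\Theta_1'$, where $$\Theta_3'=(I_\Gamma\otimes\sigma_*^{-1})\begin{bmatrix}\Theta_B&0\\0&I_{\Gamma\otimes\mathcal{D}_{L^*}}\end{bmatrix},\quad\Theta_2'=I_\Gamma\otimes J_L,\quad\Theta_1'=\begin{bmatrix}\Theta_A&0\\0&I_{\Gamma\otimes\mathcal{D}_L}\end{bmatrix}(I_\Gamma\otimes\sigma),\quad J_L=\begin{bmatrix}L^*&D_L\\ D_{L^*}&-L\end{bmatrix}.$$ Then, in each of the following cases, the factorization $\Theta_T=\Theta_3'\Theta_2'\Theta_1'$ of the characteristic function $\Theta_T$ is a $3$-regular factorization: (i) the row contraction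 $B$ is pure; (ii) the row contraction $T$ is pure; (iii) the coupling operator $L$ is a proper contraction, i.e., $\|L^*x\|<\|x\|$ for all nonzero $x\in\mathcal{D}_{A^*}$, or $\|Ly\|<\|y\|$ for all nonzero $y\in\mathcal{D}_B$.
   Context: All Hilbert spaces are complex and separable. Here $n\in\mathbb{N}$ or $n=\infty$ (with $\mathbb{C}^n=\ell^2(\mathbb{N})$ when $n=\infty$), and $\{e_1,\dots,e_n\}$ is the canonical orthonormal basis of $\mathbb{C}^n$. A row contraction on $\mathcal{H}$ is an $n$-tuple $T=[T_1,\dots,T_n]$ of operators in $B(\mathcal{H})$, viewed as an operator $\bigoplus_{i=1}^n\mathcal{H}\to\mathcal{H}$, with $\sum_{i=1}^nT_iT_i^*\le I_{\mathcal{H}}$. In the block form, $\bigoplus_1^n(\mathcal{H}_1\oplus\mathcal{H}_2)$ is identified with $(\bigoplus_1^n\mathcal{H}_1)\oplus(\bigoplus_1^n\mathcal{H}_2)$, so that each $T_i$ is block upper triangular on $\mathcal{H}_1\oplus\mathcal{H}_2$ with diagonal entries $A_i$ and $B_i$. For a contraction (in particular a row contraction) $T$, $D_T=(I-T^*T)^{1/2}$, $D_{T^*}=(I-TT^* )^{1/2}$, $\mathcal{D}_T=\overline{\mathrm{range}(D_T)}$, $\mathcal{D}_{T^*}=\overline{\mathrm{range}(D_{T^*})}$; for a row contraction on $\mathcal{H}$, $\mathcal{D}_T\subseteq\bigoplus_{i=1}^n\mathcal{H}$ and $\mathcal{D}_{T^*}\subseteq\mathcal{H}$. $\Gamma=\bigoplus_{k\ge0}(\mathbb{C}^n)^{\otimes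 k}$ is the full Fock space, with vacuum vector $e_\emptyset=1\oplus0\oplus\cdots$. $\mathbb{F}_n^+$ is the unital free semigroup on generators $1,\dots,n$ with identity the empty word $\emptyset$. For $\alpha=\alpha_1\cdots\alpha_j\in\mathbb{F}_n^+$, $|\alpha|=j$ (and $|\emptyset|=0$), $e_\alpha=e_{\alpha_1}\otimes\cdots\otimes e_{\alpha_j}$, $T_\alpha=T_{\alpha_1}\cdots T_{\alpha_j}$ and $T_\emptyset=I$; $T_\alpha^*=(T_\alpha)^*$. The left creation operators are $S_ix=e_i\otimes x$ on $\Gamma$. A row contraction $T$ on $\mathcal{H}$ is pure if $\lim_{k\to\infty}\sum_{|\alpha|=k}\|T_\alpha^*h\|^2=0$ for all $h\in\mathcal{H}$. A multi-analytic operator is a bounded operator $M:\Gamma\otimes\mathcal{E}\to\Gamma\otimes\mathcal{E}_*$ with $M(S_i\otimes I_{\mathcal{E}})=(S_i\otimes I_{\mathcal{E}_*})M$ for all $i$; it is uniquely determined by its symbol $\theta:\mathcal{E}\to\Gamma\otimes\mathcal{E}_*$, $\theta h=M(e_\emptyset\otimes h)$. The characteristic function of a row contraction $T$ on $\mathcal{H}$ is the (contractive) multi-analytic operator $\Theta_T:\Gamma\otimes\mathcal{D}_T\to\Gamma\otimes\mathcal{D}_{T^*}$ with symbol $$\theta_T(h)=-e_\emptyset\otimes\sum_{i=1}^nT_iP_ih+\sum_{i=1}^n(S_i\otimes I_{\mathcal{D}_{T^*}})\Big(\sum_{\alpha\in\mathbb{F}_n^+}e_\alpha\otimes D_{T^*}T_\alpha^*P_iD_Th\Big),\quad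 h\in\mathcal{D}_T,$$ where $P_i$ is the projection of $\bigoplus_{j=1}^n\mathcal{H}$ onto its $i$-th coordinate space. Unitaries $\sigma,\sigma_*$ giving the stated factorization exist by a theorem of Haria, Maji and Sarkar. Here $J_L:\mathcal{D}_{A^*}\oplus\mathcal{D}_L\to\mathcal{D}_B\oplus\mathcal{D}_{L^*}$ is unitary, and $\Gamma\otimes(\mathcal{E}\oplus\mathcal{F})$ is identified with $(\Gamma\otimes\mathcal{E})\oplus(\Gamma\otimes\mathcal{F})$. Let $\Theta:\Gamma\otimes\mathcal{E}\to\Gamma\otimes\mathcal{E}_*$ be a contractive multi-analytic operator with $\Theta=\Theta_3\Theta_2\Theta_1$, where $\Theta_i:\Gamma\otimes\mathcal{E}_i\to\Gamma\otimes\mathcal{E}_{i+1}$ are contractive multi-analytic operators, $\mathcal{E}_1=\mathcal{E}$, $\mathcal{E}_4=\mathcal{E}_*$. Put $\Delta_\Theta=(I-\Theta^*\Theta)^{1/2}$ and $\Delta_i=(I-\Theta_i^*\Theta_i)^{1/2}$. The factorization is $3$-regular if the isometry $Z_3:\overline{\Delta_\Theta(\Gamma\otimes\mathcal{E})}\to\overline{\Delta_3(\Gamma\otimes\mathcal{E}_3)}\oplus\overline{\Delta_2(\Gamma\otimes\mathcal{E}_2)}\oplus\overline{\Delta_1(\Gamma\otimes\mathcal{E}_1)}$ determined by $Z_3(\Delta_\Theta f)=\Delta_3\Theta_2\Theta_1f\oplus\Delta_2\Theta_1f\oplus\Delta_1f$, $f\in\Gamma\otimes\mathcal{E}$, is unitary.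 *)

theory Defs
  imports "HOL-Analysis.Analysis"
begin

section \<open>Complex Hilbert spaces\<close>

class complex_vector = real_vector +
  fixes scaleC :: "complex \<Rightarrow> 'a \<Rightarrow> 'a"  (infixr \<open>*\<^sub>C\<close> 75)
  assumes scaleC_add_right: "c *\<^sub>C (x + y) = c *\<^sub>C x + c *\<^sub>C y"
    and scaleC_add_left: "(c + d) *\<^sub>C x = c *\<^sub>C x + d *\<^sub>C x"
    and scaleC_scaleC: "c *\<^sub>C d *\<^sub>C x = (c * d) *\<^sub>C x"
    and scaleC_one: "1 *\<^sub>C x = x"
    and scaleR_scaleC: "r *\<^sub>R x = complex_of_real r *\<^sub>C x"

text \<open>The complex inner product is linear in its first argument.  The norm and the topology are
  those of the underlying real inner product space, whose inner product is the real part.\<close>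

class complex_inner = complex_vector + real_inner +
  fixes cinner :: "'a \<Rightarrow> 'a \<Rightarrow> complex"
  assumes cinner_commute: "cinner x y = cnj (cinner y x)"
    and cinner_add_left: "cinner (x + y) z = cinner x z + cinner y z"
    and cinner_scaleC_left: "cinner (c *\<^sub>C x) y = c * cinner x y"
    and inner_eq_Re_cinner: "inner x y = Re (cinner x y)"

class chilbert_space = complex_inner + complete_space

lemma cinner_add_right: "cinner x (y + z) = cinner x y + cinner x z"
  by (metis cinner_add_left cinner_commute complex_cnj_add)

lemma cinner_scaleC_right: "cinner x (c *\<^sub>C y) = cnj c * cinner x y"
  by (metis cinner_scaleC_left cinner_commute complex_cnj_mult)

lemma cinner_self: "cinner x x = complex_of_real ((norm x)\<^sup>2)"
proof -
  have "Im (cinner x x) = 0"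
    using arg_cong[OF cinner_commute[of x x], of Im] by simp
  moreover have "Re (cinner x x) = (norm x)\<^sup>2"
    by (simp add: power2_norm_eq_inner inner_eq_Re_cinner)
  ultimately show ?thesis by (simp add: complex_eq_iff)
qed

lemma norm_scaleC: "norm (c *\<^sub>C x) = cmod c * norm (x :: 'a :: complex_inner)"
proof -
  have "complex_of_real ((norm (c *\<^sub>C x))\<^sup>2) = complex_of_real ((cmod c * norm x)\<^sup>2)"
    using cinner_scaleC_left[of c x "c *\<^sub>C x"]
    by (simp add: cinner_scaleC_right cinner_self power_mult_distrib complex_norm_square
        mult.assoc[symmetric] del: of_real_power)
  then have "(norm (c *\<^sub>C x))\<^sup>2 = (cmod c * norm x)\<^sup>2"
    using of_real_eq_iff by blast
  then show ?thesis by (simp add: power2_eq_iff_nonneg)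
qed

lemma norm_cinner_le: "cmod (cinner x y) \<le> norm x * norm y"
proof (cases "cinner x y = 0")
  case False
  define c where "c = cnj (cinner x y) / complex_of_real (cmod (cinner x y))"
  have c1: "cmod c = 1" using False by (simp add: c_def norm_divide)
  have "c * cinner x y = complex_of_real (cmod (cinner x y))"
    using False by (simp add: c_def complex_norm_square[symmetric] power2_eq_square mult.commute)
  then have "inner (c *\<^sub>C x) y = cmod (cinner x y)"
    by (simp add: inner_eq_Re_cinner cinner_scaleC_left)
  moreover have "inner (c *\<^sub>C x) y \<le> norm (c *\<^sub>C x) * norm y" by (rule norm_cauchy_schwarz)
  ultimately show ?thesis using c1 by (simp add: norm_scaleC)
qed simp

lemma scaleC_zero_left [simp]: "0 *\<^sub>C (x :: 'a :: complex_vector) = 0"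
  using scaleR_scaleC[of 0 x] by simp

lemma scaleC_zero_right [simp]: "c *\<^sub>C (0 :: 'a :: complex_vector) = 0"
  using scaleC_add_right[of c 0 "0 :: 'a"] by simp

lemma cinner_zero_left [simp]: "cinner 0 x = 0"
  using cinner_add_left[of 0 0 x] by simp

lemma cinner_zero_right [simp]: "cinner x 0 = 0"
  using cinner_add_right[of x 0 0] by simp

instantiation complex :: complex_inner
begin
definition "scaleC c (z :: complex) = c * z"
definition "cinner (z :: complex) w = z * cnj w"
instance
  by standard (simp_all add: scaleC_complex_def cinner_complex_def algebra_simps
      inner_complex_def scaleR_conv_of_real)
end

instance complex :: chilbert_space ..

instantiation prod :: (complex_inner, complex_inner) complex_inner
begin
definition "scaleC c (x :: 'a \<times> 'b) = (c *\<^sub>C fst x, c *\<^sub>C snd x)"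
definition "cinner (x :: 'a \<times> 'b) y = cinner (fst x) (fst y) + cinner (snd x) (snd y)"
instance
proof
  fix x y :: "'a \<times> 'b"
  show "cinner x y = cnj (cinner y x)"
    unfolding cinner_prod_def complex_cnj_add by (metis cinner_commute)
qed (auto simp: scaleC_prod_def cinner_prod_def prod_eq_iff scaleC_add_right scaleC_add_left
      scaleC_scaleC scaleC_one scaleR_scaleC cinner_add_left cinner_scaleC_left inner_prod_def
      inner_eq_Re_cinner algebra_simps)
end

instance prod :: (chilbert_space, chilbert_space) chilbert_space ..


section \<open>Square-summable families\<close>

text \<open>The type \<open>('i, 'a) ell2\<close> is the Hilbert space direct sum of copies of \<open>'a\<close> indexed by \<open>'i\<close>.\<close>

typedef (overloaded) ('i, 'a) ell2 =
  "{f :: 'i \<Rightarrow> 'a :: real_normed_vector. (\<lambda>i. (norm (f i))\<^sup>2) summable_on UNIV}"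
  morphisms coord Abs_ell2
  by (rule exI[of _ "\<lambda>_. 0"]) simp

setup_lifting type_definition_ell2

lemma ell2_eqI: "(\<And>i. coord x i = coord y i) \<Longrightarrow> x = y"
  by (metis coord_inject ext)

lemma summable_coord: "(\<lambda>i. (norm (coord x i))\<^sup>2) summable_on UNIV"
  using coord[of x] by simp

lemma norm_add_square_le:
  fixes x y :: "'a :: real_normed_vector"
  shows "(norm (x + y))\<^sup>2 \<le> 2 * (norm x)\<^sup>2 + 2 * (norm y)\<^sup>2"
proof -
  have "(norm (x + y))\<^sup>2 \<le> (norm x + norm y)\<^sup>2"
    by (simp add: norm_triangle_ineq power_mono)
  also have "\<dots> \<le> 2 * (norm x)\<^sup>2 + 2 * (norm y)\<^sup>2"
    using sum_squares_bound[of "norm x" "norm y"] by (simp add: power2_sum)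
  finally show ?thesis .
qed

instantiation ell2 :: (type, real_normed_vector) real_vector
begin

lift_definition zero_ell2 :: "('a, 'b) ell2" is "\<lambda>_. 0" by simp

lift_definition plus_ell2 :: "('a, 'b) ell2 \<Rightarrow> ('a, 'b) ell2 \<Rightarrow> ('a, 'b) ell2"
  is "\<lambda>f g i. f i + g i"
proof -
  fix f g :: "'a \<Rightarrow> 'b"
  assume "(\<lambda>i. (norm (f i))\<^sup>2) summable_on UNIV" "(\<lambda>i. (norm (g i))\<^sup>2) summable_on UNIV"
  then have "(\<lambda>i. 2 * (norm (f i))\<^sup>2 + 2 * (norm (g i))\<^sup>2) summable_on UNIV"
    by (intro summable_on_add summable_on_cmult_right)
  then show "(\<lambda>i. (norm (f i + g i))\<^sup>2) summable_on UNIV"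
    by (rule summable_on_comparison_test) (auto simp: norm_add_square_le)
qed

lift_definition uminus_ell2 :: "('a, 'b) ell2 \<Rightarrow> ('a, 'b) ell2" is "\<lambda>f i. - f i"
  by simp

definition minus_ell2 :: "('a, 'b) ell2 \<Rightarrow> ('a, 'b) ell2 \<Rightarrow> ('a, 'b) ell2"
  where "minus_ell2 x y = x + - y"

lift_definition scaleR_ell2 :: "real \<Rightarrow> ('a, 'b) ell2 \<Rightarrow> ('a, 'b) ell2" is "\<lambda>r f i. r *\<^sub>R f i"
  by (simp add: power_mult_distrib summable_on_cmult_right)

instance
proof
  fix x y z :: "('a, 'b) ell2" and r s :: real
  show "x + y + z = x + (y + z)" by transfer (simp add: add.assoc)
  show "x + y = y + x" by transfer (simp add: add.commute)
  show "0 + x = x" by transfer simp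
  show "- x + x = 0" by transfer simp
  show "x - y = x + - y" by (simp add: minus_ell2_def)
  show "r *\<^sub>R (x + y) = r *\<^sub>R x + r *\<^sub>R y" by transfer (simp add: scaleR_add_right)
  show "(r + s) *\<^sub>R x = r *\<^sub>R x + s *\<^sub>R x" by transfer (simp add: scaleR_add_left)
  show "r *\<^sub>R s *\<^sub>R x = (r * s) *\<^sub>R x" by transfer simp
  show "1 *\<^sub>R x = x" by transfer simp
qed

end

lemma coord_zero [simp]: "coord 0 i = 0" by transfer simp
lemma coord_add [simp]: "coord (x + y) i = coord x i + coord y i" by transfer simp
lemma coord_uminus [simp]: "coord (- x) i = - coord x i" by transfer simp
lemma coord_diff [simp]: "coord (x - y) i = coord x i - coord y i"
  using coord_add[of x "- y" i] by simp
lemma coord_scaleR [simp]: "coord (r *\<^sub>R x) i = r *\<^sub>R coord x i" by transfer simp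

lemma abs_summable_product_coord:
  assumes "\<And>x y. norm (b x y :: 'c :: banach) \<le> norm x * norm y"
  shows "(\<lambda>i. b (coord x i) (coord y i)) summable_on UNIV"
proof -
  have "(\<lambda>i. (norm (coord x i))\<^sup>2 + (norm (coord y i))\<^sup>2) summable_on UNIV"
    by (intro summable_on_add summable_coord)
  moreover have "norm (b (coord x i) (coord y i)) \<le> (norm (coord x i))\<^sup>2 + (norm (coord y i))\<^sup>2" for i
    using assms[of "coord x i" "coord y i"]
      sum_squares_bound[of "norm (coord x i)" "norm (coord y i)"]
      mult_nonneg_nonneg[OF norm_ge_zero[of "coord x i"] norm_ge_zero[of "coord y i"]]
    by linarith
  ultimately have "(\<lambda>i. norm (b (coord x i) (coord y i))) summable_on UNIV"
    by (rule summable_on_comparison_test) auto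
  then show ?thesis by (rule abs_summable_summable)
qed

lemma summable_inner_coord: "(\<lambda>i. inner (coord x i) (coord y i)) summable_on UNIV"
  by (rule abs_summable_product_coord) (simp add: Cauchy_Schwarz_ineq2)

instantiation ell2 :: (type, real_inner) real_inner
begin

definition "inner x y = (\<Sum>\<^sub>\<infinity>i. inner (coord x i) (coord y i))"
definition "norm x = sqrt (inner x x)" for x :: "('a, 'b) ell2"
definition "dist x y = norm (x - y)" for x y :: "('a, 'b) ell2"
definition "sgn x = x /\<^sub>R norm x" for x :: "('a, 'b) ell2"
definition [code del]: "(uniformity :: (('a, 'b) ell2 \<times> ('a, 'b) ell2) filter)
    = (INF e\<in>{0<..}. principal {(x, y). dist x y < e})"
definition [code del]: "open U = (\<forall>x\<in>U. \<forall>\<^sub>F (x', y) in uniformity. x' = x \<longrightarrow> y \<in> U)"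
  for U :: "('a, 'b) ell2 set"

instance
proof
  fix x y z :: "('a, 'b) ell2" and r :: real
  show "inner x y = inner y x" by (simp add: inner_ell2_def inner_commute)
  show "inner (x + y) z = inner x z + inner y z"
    by (simp add: inner_ell2_def inner_add_left infsum_add summable_inner_coord)
  show "inner (r *\<^sub>R x) y = r * inner x y"
    by (simp add: inner_ell2_def infsum_cmult_right summable_inner_coord)
  show "0 \<le> inner x x" by (simp add: inner_ell2_def infsum_nonneg)
  show "(inner x x = 0) = (x = 0)"
  proof
    assume "inner x x = 0"
    then have "inner (coord x i) (coord x i) = 0" for i
      using nonneg_infsum_le_0D[OF _ summable_inner_coord[of x x], of i]
      by (simp add: inner_ell2_def)
    then show "x = 0" by (intro ell2_eqI) simp
  qed (simp add: inner_ell2_def)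
qed (simp_all add: norm_ell2_def dist_ell2_def sgn_ell2_def uniformity_ell2_def open_ell2_def)

end

lemma norm_ell2_square: "(norm x)\<^sup>2 = (\<Sum>\<^sub>\<infinity>i. (norm (coord x i))\<^sup>2)"
  by (simp add: power2_norm_eq_inner inner_ell2_def)

instantiation ell2 :: (type, complex_inner) complex_inner
begin

lift_definition scaleC_ell2 :: "complex \<Rightarrow> ('a, 'b) ell2 \<Rightarrow> ('a, 'b) ell2" is "\<lambda>c f i. c *\<^sub>C f i"
  by (simp add: norm_scaleC power_mult_distrib summable_on_cmult_right)

definition "cinner x y = (\<Sum>\<^sub>\<infinity>i. cinner (coord x i) (coord y i))"

lemma coord_scaleC' [simp]: "coord (c *\<^sub>C x) i = c *\<^sub>C coord x i" for x :: "('a, 'b) ell2"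
  by transfer simp

lemma summable_cinner_coord':
  "(\<lambda>i. cinner (coord x i) (coord y i)) summable_on UNIV" for x y :: "('a, 'b) ell2"
  by (rule abs_summable_product_coord) (rule norm_cinner_le)

instance
proof
  fix x y z :: "('a, 'b) ell2" and c d :: complex and r :: real
  show "c *\<^sub>C (x + y) = c *\<^sub>C x + c *\<^sub>C y" by (rule ell2_eqI) (simp add: scaleC_add_right)
  show "(c + d) *\<^sub>C x = c *\<^sub>C x + d *\<^sub>C x" by (rule ell2_eqI) (simp add: scaleC_add_left)
  show "c *\<^sub>C d *\<^sub>C x = (c * d) *\<^sub>C x" by (rule ell2_eqI) (simp add: scaleC_scaleC)
  show "1 *\<^sub>C x = x" by (rule ell2_eqI) (simp add: scaleC_one)
  show "r *\<^sub>R x = complex_of_real r *\<^sub>C x" by (rule ell2_eqI) (simp add: scaleR_scaleC)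
  show "cinner x y = cnj (cinner y x)"
    unfolding cinner_ell2_def infsum_cnj[symmetric] by (metis cinner_commute)
  show "cinner (x + y) z = cinner x z + cinner y z"
    by (simp add: cinner_ell2_def cinner_add_left infsum_add summable_cinner_coord')
  show "cinner (c *\<^sub>C x) y = c * cinner x y"
    by (simp add: cinner_ell2_def cinner_scaleC_left infsum_cmult_right summable_cinner_coord')
  show "inner x y = Re (cinner x y)"
    by (simp add: cinner_ell2_def inner_ell2_def inner_eq_Re_cinner infsum_Re summable_cinner_coord')
qed

end

lemmas coord_scaleC [simp] = coord_scaleC'
lemmas summable_cinner_coord = summable_cinner_coord'

lemma norm_coord_le: "norm (coord x i) \<le> norm x"
proof -
  have "(\<Sum>j\<in>{i}. (norm (coord x j))\<^sup>2) \<le> (\<Sum>\<^sub>\<infinity>j. (norm (coord x j))\<^sup>2)"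
    by (rule finite_sum_le_infsum) (auto simp: summable_coord)
  then show ?thesis by (simp add: norm_ell2_square[symmetric] power2_le_iff_abs_le)
qed

lemma ell2_bounded_partial_sums:
  assumes "\<And>F. finite F \<Longrightarrow> (\<Sum>i\<in>F. (norm (f i))\<^sup>2) \<le> K\<^sup>2" "0 \<le> K"
  shows "\<exists>x. coord x = f \<and> norm x \<le> K"
proof -
  have s: "(\<lambda>i. (norm (f i))\<^sup>2) summable_on UNIV"
    by (rule nonneg_bdd_above_summable_on) (auto intro!: bdd_aboveI[of _ "K\<^sup>2"] assms)
  then have c: "coord (Abs_ell2 f) = f" by (simp add: Abs_ell2_inverse)
  moreover have "(norm (Abs_ell2 f))\<^sup>2 \<le> K\<^sup>2"
    unfolding norm_ell2_square c by (rule infsum_le_finite_sums[OF s]) (auto intro: assms)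
  ultimately show ?thesis using assms(2) by (metis power2_le_imp_le)
qed

instance ell2 :: (type, "{real_inner, complete_space}") complete_space
proof
  fix X :: "nat \<Rightarrow> ('a, 'b) ell2"
  assume X: "Cauchy X"
  have "Cauchy (\<lambda>n. coord (X n) i)" for i
  proof (rule CauchyI)
    fix e :: real assume "0 < e"
    then obtain M where "\<forall>m\<ge>M. \<forall>n\<ge>M. norm (X m - X n) < e" using X CauchyD by blast
    then show "\<exists>M. \<forall>m\<ge>M. \<forall>n\<ge>M. norm (coord (X m) i - coord (X n) i) < e"
      using norm_coord_le[of _ i] by (metis coord_diff order_le_less_trans)
  qed
  then have "\<forall>i. \<exists>l. (\<lambda>n. coord (X n) i) \<longlonglongrightarrow> l"
    by (simp add: Cauchy_convergent_iff convergent_def)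
  then obtain l where l: "\<And>i. (\<lambda>n. coord (X n) i) \<longlonglongrightarrow> l i" by metis
  have near: "\<exists>x. coord x = (\<lambda>i. l i - coord (X m) i) \<and> norm x \<le> e"
    if e: "0 < e" and M: "\<forall>m\<ge>M. \<forall>n\<ge>M. norm (X m - X n) < e" and m: "m \<ge> M" for e M m
  proof (rule ell2_bounded_partial_sums)
    fix F :: "'a set" assume F: "finite F"
    show "(\<Sum>i\<in>F. (norm (l i - coord (X m) i))\<^sup>2) \<le> e\<^sup>2"
    proof (rule LIMSEQ_le_const2)
      show "(\<lambda>n. \<Sum>i\<in>F. (norm (coord (X n) i - coord (X m) i))\<^sup>2)
              \<longlonglongrightarrow> (\<Sum>i\<in>F. (norm (l i - coord (X m) i))\<^sup>2)"
        by (intro tendsto_intros l)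
      have "(\<Sum>i\<in>F. (norm (coord (X n) i - coord (X m) i))\<^sup>2) \<le> e\<^sup>2" if n: "n \<ge> M" for n
      proof -
        have "(\<Sum>i\<in>F. (norm (coord (X n) i - coord (X m) i))\<^sup>2) \<le> (norm (X n - X m))\<^sup>2"
          unfolding norm_ell2_square coord_diff[symmetric]
          by (rule finite_sum_le_infsum) (use F summable_coord[of "X n - X m"] in auto)
        also have "\<dots> \<le> e\<^sup>2" using M n m by (intro power_mono) (auto simp: less_imp_le)
        finally show ?thesis .
      qed
      then show "\<exists>N. \<forall>n\<ge>N. (\<Sum>i\<in>F. (norm (coord (X n) i - coord (X m) i))\<^sup>2) \<le> e\<^sup>2" by blast
    qed
  qed (use e in simp)
  obtain M1 where "\<forall>m\<ge>M1. \<forall>n\<ge>M1. norm (X m - X n) < 1"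
    using X CauchyD zero_less_one by blast
  then obtain d where d: "coord d = (\<lambda>i. l i - coord (X M1) i)"
    using near[of 1 M1 M1] by auto
  define L where "L = X M1 + d"
  have L: "coord L i = l i" for i by (simp add: L_def d)
  have "X \<longlonglongrightarrow> L"
  proof (rule LIMSEQ_I)
    fix e :: real assume e: "0 < e"
    then obtain M where M: "\<forall>m\<ge>M. \<forall>n\<ge>M. norm (X m - X n) < e / 2"
      using X CauchyD half_gt_zero by blast
    have "norm (X m - L) < e" if m: "m \<ge> M" for m
    proof -
      obtain x where x: "coord x = (\<lambda>i. l i - coord (X m) i)" "norm x \<le> e / 2"
        using near[of "e / 2" M m] e M m by auto
      have "x = L - X m" by (rule ell2_eqI) (simp add: x L)
      then show ?thesis using x(2) e by (simp add: norm_minus_commute)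
    qed
    then show "\<exists>M. \<forall>m\<ge>M. norm (X m - L) < e" by blast
  qed
  then show "convergent X" by (auto simp: convergent_def)
qed

instance ell2 :: (type, chilbert_space) chilbert_space ..

definition ell2_map :: "('a \<Rightarrow> 'b) \<Rightarrow> ('i, 'a::real_normed_vector) ell2 \<Rightarrow> ('i, 'b::real_normed_vector) ell2"
  where "ell2_map f x = Abs_ell2 (\<lambda>i. f (coord x i))"

text \<open>The identification of \<open>\<Oplus>(H\<^sub>1 \<oplus> H\<^sub>2)\<close> with \<open>(\<Oplus> H\<^sub>1) \<oplus> (\<Oplus> H\<^sub>2)\<close> and its inverse.\<close>

lift_definition ell2_fst :: "('i, 'a::real_inner \<times> 'b::real_inner) ell2 \<Rightarrow> ('i, 'a) ell2"
  is "\<lambda>f i. fst (f i)"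
  by (erule summable_on_comparison_test) (auto simp: norm_prod_def)

lift_definition ell2_snd :: "('i, 'a::real_inner \<times> 'b::real_inner) ell2 \<Rightarrow> ('i, 'b) ell2"
  is "\<lambda>f i. snd (f i)"
  by (erule summable_on_comparison_test) (auto simp: norm_prod_def)

definition ell2_split :: "('i, 'a::real_inner \<times> 'b::real_inner) ell2 \<Rightarrow> ('i, 'a) ell2 \<times> ('i, 'b) ell2"
  where "ell2_split x = (ell2_fst x, ell2_snd x)"

lift_definition ell2_pair :: "('i, 'a::real_inner) ell2 \<Rightarrow> ('i, 'b::real_inner) ell2 \<Rightarrow> ('i, 'a \<times> 'b) ell2"
  is "\<lambda>f g i. (f i, g i)"
  by (simp add: norm_prod_def summable_on_add)

definition ell2_join :: "('i, 'a::real_inner) ell2 \<times> ('i, 'b::real_inner) ell2 \<Rightarrow> ('i, 'a \<times> 'b) ell2"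
  where "ell2_join p = ell2_pair (fst p) (snd p)"

lemma coord_ell2_split: "coord (fst (ell2_split x)) i = fst (coord x i)"
  "coord (snd (ell2_split x)) i = snd (coord x i)"
  by (simp_all add: ell2_split_def ell2_fst.rep_eq ell2_snd.rep_eq)

lemma coord_ell2_join: "coord (ell2_join p) i = (coord (fst p) i, coord (snd p) i)"
  by (simp add: ell2_join_def ell2_pair.rep_eq)

lemma ell2_join_split [simp]: "ell2_join (ell2_split x) = x"
  by (rule ell2_eqI) (simp add: coord_ell2_join coord_ell2_split)

lemma ell2_split_join [simp]: "ell2_split (ell2_join p) = p"
  by (auto intro!: prod_eqI ell2_eqI simp: coord_ell2_split coord_ell2_join)


section \<open>Operators between closed subspaces\<close>

text \<open>A Hilbert space that occurs as a closed subspace \<open>E\<close> of a type \<open>'a\<close> is represented by the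
  set \<open>E\<close>.  An operator from \<open>E\<close> to \<open>F\<close> is represented by a function on the ambient type, of
  which only the values on \<open>E\<close> matter.\<close>

definition bop :: "'a::complex_inner set \<Rightarrow> 'b::complex_inner set \<Rightarrow> ('a \<Rightarrow> 'b) set"
  where "bop E F = {f. f \<in> E \<rightarrow> F \<and>
    (\<forall>x\<in>E. \<forall>y\<in>E. f (x + y) = f x + f y) \<and>
    (\<forall>c. \<forall>x\<in>E. f (c *\<^sub>C x) = c *\<^sub>C f x) \<and>
    (\<exists>K. \<forall>x\<in>E. norm (f x) \<le> K * norm x)}"

definition contraction_op :: "'a::complex_inner set \<Rightarrow> 'b::complex_inner set \<Rightarrow> ('a \<Rightarrow> 'b) \<Rightarrow> bool"
  where "contraction_op E F f \<longleftrightarrow> f \<in> bop E F \<and> (\<forall>x\<in>E. norm (f x) \<le> norm x)"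

definition unitary_op :: "'a::complex_inner set \<Rightarrow> 'b::complex_inner set \<Rightarrow> ('a \<Rightarrow> 'b) \<Rightarrow> bool"
  where "unitary_op E F f \<longleftrightarrow> f \<in> bop E F \<and>
    (\<forall>x\<in>E. \<forall>y\<in>E. cinner (f x) (f y) = cinner x y) \<and> f ` E = F"

text \<open>The adjoint of \<open>f \<in> bop E F\<close>, at \<open>y \<in> F\<close>.\<close>

definition adj :: "'a::complex_inner set \<Rightarrow> ('a \<Rightarrow> 'b::complex_inner) \<Rightarrow> 'b \<Rightarrow> 'a"
  where "adj E f y = (THE x. x \<in> E \<and> (\<forall>z\<in>E. cinner (f z) y = cinner z x))"

definition positive_op :: "'a::complex_inner set \<Rightarrow> ('a \<Rightarrow> 'a) \<Rightarrow> bool"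
  where "positive_op E f \<longleftrightarrow> f \<in> bop E E \<and> (\<forall>x\<in>E. cinner (f x) x \<in> \<real>\<^sub>\<ge>\<^sub>0)"

definition op_le :: "'a::complex_inner set \<Rightarrow> ('a \<Rightarrow> 'a) \<Rightarrow> ('a \<Rightarrow> 'a) \<Rightarrow> bool"
  where "op_le E f g \<longleftrightarrow> positive_op E (\<lambda>x. g x - f x)"

definition psqrt :: "'a::complex_inner set \<Rightarrow> ('a \<Rightarrow> 'a) \<Rightarrow> 'a \<Rightarrow> 'a"
  where "psqrt E f = (THE g. positive_op E g \<and> (\<forall>x\<in>E. g (g x) = f x) \<and> (\<forall>x. x \<notin> E \<longrightarrow> g x = 0))"

text \<open>For a contraction \<open>f\<close> from \<open>E\<close> to \<open>F\<close>: the defect operators \<open>(I - f\<^sup>* f)\<^sup>\<onehalf>\<close> and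
  \<open>(I - f f\<^sup>*)\<^sup>\<onehalf>\<close>, and the closures of their ranges.\<close>

definition defect :: "'a::complex_inner set \<Rightarrow> ('a \<Rightarrow> 'b::complex_inner) \<Rightarrow> 'a \<Rightarrow> 'a"
  where "defect E f = psqrt E (\<lambda>x. x - adj E f (f x))"

definition defect_star :: "'a::complex_inner set \<Rightarrow> 'b::complex_inner set \<Rightarrow> ('a \<Rightarrow> 'b) \<Rightarrow> 'b \<Rightarrow> 'b"
  where "defect_star E F f = psqrt F (\<lambda>y. y - f (adj E f y))"

definition defect_space :: "'a::complex_inner set \<Rightarrow> ('a \<Rightarrow> 'b::complex_inner) \<Rightarrow> 'a set"
  where "defect_space E f = closure (defect E f ` E)"

definition defect_star_space :: "'a::complex_inner set \<Rightarrow> 'b::complex_inner set \<Rightarrow> ('a \<Rightarrow> 'b) \<Rightarrow> 'b set"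
  where "defect_star_space E F f = closure (defect_star E F f ` F)"

definition block_op ::
  "('a \<Rightarrow> 'c) \<Rightarrow> ('b \<Rightarrow> 'c) \<Rightarrow> ('a \<Rightarrow> 'd) \<Rightarrow> ('b \<Rightarrow> 'd) \<Rightarrow> 'a \<times> 'b \<Rightarrow> 'c::plus \<times> 'd::plus"
  where "block_op p q r s z = (p (fst z) + q (snd z), r (fst z) + s (snd z))"

text \<open>The operator \<open>J\<^sub>L\<close> on \<open>F \<oplus> \<D>\<^sub>L\<close> for a contraction \<open>L\<close> from \<open>E\<close> to \<open>F\<close>.\<close>

definition julia_op ::
  "'a::complex_inner set \<Rightarrow> 'b::complex_inner set \<Rightarrow> ('a \<Rightarrow> 'b) \<Rightarrow> 'b \<times> 'a \<Rightarrow> 'a \<times> 'b"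
  where "julia_op E F L = block_op (adj E L) (defect E L) (defect_star E F L) (\<lambda>x. - L x)"


section \<open>Row contractions\<close>

text \<open>An \<open>n\<close>-tuple of operators is a family indexed by a countable type \<open>'n\<close>; a countably infinite
  type corresponds to \<open>n = \<infinity>\<close>.  In that case the sum \<open>\<Sum> T\<^sub>i T\<^sub>i\<^sup>*\<close> is understood in the strong
  operator topology.\<close>

definition row_contraction :: "('n \<Rightarrow> 'h::complex_inner \<Rightarrow> 'h) \<Rightarrow> bool"
  where "row_contraction T \<longleftrightarrow> (\<forall>i. T i \<in> bop UNIV UNIV) \<and>
    (\<forall>h. (\<lambda>i. T i (adj UNIV (T i) h)) summable_on UNIV) \<and>
    op_le UNIV (\<lambda>h. \<Sum>\<^sub>\<infinity>i. T i (adj UNIV (T i) h)) (\<lambda>h. h)"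

definition row_op :: "('n \<Rightarrow> 'h::complex_inner \<Rightarrow> 'h) \<Rightarrow> ('n, 'h) ell2 \<Rightarrow> 'h"
  where "row_op T x = (\<Sum>\<^sub>\<infinity>i. T i (coord x i))"

abbreviation row_defect :: "('n \<Rightarrow> 'h::complex_inner \<Rightarrow> 'h) \<Rightarrow> ('n, 'h) ell2 \<Rightarrow> ('n, 'h) ell2"
  where "row_defect T \<equiv> defect UNIV (row_op T)"

abbreviation row_defect_star :: "('n \<Rightarrow> 'h::complex_inner \<Rightarrow> 'h) \<Rightarrow> 'h \<Rightarrow> 'h"
  where "row_defect_star T \<equiv> defect_star UNIV UNIV (row_op T)"

abbreviation row_defect_space :: "('n \<Rightarrow> 'h::complex_inner \<Rightarrow> 'h) \<Rightarrow> ('n, 'h) ell2 set"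
  where "row_defect_space T \<equiv> defect_space UNIV (row_op T)"

abbreviation row_defect_star_space :: "('n \<Rightarrow> 'h::complex_inner \<Rightarrow> 'h) \<Rightarrow> 'h set"
  where "row_defect_star_space T \<equiv> defect_star_space UNIV UNIV (row_op T)"

text \<open>Elements of the free semigroup are lists.\<close>

fun word_op :: "('n \<Rightarrow> 'h \<Rightarrow> 'h) \<Rightarrow> 'n list \<Rightarrow> 'h \<Rightarrow> 'h"
  where "word_op T [] = id"
  | "word_op T (i # w) = T i \<circ> word_op T w"

definition pure_row_contraction :: "('n \<Rightarrow> 'h::complex_inner \<Rightarrow> 'h) \<Rightarrow> bool"
  where "pure_row_contraction T \<longleftrightarrow> row_contraction T \<and>
    (\<forall>h. (\<lambda>k. \<Sum>\<^sub>\<infinity>w\<in>{w. length w = k}. (norm (adj UNIV (word_op T w) h))\<^sup>2) \<longlonglongrightarrow> 0)"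


section \<open>Fock space and multi-analytic operators\<close>

text \<open>Since the vectors \<open>e\<^sub>w\<close>, for \<open>w\<close> a word, form an orthonormal basis of the full Fock space
  \<open>\<Gamma>\<close>, the latter is the space of square-summable complex families indexed by words.  For a Hilbert
  space \<open>E \<subseteq> 'a\<close>, the Hilbert space tensor product \<open>\<Gamma> \<otimes> E\<close> is the space of square-summable families
  in \<open>E\<close> indexed by words, with elementary tensors \<open>\<otimes>\<close> as defined here; the lemmas below state
  the properties that characterise this tensor product.\<close>

lift_definition basis_vec :: "'i \<Rightarrow> ('i, complex) ell2"  (\<open>\<e>\<close>)
  is "\<lambda>w v. if v = w then 1 else 0"
  by (rule finite_nonzero_values_imp_summable_on) (auto intro: finite_subset[of _ "{_}"])

lift_definition tensor :: "('i, complex) ell2 \<Rightarrow> 'a::complex_inner \<Rightarrow> ('i, 'a) ell2"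
  (infixr \<open>\<otimes>\<close> 70)
  is "\<lambda>f x i. f i *\<^sub>C x"
  by (simp add: norm_scaleC power_mult_distrib summable_on_cmult_left)

lemma coord_basis_vec: "coord (\<e> w) v = (if v = w then 1 else 0)"
  by (simp add: basis_vec.rep_eq)

lemma coord_tensor: "coord (f \<otimes> x) i = coord f i *\<^sub>C x"
  by (simp add: tensor.rep_eq)

definition fock_tensor :: "'a::complex_inner set \<Rightarrow> ('n list, 'a) ell2 set"
  where "fock_tensor E = {x. \<forall>w. coord x w \<in> E}"

lemma cinner_tensor: "cinner (f \<otimes> x) (g \<otimes> y) = cinner f g * cinner x y"
proof -
  have "(\<lambda>i. coord f i * cnj (coord g i)) summable_on UNIV"
    using summable_cinner_coord[of f g] by (simp add: cinner_complex_def)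
  then have "(\<Sum>\<^sub>\<infinity>i. coord f i * cnj (coord g i) * cinner x y)
      = (\<Sum>\<^sub>\<infinity>i. coord f i * cnj (coord g i)) * cinner x y"
    by (rule infsum_cmult_left)
  moreover have "cinner (coord (f \<otimes> x) i) (coord (g \<otimes> y) i)
      = coord f i * cnj (coord g i) * cinner x y" for i
    by (simp add: coord_tensor cinner_scaleC_left cinner_scaleC_right)
  ultimately show ?thesis
    by (simp only: cinner_ell2_def cinner_complex_def)
qed

definition csubspace :: "'a::complex_vector set \<Rightarrow> bool"
  where "csubspace E \<longleftrightarrow> 0 \<in> E \<and> (\<forall>x\<in>E. \<forall>y\<in>E. x + y \<in> E) \<and> (\<forall>c. \<forall>x\<in>E. c *\<^sub>C x \<in> E)"

lemma coord_sum: "coord (sum f F) i = (\<Sum>j\<in>F. coord (f j) i)"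
  by (induction F rule: infinite_finite_induct) auto

lemma has_sum_basis_tensor: "((\<lambda>w. \<e> w \<otimes> coord x w) has_sum x) UNIV"
  unfolding has_sum_def
proof (rule LIM_zero_cancel, rule tendsto_norm_zero_cancel)
  let ?n = "\<lambda>i. (norm (coord x i))\<^sup>2"
  have norm_eq: "norm ((\<Sum>w\<in>F. \<e> w \<otimes> coord x w) - x) = sqrt ((norm x)\<^sup>2 - sum ?n F)"
    if F: "finite F" for F
  proof -
    have "coord (\<e> w \<otimes> coord x w) i = (if w = i then coord x w else 0)" for w i
      by (simp add: coord_tensor coord_basis_vec scaleC_one)
    then have "coord (\<Sum>w\<in>F. \<e> w \<otimes> coord x w) i = (if i \<in> F then coord x i else 0)" for i
      using F by (simp add: coord_sum sum.delta)
    then have "(norm ((\<Sum>w\<in>F. \<e> w \<otimes> coord x w) - x))\<^sup>2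
        = (\<Sum>\<^sub>\<infinity>i. ?n i - (if i \<in> F then ?n i else 0))"
      unfolding norm_ell2_square by (intro infsum_cong) simp
    also have "\<dots> = infsum ?n UNIV - (\<Sum>\<^sub>\<infinity>i. if i \<in> F then ?n i else 0)"
    proof -
      have "(\<lambda>i. if i \<in> F then ?n i else 0) summable_on UNIV"
        by (rule finite_nonzero_values_imp_summable_on) (rule finite_subset[OF _ F], auto)
      then have "(\<Sum>\<^sub>\<infinity>i. ?n i + - (if i \<in> F then ?n i else 0))
          = infsum ?n UNIV + (\<Sum>\<^sub>\<infinity>i. - (if i \<in> F then ?n i else 0))"
        by (intro infsum_add summable_coord) (simp only: summable_on_uminus)
      then show ?thesis by (simp only: infsum_uminus diff_conv_add_uminus)
    qed
    also have "(\<Sum>\<^sub>\<infinity>i. if i \<in> F then ?n i else 0) = infsum ?n F"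
      by (rule infsum_cong_neutral) auto
    also have "infsum ?n F = sum ?n F" using F by simp
    finally have "(norm ((\<Sum>w\<in>F. \<e> w \<otimes> coord x w) - x))\<^sup>2 = (norm x)\<^sup>2 - sum ?n F"
      by (simp add: norm_ell2_square)
    then show ?thesis by (intro real_sqrt_unique[symmetric]) simp_all
  qed
  have "(?n has_sum (norm x)\<^sup>2) UNIV"
    using summable_coord[of x] by (simp add: norm_ell2_square)
  then have "((\<lambda>F. sqrt ((norm x)\<^sup>2 - sum ?n F)) \<longlongrightarrow> sqrt ((norm x)\<^sup>2 - (norm x)\<^sup>2))
      (finite_subsets_at_top UNIV)"
    unfolding has_sum_def by (intro tendsto_intros)
  then have "((\<lambda>F. sqrt ((norm x)\<^sup>2 - sum ?n F)) \<longlongrightarrow> 0) (finite_subsets_at_top UNIV)"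
    by simp
  moreover have "\<forall>\<^sub>F F in finite_subsets_at_top UNIV.
      sqrt ((norm x)\<^sup>2 - sum ?n F) = norm ((\<Sum>w\<in>F. \<e> w \<otimes> coord x w) - x)"
    by (intro eventually_finite_subsets_at_top_weakI) (simp add: norm_eq)
  ultimately show "((\<lambda>F. norm ((\<Sum>w\<in>F. \<e> w \<otimes> coord x w) - x)) \<longlongrightarrow> 0) (finite_subsets_at_top UNIV)"
    by (rule Lim_transform_eventually)
qed

lemma bounded_linear_coord: "bounded_linear (\<lambda>x. coord x i)"
  by (rule bounded_linear_intro[of _ 1]) (auto simp: norm_coord_le)

lemma fock_tensor_eq_closure_span:
  fixes E :: "'a::complex_inner set"
  assumes E: "csubspace E" and "closed E"
  shows "(fock_tensor E :: ('n list, 'a) ell2 set) = closure (span {f \<otimes> x |f x. x \<in> E})"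
proof
  show "(fock_tensor E :: ('n list, 'a) ell2 set) \<subseteq> closure (span {f \<otimes> x |f x. x \<in> E})"
  proof
    fix x :: "('n list, 'a) ell2"
    assume x: "x \<in> fock_tensor E"
    show "x \<in> closure (span {f \<otimes> x |f x. x \<in> E})"
    proof (rule Lim_in_closed_set)
      show "(sum (\<lambda>w. \<e> w \<otimes> coord x w) \<longlongrightarrow> x) (finite_subsets_at_top UNIV)"
        using has_sum_basis_tensor[of x] by (simp add: has_sum_def)
      have "(\<Sum>w\<in>F. \<e> w \<otimes> coord x w) \<in> span {f \<otimes> x |f x. x \<in> E}" for F
        using x by (intro span_sum span_base) (auto simp: fock_tensor_def)
      then show "\<forall>\<^sub>F F in finite_subsets_at_top UNIV.
          (\<Sum>w\<in>F. \<e> w \<otimes> coord x w) \<in> closure (span {f \<otimes> x |f x. x \<in> E})"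
        using closure_subset by (intro always_eventually allI) blast
    qed auto
  qed
next
  have "closed (fock_tensor E :: ('n list, 'a) ell2 set)"
    unfolding fock_tensor_def
    by (intro closed_Collect_all closed_vimage[unfolded vimage_def] assms
        linear_continuous_on bounded_linear_coord)
  moreover have "subspace (fock_tensor E :: ('n list, 'a) ell2 set)"
    using E by (auto simp: subspace_def fock_tensor_def csubspace_def scaleR_scaleC)
  moreover have "{f \<otimes> x |f x. x \<in> E} \<subseteq> (fock_tensor E :: ('n list, 'a) ell2 set)"
    using E by (auto simp: fock_tensor_def csubspace_def coord_tensor)
  ultimately show "closure (span {f \<otimes> x |f x. x \<in> E}) \<subseteq> (fock_tensor E :: ('n list, 'a) ell2 set)"
    by (intro closure_minimal span_minimal)
qed

text \<open>The left creation operator \<open>S\<^sub>i\<close> on \<open>\<Gamma>\<close> (for \<open>'a = complex\<close>), and more generally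
  \<open>S\<^sub>i \<otimes> I\<close> on \<open>\<Gamma> \<otimes> E\<close>.\<close>

lift_definition creation :: "'n \<Rightarrow> ('n list, 'a::real_normed_vector) ell2 \<Rightarrow> ('n list, 'a) ell2"
  is "\<lambda>i f w. (case w of [] \<Rightarrow> 0 | j # v \<Rightarrow> if j = i then f v else 0)"
proof -
  fix i :: 'n and f :: "'n list \<Rightarrow> 'a"
  let ?g = "\<lambda>w. (case w of [] \<Rightarrow> 0 | j # v \<Rightarrow> if j = i then f v else 0)"
  assume "(\<lambda>w. (norm (f w))\<^sup>2) summable_on UNIV"
  then have "((\<lambda>w. (norm (?g w))\<^sup>2) \<circ> (#) i) summable_on UNIV"
    by (simp add: o_def)
  then have "(\<lambda>w. (norm (?g w))\<^sup>2) summable_on range ((#) i)"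
    by (subst summable_on_reindex) (auto simp: inj_def)
  moreover have "(\<lambda>w. (norm (?g w))\<^sup>2) summable_on range ((#) i) \<longleftrightarrow> (\<lambda>w. (norm (?g w))\<^sup>2) summable_on UNIV"
    by (rule summable_on_cong_neutral) (auto split: list.split)
  ultimately show "(\<lambda>w. (norm (?g w))\<^sup>2) summable_on UNIV" by blast
qed

lemma coord_creation:
  "coord (creation i x) w = (case w of [] \<Rightarrow> 0 | j # v \<Rightarrow> if j = i then coord x v else 0)"
  by (simp add: creation.rep_eq)

lemma creation_basis_vec: "creation i (\<e> w) = \<e> (i # w)"
  by (rule ell2_eqI) (auto simp: coord_creation coord_basis_vec split: list.splits)

lemma creation_tensor: "creation i (f \<otimes> x) = creation i f \<otimes> x"
  by (rule ell2_eqI) (auto simp: coord_creation coord_tensor split: list.splits)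

text \<open>\<open>I\<^sub>\<Gamma> \<otimes> \<sigma>\<close>.\<close>

abbreviation fock_map ::
  "('a \<Rightarrow> 'b) \<Rightarrow> ('n list, 'a::complex_inner) ell2 \<Rightarrow> ('n list, 'b::complex_inner) ell2"
  where "fock_map \<sigma> \<equiv> ell2_map \<sigma>"

lemma fock_map_tensor:
  assumes "\<sigma> \<in> bop E F" "x \<in> E"
  shows "fock_map \<sigma> (f \<otimes> x) = f \<otimes> \<sigma> x"
proof -
  have "(\<lambda>i. \<sigma> (coord (f \<otimes> x) i)) = coord (f \<otimes> \<sigma> x)"
    using assms by (auto simp: bop_def coord_tensor)
  then show ?thesis by (simp add: ell2_map_def coord_inverse)
qed

text \<open>\<open>X \<oplus> I\<close> from \<open>\<Gamma> \<otimes> (E \<oplus> G)\<close> to \<open>\<Gamma> \<otimes> (F \<oplus> G)\<close>, for \<open>X\<close> from \<open>\<Gamma> \<otimes> E\<close> to \<open>\<Gamma> \<otimes> F\<close>.\<close>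

definition fock_diag_id ::
  "(('n list, 'a::complex_inner) ell2 \<Rightarrow> ('n list, 'b::complex_inner) ell2) \<Rightarrow>
    ('n list, 'a \<times> 'c::complex_inner) ell2 \<Rightarrow> ('n list, 'b \<times> 'c) ell2"
  where "fock_diag_id X = ell2_join \<circ> block_op X (\<lambda>_. 0) (\<lambda>_. 0) id \<circ> ell2_split"

definition multi_analytic :: "'a::complex_inner set \<Rightarrow> 'b::complex_inner set \<Rightarrow>
    (('n list, 'a) ell2 \<Rightarrow> ('n list, 'b) ell2) \<Rightarrow> bool"
  where "multi_analytic E F M \<longleftrightarrow> M \<in> bop (fock_tensor E) (fock_tensor F) \<and>
    (\<forall>i. \<forall>x\<in>fock_tensor E. M (creation i x) = creation i (M x))"

definition char_symbol :: "('n \<Rightarrow> 'h::complex_inner \<Rightarrow> 'h) \<Rightarrow> ('n, 'h) ell2 \<Rightarrow> ('n list, 'h) ell2"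
  where "char_symbol T h = - (\<e> [] \<otimes> (\<Sum>\<^sub>\<infinity>i. T i (coord h i))) +
    (\<Sum>\<^sub>\<infinity>i. creation i (\<Sum>\<^sub>\<infinity>w. \<e> w \<otimes> row_defect_star T
       (adj UNIV (word_op T w) (coord (row_defect T h) i))))"

definition char_fun ::
  "('n \<Rightarrow> 'h::complex_inner \<Rightarrow> 'h) \<Rightarrow> ('n list, ('n, 'h) ell2) ell2 \<Rightarrow> ('n list, 'h) ell2"
  where "char_fun T = (THE M. multi_analytic (row_defect_space T) (row_defect_star_space T) M \<and>
    (\<forall>h\<in>row_defect_space T. M (\<e> [] \<otimes> h) = char_symbol T h) \<and>
    (\<forall>x. x \<notin> fock_tensor (row_defect_space T) \<longrightarrow> M x = 0))"


section \<open>Regular factorizations\<close>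

definition contractive_multi_analytic :: "'a::complex_inner set \<Rightarrow> 'b::complex_inner set \<Rightarrow>
    (('n list, 'a) ell2 \<Rightarrow> ('n list, 'b) ell2) \<Rightarrow> bool"
  where "contractive_multi_analytic E F M \<longleftrightarrow> multi_analytic E F M \<and>
    contraction_op (fock_tensor E) (fock_tensor F) M"

text \<open>The isometry \<open>Z\<^sub>3\<close> of a factorization \<open>\<Theta> = \<Theta>\<^sub>3 \<Theta>\<^sub>2 \<Theta>\<^sub>1\<close> and its codomain, where \<open>\<Theta>\<^sub>i\<close> acts
  from \<open>\<Gamma> \<otimes> E\<^sub>i\<close> to \<open>\<Gamma> \<otimes> E\<^sub>i\<^sub>+\<^sub>1\<close>.\<close>

definition Z3_codomain where
  "Z3_codomain E1 E2 E3 \<Theta>3 \<Theta>2 \<Theta>1 =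
    defect_space (fock_tensor E3) \<Theta>3 \<times> defect_space (fock_tensor E2) \<Theta>2 \<times>
    defect_space (fock_tensor E1) \<Theta>1"

definition Z3 where
  "Z3 E1 E2 E3 \<Theta> \<Theta>3 \<Theta>2 \<Theta>1 = (THE Z.
    Z \<in> bop (defect_space (fock_tensor E1) \<Theta>) (Z3_codomain E1 E2 E3 \<Theta>3 \<Theta>2 \<Theta>1) \<and>
    (\<forall>f\<in>fock_tensor E1. Z (defect (fock_tensor E1) \<Theta> f) =
      (defect (fock_tensor E3) \<Theta>3 (\<Theta>2 (\<Theta>1 f)),
       defect (fock_tensor E2) \<Theta>2 (\<Theta>1 f),
       defect (fock_tensor E1) \<Theta>1 f)) \<and>
    (\<forall>x. x \<notin> defect_space (fock_tensor E1) \<Theta> \<longrightarrow> Z x = 0))"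

definition three_regular_factorization ::
  "'a::complex_inner set \<Rightarrow> 'b::complex_inner set \<Rightarrow> 'c::complex_inner set \<Rightarrow> 'd::complex_inner set \<Rightarrow>
   (('n list, 'a) ell2 \<Rightarrow> ('n list, 'd) ell2) \<Rightarrow>
   (('n list, 'c) ell2 \<Rightarrow> ('n list, 'd) ell2) \<Rightarrow>
   (('n list, 'b) ell2 \<Rightarrow> ('n list, 'c) ell2) \<Rightarrow>
   (('n list, 'a) ell2 \<Rightarrow> ('n list, 'b) ell2) \<Rightarrow> bool"
  where "three_regular_factorization E1 E2 E3 E4 \<Theta> \<Theta>3 \<Theta>2 \<Theta>1 \<longleftrightarrow>
    contractive_multi_analytic E1 E4 \<Theta> \<and>
    contractive_multi_analytic E3 E4 \<Theta>3 \<and>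
    contractive_multi_analytic E2 E3 \<Theta>2 \<and>
    contractive_multi_analytic E1 E2 \<Theta>1 \<and>
    (\<forall>f\<in>fock_tensor E1. \<Theta> f = \<Theta>3 (\<Theta>2 (\<Theta>1 f))) \<and>
    unitary_op (defect_space (fock_tensor E1) \<Theta>) (Z3_codomain E1 E2 E3 \<Theta>3 \<Theta>2 \<Theta>1)
      (Z3 E1 E2 E3 \<Theta> \<Theta>3 \<Theta>2 \<Theta>1)"

end

theory Submission
  imports Defs
begin

text \<open>
  For \<open>\<Theta> = \<Theta>\<^sub>3 \<Theta>\<^sub>2 \<Theta>\<^sub>1\<close> one has \<open>\<parallel>\<Delta>\<^sub>\<Theta> f\<parallel>\<^sup>2 = \<parallel>\<Delta>\<^sub>3 \<Theta>\<^sub>2 \<Theta>\<^sub>1 f\<parallel>\<^sup>2 + \<parallel>\<Delta>\<^sub>2 \<Theta>\<^sub>1 f\<parallel>\<^sup>2 + \<parallel>\<Delta>\<^sub>1 f\<parallel>\<^sup>2\<close>, because the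
  right-hand side telescopes.  Hence \<open>Z\<^sub>3\<close> always is an isometry, and the factorization is regular
  as soon as the vectors \<open>(\<Delta>\<^sub>3 \<Theta>\<^sub>2 \<Theta>\<^sub>1 f, \<Delta>\<^sub>2 \<Theta>\<^sub>1 f, \<Delta>\<^sub>1 f)\<close> are dense in the codomain
  (\<open>isometric_extension\<close>, \<open>three_regularI\<close>).  Here \<open>\<Delta>\<^sub>2 = 0\<close>, since the Julia operator \<open>J\<^sub>L\<close> is isometric
  (\<open>julia_isometry\<close>), so only the first and the last component matter.

  If \<open>B\<close> is pure, then \<open>\<Theta>\<^sub>B\<close> is isometric (\<open>char_fun_isometric\<close>), so that \<open>\<Delta>\<^sub>3 = 0\<close> as well and density
  is trivial.  If \<open>T\<close> is pure, so is \<open>B\<close>, because \<open>T\<^sub>\<alpha>\<^sup>*\<close> maps \<open>0 \<oplus> k\<close> to \<open>0 \<oplus> B\<^sub>\<alpha>\<^sup>* k\<close>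
  (\<open>pure_compression\<close>).

  If \<open>\<parallel>L\<^sup>* x\<parallel> < \<parallel>x\<parallel>\<close> for all \<open>x \<noteq> 0\<close>, then also \<open>\<parallel>L y\<parallel> < \<parallel>y\<parallel>\<close> for all \<open>y \<noteq> 0\<close>
  (\<open>strict_of_strict_adj\<close>).  In that case the self-adjoint operator \<open>D\<^sub>L\<close> is injective, so it has dense
  range, and so has \<open>I \<otimes> D\<^sub>L\<close> on \<open>\<Gamma> \<otimes> \<D>\<^sub>B\<close>.  To approximate \<open>(\<Delta>\<^sub>3 a, 0, \<Delta>\<^sub>1 f)\<close>, change \<open>f\<close> by the
  vector that \<open>I \<otimes> \<sigma>\<close> maps to \<open>0 \<oplus> g\<close>.  The last component does not change, because \<open>\<Theta>\<^sub>1\<close> is isometric on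
  that vector, while the first component of \<open>\<Theta>\<^sub>2 \<Theta>\<^sub>1 f\<close>, on which alone \<open>\<Delta>\<^sub>3\<close> depends, changes by
  \<open>(I \<otimes> D\<^sub>L) g\<close> and can thus be moved arbitrarily close to that of \<open>a\<close>.

  The facts about characteristic functions come from reading \<open>\<Theta>\<^sub>T\<close> as the input-output map of a
  linear system indexed by words: with input \<open>x\<close> and state \<open>h\<close>,
  the output at \<open>w\<close> is \<open>D\<^sub>T\<^sub>* h\<^sub>w - T x\<^sub>w\<close> and the state at \<open>w i\<close> is the \<open>i\<close>-th coordinate of
  \<open>T\<^sup>* h\<^sub>w + D\<^sub>T x\<^sub>w\<close>.  One step of this system conserves the sum of the squared norms, which makes
  the input-output map contractive; if \<open>T\<close> is pure, no energy stays in the state for ever,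
  and the map is isometric.

  Square roots, adjoints and the completeness arguments behind them are developed for closed
  subspaces of Hilbert spaces: adjoints by the Riesz representation theorem, and the positive square
  root of \<open>I - C\<close> by the iteration \<open>Y\<^sub>k\<^sub>+\<^sub>1 = (C + Y\<^sub>k\<^sup>2) / 2\<close>.
\<close>

section \<open>Closed complex subspaces and bounded operators between them\<close>

lemma scaleC_minus_right: "c *\<^sub>C (- x) = - (c *\<^sub>C (x :: 'a :: complex_vector))"
  using scaleC_add_right[of c x "- x"] by (simp add: eq_neg_iff_add_eq_0 add.commute)

lemma scaleC_diff_right: "c *\<^sub>C (x - y) = c *\<^sub>C x - c *\<^sub>C (y :: 'a :: complex_vector)"
  using scaleC_add_right[of c x "- y"] by (simp add: scaleC_minus_right)

lemma scaleC_minus_one: "(- 1) *\<^sub>C x = - (x :: 'a :: complex_vector)"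
  using scaleR_scaleC[of "- 1" x] by simp

lemma cinner_scaleR_left: "cinner (r *\<^sub>R x) y = of_real r * cinner x y"
  by (simp add: scaleR_scaleC cinner_scaleC_left)

lemma cinner_scaleR_right: "cinner x (r *\<^sub>R y) = of_real r * cinner x y"
  by (simp add: scaleR_scaleC cinner_scaleC_right)

lemma cinner_minus_left: "cinner (- x) y = - cinner x y"
  using cinner_scaleR_left[of "- 1" x y] by simp

lemma cinner_minus_right: "cinner x (- y) = - cinner x y"
  using cinner_scaleR_right[of x "- 1" y] by simp

lemma cinner_diff_left: "cinner (x - y) z = cinner x z - cinner y z"
  using cinner_add_left[of x "- y" z] by (simp add: cinner_minus_left)

lemma cinner_diff_right: "cinner x (y - z) = cinner x y - cinner x z"
  using cinner_add_right[of x y "- z"] by (simp add: cinner_minus_right)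

lemma bounded_linear_cinner_left: "bounded_linear (\<lambda>x. cinner x y)"
  by (rule bounded_linear_intro[of _ "norm y"])
    (auto simp: cinner_add_left cinner_scaleR_left scaleR_conv_of_real norm_cinner_le)

lemma bounded_linear_cinner_right: "bounded_linear (\<lambda>y. cinner x y)"
  by (rule bounded_linear_intro[of _ "norm x"])
    (auto simp: cinner_add_right cinner_scaleR_right scaleR_conv_of_real norm_cinner_le mult.commute
      intro: order_trans[OF norm_cinner_le])

lemma bounded_linear_scaleC: "bounded_linear (\<lambda>x :: 'a :: complex_inner. c *\<^sub>C x)"
  by (rule bounded_linear_intro[of _ "cmod c"])
    (auto simp: scaleC_add_right norm_scaleC mult.commute scaleR_scaleC scaleC_scaleC)

lemma norm_add_square: "(norm (x + y))\<^sup>2 = (norm x)\<^sup>2 + (norm y)\<^sup>2 + 2 * inner x y"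
  for x y :: "'a :: real_inner"
  by (simp add: power2_norm_eq_inner inner_add_left inner_add_right inner_commute)

lemma norm_prod_square: "(norm p)\<^sup>2 = (norm (fst p))\<^sup>2 + (norm (snd p))\<^sup>2"
  for p :: "'a :: real_inner \<times> 'b :: real_inner"
  by (simp add: norm_prod_def)

definition closed_csubspace :: "'a::complex_inner set \<Rightarrow> bool"
  where "closed_csubspace E \<longleftrightarrow> csubspace E \<and> closed E"

lemma csubspace_0: "csubspace E \<Longrightarrow> 0 \<in> E"
  and csubspace_add: "csubspace E \<Longrightarrow> x \<in> E \<Longrightarrow> y \<in> E \<Longrightarrow> x + y \<in> E"
  and csubspace_scaleC: "csubspace E \<Longrightarrow> x \<in> E \<Longrightarrow> c *\<^sub>C x \<in> E"
  by (auto simp: csubspace_def)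

lemma csubspace_scaleR: "csubspace E \<Longrightarrow> x \<in> E \<Longrightarrow> r *\<^sub>R x \<in> E"
  by (simp add: scaleR_scaleC csubspace_scaleC)

lemma csubspace_minus: "csubspace E \<Longrightarrow> x \<in> E \<Longrightarrow> - x \<in> E"
  using csubspace_scaleC[of E x "- 1"] by (simp add: scaleC_minus_one)

lemma csubspace_diff: "csubspace E \<Longrightarrow> x \<in> E \<Longrightarrow> y \<in> E \<Longrightarrow> x - y \<in> E"
  using csubspace_add[of E x "- y"] by (simp add: csubspace_minus)

lemma csubspace_sum: "csubspace E \<Longrightarrow> (\<And>i. i \<in> F \<Longrightarrow> f i \<in> E) \<Longrightarrow> sum f F \<in> E"
  by (induction F rule: infinite_finite_induct) (auto intro: csubspace_0 csubspace_add)

lemmas csubspace_closed_ops = csubspace_0 csubspace_add csubspace_scaleC csubspace_scaleR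
  csubspace_minus csubspace_diff

lemma csubspace_UNIV: "csubspace UNIV"
  by (simp add: csubspace_def)

lemma closed_csubspace_UNIV [simp]: "closed_csubspace UNIV"
  by (simp add: closed_csubspace_def csubspace_def)

lemma closed_csubspace_Times:
  "closed_csubspace E \<Longrightarrow> closed_csubspace F \<Longrightarrow> closed_csubspace (E \<times> F)"
  by (auto simp: closed_csubspace_def csubspace_def scaleC_prod_def zero_prod_def intro: closed_Times)

lemma closed_csubspace_closure:
  fixes E :: "'a::complex_inner set"
  assumes E: "csubspace E"
  shows "closed_csubspace (closure E)"
  unfolding closed_csubspace_def csubspace_def
proof (intro conjI ballI allI)
  show "0 \<in> closure E" using closure_subset csubspace_0[OF E] by blast
next
  fix x y assume "x \<in> closure E" "y \<in> closure E"
  then obtain f g where "\<And>n. f n \<in> E" "f \<longlonglongrightarrow> x" "\<And>n. g n \<in> E" "g \<longlonglongrightarrow> y"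
    unfolding closure_sequential by blast
  then show "x + y \<in> closure E"
    unfolding closure_sequential by (intro exI[of _ "\<lambda>n. f n + g n"])
      (auto intro: tendsto_add csubspace_add[OF E])
next
  fix c x assume "x \<in> closure E"
  then obtain f where "\<And>n. f n \<in> E" "f \<longlonglongrightarrow> x"
    unfolding closure_sequential by blast
  then show "c *\<^sub>C x \<in> closure E"
    unfolding closure_sequential by (intro exI[of _ "\<lambda>n. c *\<^sub>C f n"])
      (auto intro: bounded_linear.tendsto[OF bounded_linear_scaleC] csubspace_scaleC[OF E])
qed simp

lemma image_in_closure: "x \<in> E \<Longrightarrow> g x \<in> closure (g ` E)"
  by (rule subsetD[OF closure_subset imageI])

lemma bop_in: "f \<in> bop E F \<Longrightarrow> x \<in> E \<Longrightarrow> f x \<in> F"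
  and bop_add: "f \<in> bop E F \<Longrightarrow> x \<in> E \<Longrightarrow> y \<in> E \<Longrightarrow> f (x + y) = f x + f y"
  and bop_scaleC: "f \<in> bop E F \<Longrightarrow> x \<in> E \<Longrightarrow> f (c *\<^sub>C x) = c *\<^sub>C f x"
  by (auto simp: bop_def)

lemma bop_scaleR: "f \<in> bop E F \<Longrightarrow> x \<in> E \<Longrightarrow> f (r *\<^sub>R x) = r *\<^sub>R f x"
  by (simp add: scaleR_scaleC bop_scaleC)

lemma bop_minus: "f \<in> bop E F \<Longrightarrow> x \<in> E \<Longrightarrow> f (- x) = - f x"
  using bop_scaleR[of f E F x "- 1"] by simp

lemma bop_diff: "f \<in> bop E F \<Longrightarrow> csubspace E \<Longrightarrow> x \<in> E \<Longrightarrow> y \<in> E \<Longrightarrow> f (x - y) = f x - f y"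
  using bop_add[of f E F x "- y"] by (simp add: csubspace_minus bop_minus)

lemma bop_zero: "f \<in> bop E F \<Longrightarrow> csubspace E \<Longrightarrow> f 0 = 0"
  using bop_scaleR[of f E F 0 0] by (simp add: csubspace_0)

lemma bop_sum:
  "f \<in> bop E F \<Longrightarrow> csubspace E \<Longrightarrow> (\<And>i. i \<in> I \<Longrightarrow> g i \<in> E) \<Longrightarrow> f (sum g I) = (\<Sum>i\<in>I. f (g i))"
  by (induction I rule: infinite_finite_induct) (auto simp: bop_zero bop_add csubspace_sum)

lemma bop_bound:
  assumes "f \<in> bop E F"
  obtains K where "K \<ge> 0" "\<And>x. x \<in> E \<Longrightarrow> norm (f x) \<le> K * norm x"
proof -
  obtain K where K: "\<forall>x\<in>E. norm (f x) \<le> K * norm x" using assms by (auto simp: bop_def)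
  have "norm (f x) \<le> max K 0 * norm x" if "x \<in> E" for x
    using K that mult_right_mono[OF max.cobounded1[of K 0] norm_ge_zero[of x]] by force
  then show ?thesis using that[of "max K 0"] by auto
qed

lemma bopI:
  assumes "\<And>x. x \<in> E \<Longrightarrow> f x \<in> F"
    and "\<And>x y. x \<in> E \<Longrightarrow> y \<in> E \<Longrightarrow> f (x + y) = f x + f y"
    and "\<And>c x. x \<in> E \<Longrightarrow> f (c *\<^sub>C x) = c *\<^sub>C f x"
    and "\<And>x. x \<in> E \<Longrightarrow> norm (f x) \<le> K * norm x"
  shows "f \<in> bop E F"
  using assms unfolding bop_def by blast

lemma bop_cong: "(\<And>x. x \<in> E \<Longrightarrow> f x = g x) \<Longrightarrow> csubspace E \<Longrightarrow> f \<in> bop E F \<Longrightarrow> g \<in> bop E F"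
  by (auto simp: bop_def Pi_iff csubspace_add csubspace_scaleC)

lemma bop_continuous_on:
  assumes "f \<in> bop E F" "csubspace E"
  shows "continuous_on E f"
proof -
  obtain K where "K \<ge> 0" and K: "\<And>x. x \<in> E \<Longrightarrow> norm (f x) \<le> K * norm x"
    using bop_bound[OF assms(1)] by blast
  have "K-lipschitz_on E f"
  proof (rule lipschitz_onI)
    fix x y assume "x \<in> E" "y \<in> E"
    then show "dist (f x) (f y) \<le> K * dist x y"
      using K[of "x - y"] by (simp add: dist_norm bop_diff[OF assms] csubspace_diff[OF assms(2)])
  qed fact
  then show ?thesis by (rule lipschitz_on_continuous_on)
qed

lemma bop_tendsto:
  assumes "f \<in> bop E F" "csubspace E" "(g \<longlongrightarrow> x) G" "x \<in> E" "eventually (\<lambda>n. g n \<in> E) G"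
  shows "((\<lambda>n. f (g n)) \<longlongrightarrow> f x) G"
  using continuous_on_tendsto_compose[OF bop_continuous_on[OF assms(1,2)] assms(3-5)] .

lemma bop_UNIV_bounded_linear:
  assumes "f \<in> bop UNIV UNIV"
  shows "bounded_linear f"
proof -
  obtain K where "\<And>x. x \<in> UNIV \<Longrightarrow> norm (f x) \<le> K * norm x" using bop_bound[OF assms] by blast
  then show ?thesis
    by (intro bounded_linear_intro[of f K]) (simp_all add: bop_add[OF assms] bop_scaleR[OF assms] mult.commute)
qed

lemma bop_compose:
  assumes f: "f \<in> bop E F" and g: "g \<in> bop F G"
  shows "(\<lambda>x. g (f x)) \<in> bop E G"
proof -
  obtain K where "K \<ge> 0" and K: "\<And>x. x \<in> E \<Longrightarrow> norm (f x) \<le> K * norm x"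
    using bop_bound[OF f] by blast
  obtain K' where "K' \<ge> 0" and K': "\<And>x. x \<in> F \<Longrightarrow> norm (g x) \<le> K' * norm x"
    using bop_bound[OF g] by blast
  show ?thesis
  proof (rule bopI)
    fix x assume x: "x \<in> E"
    have "norm (g (f x)) \<le> K' * norm (f x)" using x f K' bop_in by blast
    also have "\<dots> \<le> K' * (K * norm x)" using K[OF x] \<open>K' \<ge> 0\<close> by (rule mult_left_mono)
    finally show "norm (g (f x)) \<le> (K' * K) * norm x" by (simp add: mult.assoc)
  qed (use f g in \<open>auto simp: bop_in bop_add bop_scaleC\<close>)
qed

lemma contraction_opI:
  assumes "\<And>x. x \<in> E \<Longrightarrow> f x \<in> F"
    and "\<And>x y. x \<in> E \<Longrightarrow> y \<in> E \<Longrightarrow> f (x + y) = f x + f y"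
    and "\<And>c x. x \<in> E \<Longrightarrow> f (c *\<^sub>C x) = c *\<^sub>C f x"
    and "\<And>x. x \<in> E \<Longrightarrow> norm (f x) \<le> norm x"
  shows "contraction_op E F f"
  unfolding contraction_op_def using bopI[of E f F 1] assms by auto

lemma contraction_bop: "contraction_op E F f \<Longrightarrow> f \<in> bop E F"
  and contraction_norm: "contraction_op E F f \<Longrightarrow> x \<in> E \<Longrightarrow> norm (f x) \<le> norm x"
  by (auto simp: contraction_op_def)

lemma contraction_compose:
  assumes "contraction_op E F f" "contraction_op F G g"
  shows "contraction_op E G (\<lambda>x. g (f x))"
  using assms bop_compose[of f E F g G] unfolding contraction_op_def
  by (meson bop_in order_trans)

lemma csubspace_image: "csubspace E \<Longrightarrow> f \<in> bop E F \<Longrightarrow> csubspace (f ` E)"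
  unfolding csubspace_def
proof (intro conjI ballI allI)
  assume E: "0 \<in> E \<and> (\<forall>x\<in>E. \<forall>y\<in>E. x + y \<in> E) \<and> (\<forall>c. \<forall>x\<in>E. c *\<^sub>C x \<in> E)"
    and f: "f \<in> bop E F"
  then have E': "csubspace E" by (simp add: csubspace_def)
  show "0 \<in> f ` E" using bop_zero[OF f E'] csubspace_0[OF E'] by (metis imageI)
  show "x + y \<in> f ` E" if "x \<in> f ` E" "y \<in> f ` E" for x y
    using that bop_add[OF f] csubspace_add[OF E'] by (metis (no_types, lifting) imageE imageI)
  show "c *\<^sub>C x \<in> f ` E" if "x \<in> f ` E" for c x
    using that bop_scaleC[OF f] csubspace_scaleC[OF E'] by (metis (no_types, lifting) imageE imageI)
qed

section \<open>Riesz representation and adjoints\<close>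

text \<open>Near \<open>t = 0\<close> the linear term dominates.  This is the first variation argument for quadratic
  functionals; it serves for the Riesz representation and for the Cauchy--Schwarz inequality of a
  positive operator.\<close>

lemma linear_coefficient_zero:
  fixes a b :: real
  assumes "\<And>t. 0 \<le> t * b + t\<^sup>2 * a"
  shows "b = 0"
proof (rule ccontr)
  assume b: "b \<noteq> 0"
  define c where "c = \<bar>a\<bar> + 1"
  have c: "c > 0" "a < c" by (auto simp: c_def)
  have "0 \<le> (- b / c) * b + (- b / c)\<^sup>2 * a" by (rule assms)
  also have "\<dots> = (b\<^sup>2 / c\<^sup>2) * (a - c)" using c by (simp add: power2_eq_square field_simps)
  also have "\<dots> < 0" using b c by (intro mult_pos_neg) auto
  finally show False by simp
qed

text \<open>The representing vector minimises \<open>\<parallel>x\<parallel>\<^sup>2 - 2 Re \<phi>(x)\<close> over \<open>E\<close>: by the parallelogram identity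
  a minimising sequence is Cauchy, and the first variation of the functional vanishes at the limit.
  This determines the real part of \<open>\<phi>\<close>, and replacing \<open>z\<close> by \<open>\<i> z\<close> gives the imaginary part.\<close>

lemma riesz_representation:
  fixes E :: "'a::chilbert_space set"
  assumes E: "closed_csubspace E"
    and add: "\<And>x y. x \<in> E \<Longrightarrow> y \<in> E \<Longrightarrow> \<phi> (x + y) = \<phi> x + \<phi> y"
    and scale: "\<And>c x. x \<in> E \<Longrightarrow> \<phi> (c *\<^sub>C x) = c * \<phi> x"
    and bound: "\<And>x. x \<in> E \<Longrightarrow> cmod (\<phi> x) \<le> K * norm x"
  shows "\<exists>x\<in>E. \<forall>z\<in>E. \<phi> z = cinner z x"
proof -
  have cE: "csubspace E" and clE: "closed E" using E by (auto simp: closed_csubspace_def)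
  define J where "J x = (norm x)\<^sup>2 - 2 * Re (\<phi> x)" for x
  have scaleR: "\<phi> (r *\<^sub>R x) = of_real r * \<phi> x" if "x \<in> E" for r x
    using scale[OF that] by (simp add: scaleR_scaleC)
  have J_lower: "- K\<^sup>2 \<le> J x" if "x \<in> E" for x
  proof -
    have "Re (\<phi> x) \<le> K * norm x" using bound[OF that] complex_Re_le_cmod order_trans by blast
    then show ?thesis using zero_le_power2[of "norm x - K"] by (simp add: J_def power2_diff mult.commute)
  qed
  define m where "m = Inf (J ` E)"
  have bdd: "bdd_below (J ` E)" using J_lower by (intro bdd_belowI[of _ "- K\<^sup>2"]) auto
  have m_le: "m \<le> J x" if "x \<in> E" for x
    unfolding m_def by (rule cInf_lower[OF _ bdd]) (use that in auto)
  have "\<exists>x\<in>E. J x < m + 1 / real (Suc n)" for n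
  proof -
    have "Inf (J ` E) < m + 1 / real (Suc n)" by (simp add: m_def)
    then show ?thesis using cInf_lessD[of "J ` E"] csubspace_0[OF cE] by auto
  qed
  then obtain X where XE: "\<And>n. X n \<in> E" and X: "\<And>n. J (X n) < m + 1 / real (Suc n)" by metis
  have par: "(norm (x - y))\<^sup>2 \<le> 2 * (J x - m) + 2 * (J y - m)" if xy: "x \<in> E" "y \<in> E" for x y
  proof -
    let ?z = "(1 / 2) *\<^sub>R (x + y)"
    have "?z \<in> E" using xy cE by (intro csubspace_closed_ops)
    then have "m \<le> J ?z" by (rule m_le)
    also have "J ?z = (norm (x + y))\<^sup>2 / 4 - Re (\<phi> x) - Re (\<phi> y)"
    proof -
      have "\<phi> ?z = of_real (1 / 2) * (\<phi> x + \<phi> y)"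
        by (simp only: scaleR[OF csubspace_add[OF cE xy]] add[OF xy])
      then have "Re (\<phi> ?z) = (Re (\<phi> x) + Re (\<phi> y)) / 2"
        by (simp only: times_complex.sel plus_complex.sel Re_complex_of_real Im_complex_of_real)
      then show ?thesis unfolding J_def norm_scaleR power_mult_distrib by (simp add: power_divide)
    qed
    finally have "4 * m \<le> (norm (x + y))\<^sup>2 - 4 * Re (\<phi> x) - 4 * Re (\<phi> y)" by simp
    moreover have "(norm (x - y))\<^sup>2 + (norm (x + y))\<^sup>2 = 2 * (norm x)\<^sup>2 + 2 * (norm y)\<^sup>2"
      using norm_add_square[of x y] norm_add_square[of x "- y"] by simp
    ultimately show ?thesis by (simp add: J_def)
  qed
  have "Cauchy X"
  proof (rule CauchyI)
    fix e :: real assume e: "0 < e"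
    then obtain N where N: "4 / e\<^sup>2 < real N" using reals_Archimedean2 by blast
    have "norm (X p - X q) < e" if "p \<ge> N" "q \<ge> N" for p q
    proof -
      have small: "J (X k) - m < e\<^sup>2 / 4" if "k \<ge> N" for k
      proof -
        have "4 / e\<^sup>2 < real (Suc k)" using N that by linarith
        then have "1 / real (Suc k) < e\<^sup>2 / 4" using e by (simp add: field_simps)
        then show ?thesis using X[of k] by linarith
      qed
      have "2 * (J (X p) - m) + 2 * (J (X q) - m) < 2 * (e\<^sup>2 / 4) + 2 * (e\<^sup>2 / 4)"
        using small[OF that(1)] small[OF that(2)] by (intro add_strict_mono mult_strict_left_mono) auto
      then have "(norm (X p - X q))\<^sup>2 < e\<^sup>2" using par[OF XE XE, of p q] by simp
      then show ?thesis using e by (simp add: power2_less_imp_less)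
    qed
    then show "\<exists>N. \<forall>p\<ge>N. \<forall>q\<ge>N. norm (X p - X q) < e" by blast
  qed
  then obtain x where x: "X \<longlonglongrightarrow> x" using convergent_eq_Cauchy[of X] by (auto simp: convergent_def)
  have xE: "x \<in> E" using closed_sequentially[OF clE XE x] .
  have real_part: "Re (\<phi> z) = inner z x" if z: "z \<in> E" for z
  proof -
    have "0 \<le> t * (2 * (inner x z - Re (\<phi> z))) + t\<^sup>2 * (norm z)\<^sup>2" for t
    proof (rule tendsto_lowerbound)
      show "((\<lambda>n. t * (2 * (inner (X n) z - Re (\<phi> z))) + t\<^sup>2 * (norm z)\<^sup>2 + 1 / real (Suc n))
          \<longlongrightarrow> t * (2 * (inner x z - Re (\<phi> z))) + t\<^sup>2 * (norm z)\<^sup>2) sequentially"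
      proof -
        have "(\<lambda>n. t * (2 * (inner (X n) z - Re (\<phi> z))) + t\<^sup>2 * (norm z)\<^sup>2)
            \<longlonglongrightarrow> t * (2 * (inner x z - Re (\<phi> z))) + t\<^sup>2 * (norm z)\<^sup>2"
          by (intro tendsto_intros x)
        from tendsto_add[OF this LIMSEQ_Suc[OF lim_1_over_n]] show ?thesis by (simp only: add_0_right)
      qed
      have "0 \<le> t * (2 * (inner (X n) z - Re (\<phi> z))) + t\<^sup>2 * (norm z)\<^sup>2 + 1 / real (Suc n)" for n
      proof -
        have "m \<le> J (X n + t *\<^sub>R z)" using XE z cE by (intro m_le csubspace_closed_ops)
        also have "\<dots> = J (X n) + t * (2 * (inner (X n) z - Re (\<phi> z))) + t\<^sup>2 * (norm z)\<^sup>2"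
          using add[OF XE csubspace_scaleR[OF cE z], of n t] scaleR[OF z, of t]
          by (simp add: J_def norm_add_square power_mult_distrib algebra_simps)
        finally show ?thesis using X[of n] by linarith
      qed
      then show "\<forall>\<^sub>F n in sequentially.
          0 \<le> t * (2 * (inner (X n) z - Re (\<phi> z))) + t\<^sup>2 * (norm z)\<^sup>2 + 1 / real (Suc n)" by simp
    qed simp
    from linear_coefficient_zero[OF this] show ?thesis by (simp add: inner_commute)
  qed
  have "\<phi> z = cinner z x" if z: "z \<in> E" for z
  proof (rule complex_eqI)
    show "Re (\<phi> z) = Re (cinner z x)" using real_part[OF z] by (simp add: inner_eq_Re_cinner)
    show "Im (\<phi> z) = Im (cinner z x)"
      using real_part[OF csubspace_scaleC[OF cE z, of \<i>]] scale[OF z, of \<i>]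
      by (simp add: inner_eq_Re_cinner cinner_scaleC_left)
  qed
  with xE show ?thesis by blast
qed

text \<open>Testing against vectors of \<open>E\<close> suffices because \<open>x - y\<close> itself lies in \<open>E\<close>.\<close>

lemma cinner_eq_on_subspace:
  assumes "csubspace E" "x \<in> E" "y \<in> E" "\<And>z. z \<in> E \<Longrightarrow> cinner z x = cinner z y"
  shows "x = y"
proof -
  have "cinner (x - y) (x - y) = 0"
    using assms(4)[OF csubspace_diff[OF assms(1-3)]] by (simp add: cinner_diff_right)
  then show ?thesis by (simp add: cinner_self)
qed

lemma adj_eqI:
  assumes "csubspace E" "x \<in> E" "\<And>z. z \<in> E \<Longrightarrow> cinner (f z) y = cinner z x"
  shows "adj E f y = x"
  unfolding adj_def
proof (rule the_equality)
  fix x' assume "x' \<in> E \<and> (\<forall>z\<in>E. cinner (f z) y = cinner z x')"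
  then show "x' = x" using cinner_eq_on_subspace[OF assms(1), of x' x] assms(2,3) by metis
qed (use assms in auto)

context
  fixes E :: "'a::chilbert_space set" and F :: "'b::complex_inner set" and f
  assumes E: "closed_csubspace E" and f: "f \<in> bop E F"
begin

lemma adj_exists: "\<exists>x\<in>E. \<forall>z\<in>E. cinner (f z) y = cinner z x"
proof -
  obtain K where "K \<ge> 0" and K: "\<And>x. x \<in> E \<Longrightarrow> norm (f x) \<le> K * norm x"
    using bop_bound[OF f] by blast
  show ?thesis
  proof (rule riesz_representation[OF E])
    fix x assume "x \<in> E"
    then have "norm (f x) * norm y \<le> K * norm x * norm y" by (intro mult_right_mono K) auto
    then show "cmod (cinner (f x) y) \<le> (K * norm y) * norm x"
      using norm_cinner_le[of "f x" y] by (simp add: algebra_simps)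
  qed (use f in \<open>auto simp: bop_add bop_scaleC cinner_add_left cinner_scaleC_left\<close>)
qed

lemma adj_in: "adj E f y \<in> E"
  and cinner_adj: "z \<in> E \<Longrightarrow> cinner z (adj E f y) = cinner (f z) y"
proof -
  obtain x where x: "x \<in> E" "\<And>z. z \<in> E \<Longrightarrow> cinner (f z) y = cinner z x" using adj_exists by blast
  then have "adj E f y = x" using E by (intro adj_eqI) (auto simp: closed_csubspace_def)
  then show "adj E f y \<in> E" "z \<in> E \<Longrightarrow> cinner z (adj E f y) = cinner (f z) y"
    using x by auto
qed

lemma inner_adj: "z \<in> E \<Longrightarrow> inner z (adj E f y) = inner (f z) y"
  by (simp add: inner_eq_Re_cinner cinner_adj)

lemma cinner_adj_left: "z \<in> E \<Longrightarrow> cinner (adj E f y) z = cinner y (f z)"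
  using cinner_adj[of z y] by (metis cinner_commute)

lemma adj_norm_le:
  assumes "K \<ge> 0" and K: "\<And>x. x \<in> E \<Longrightarrow> norm (f x) \<le> K * norm x"
  shows "norm (adj E f y) \<le> K * norm y"
proof (cases "adj E f y = 0")
  case True
  then show ?thesis using \<open>K \<ge> 0\<close> by simp
next
  case False
  have "(norm (adj E f y))\<^sup>2 = inner (f (adj E f y)) y"
    using inner_adj[OF adj_in] by (simp add: power2_norm_eq_inner)
  also have "\<dots> \<le> norm (f (adj E f y)) * norm y" by (rule norm_cauchy_schwarz)
  also have "\<dots> \<le> K * norm (adj E f y) * norm y" by (intro mult_right_mono K adj_in) simp
  finally have "norm (adj E f y) * norm (adj E f y) \<le> norm (adj E f y) * (K * norm y)"
    by (simp add: power2_eq_square algebra_simps)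
  then show ?thesis using False by simp
qed

lemma adj_bop: "adj E f \<in> bop G E"
proof -
  have cE: "csubspace E" using E by (simp add: closed_csubspace_def)
  obtain K where K: "K \<ge> 0" "\<And>x. x \<in> E \<Longrightarrow> norm (f x) \<le> K * norm x"
    using bop_bound[OF f] by blast
  show ?thesis
  proof (rule bopI)
    fix x y assume "x \<in> G" "y \<in> G"
    show "adj E f (x + y) = adj E f x + adj E f y"
      by (rule adj_eqI[OF cE]) (auto simp: adj_in csubspace_add[OF cE] cinner_add_right cinner_adj)
  next
    fix c x assume "x \<in> G"
    show "adj E f (c *\<^sub>C x) = c *\<^sub>C adj E f x"
      by (rule adj_eqI[OF cE]) (auto simp: adj_in csubspace_scaleC[OF cE] cinner_scaleC_right cinner_adj)
  next
    fix x
    show "norm (adj E f x) \<le> K * norm x" using adj_norm_le[OF K] .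
  qed (rule adj_in)
qed

end

section \<open>Square roots of positive contractions\<close>

text \<open>If \<open>I - Y\<close> is a square root of \<open>I - C\<close>, then \<open>Y = (C + Y\<^sup>2) / 2\<close>.  Iterating this equation
  from \<open>0\<close> gives polynomials in \<open>C\<close>, so that every operator intertwining \<open>C\<close> and \<open>C'\<close> also
  intertwines the iterates, and, in the limit, the square roots.\<close>

fun sqrt_iter :: "('a::real_normed_vector \<Rightarrow> 'a) \<Rightarrow> nat \<Rightarrow> 'a \<Rightarrow> 'a" where
  "sqrt_iter C 0 x = 0"
| "sqrt_iter C (Suc k) x = (1 / 2) *\<^sub>R (C x + sqrt_iter C k (sqrt_iter C k x))"

text \<open>The iteration for the scalar \<open>C = 1\<close>; it dominates the norms of \<open>sqrt_iter\<close> and of its increments.\<close>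

fun sqrt_bound :: "nat \<Rightarrow> real" where
  "sqrt_bound 0 = 0"
| "sqrt_bound (Suc k) = (1 + (sqrt_bound k)\<^sup>2) / 2"

lemma sqrt_bound_ge_0: "0 \<le> sqrt_bound k"
  by (induction k) auto

lemma sqrt_bound_le_1: "sqrt_bound k \<le> 1"
proof (induction k)
  case (Suc k)
  then have "(sqrt_bound k)\<^sup>2 \<le> 1" by (simp add: sqrt_bound_ge_0 power_le_one)
  then show ?case by simp
qed simp

lemma sqrt_bound_Suc_ge: "sqrt_bound k \<le> sqrt_bound (Suc k)"
  using zero_le_power2[of "sqrt_bound k - 1"] by (simp add: power2_diff)

lemma sqrt_bound_Cauchy: "Cauchy sqrt_bound"
proof -
  have "incseq sqrt_bound" by (intro incseq_SucI sqrt_bound_Suc_ge)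
  then have "convergent sqrt_bound" using sqrt_bound_le_1
    by (intro Bseq_monoseq_convergent BseqI'[of _ 1])
      (auto simp: sqrt_bound_ge_0 mono_def monoseq_def incseq_def)
  then show ?thesis by (rule convergent_Cauchy)
qed

lemma sqrt_iter_contraction:
  assumes E: "csubspace E" and C: "contraction_op E E C"
  shows "sqrt_iter C k \<in> bop E E" "x \<in> E \<Longrightarrow> norm (sqrt_iter C k x) \<le> sqrt_bound k * norm x"
proof (induction k arbitrary: x)
  case 0
  case 1 show ?case by (rule bopI[of _ _ _ 0]) (auto simp: csubspace_0[OF E])
  case 2 show ?case by simp
next
  case (Suc k)
  note IH = Suc
  have C': "C \<in> bop E E" using C by (rule contraction_bop)
  have in1: "sqrt_iter C k x \<in> E" if "x \<in> E" for x using IH(1) that by (rule bop_in)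
  have bound: "norm (sqrt_iter C (Suc k) x) \<le> sqrt_bound (Suc k) * norm x" if x: "x \<in> E" for x
  proof -
    have "norm (sqrt_iter C k (sqrt_iter C k x)) \<le> sqrt_bound k * norm (sqrt_iter C k x)"
      using IH(2)[OF in1[OF x]] .
    also have "\<dots> \<le> sqrt_bound k * (sqrt_bound k * norm x)"
      by (intro mult_left_mono IH(2) x sqrt_bound_ge_0)
    finally have "norm (C x + sqrt_iter C k (sqrt_iter C k x)) \<le> norm x + (sqrt_bound k)\<^sup>2 * norm x"
      by (intro order_trans[OF norm_triangle_ineq] add_mono contraction_norm[OF C x])
        (simp add: power2_eq_square mult.assoc)
    then show ?thesis by (simp add: distrib_right add_divide_distrib del: scaleR_add_right)
  qed
  case 1
  show ?case
    by (rule bopI[OF _ _ _ bound])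
      (auto simp: in1 csubspace_closed_ops[OF E] bop_in[OF C'] bop_add[OF C'] bop_add[OF IH(1)]
        bop_scaleC[OF C'] bop_scaleC[OF IH(1)] scaleC_add_right scaleR_scaleC scaleC_scaleC mult.commute)
  case 2
  then show ?case by (rule bound)
qed

lemma sqrt_iter_intertwine:
  assumes X: "X \<in> bop E F" and E: "csubspace E" and C: "contraction_op E E C"
    and XC: "\<And>x. x \<in> E \<Longrightarrow> X (C x) = C' (X x)" and "x \<in> E"
  shows "X (sqrt_iter C k x) = sqrt_iter C' k (X x)"
  using \<open>x \<in> E\<close>
proof (induction k arbitrary: x)
  case 0 then show ?case by (simp add: bop_zero[OF X E])
next
  case (Suc k)
  have i: "sqrt_iter C k x \<in> E" if "x \<in> E" for x
    using bop_in[OF sqrt_iter_contraction(1)[OF E C] that] .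
  have "C x \<in> E" using Suc.prems bop_in[OF contraction_bop[OF C]] by blast
  then show ?case using Suc i
    by (simp add: bop_scaleR[OF X] bop_add[OF X] csubspace_add[OF E] XC)
qed

lemma sqrt_iter_selfadjoint:
  assumes E: "csubspace E" and C: "contraction_op E E C"
    and sa: "\<And>x y. x \<in> E \<Longrightarrow> y \<in> E \<Longrightarrow> cinner (C x) y = cinner x (C y)"
    and "x \<in> E" "y \<in> E"
  shows "cinner (sqrt_iter C k x) y = cinner x (sqrt_iter C k y)"
  using assms(4,5)
proof (induction k arbitrary: x y)
  case (Suc k)
  have i: "sqrt_iter C k x \<in> E" if "x \<in> E" for x
    using bop_in[OF sqrt_iter_contraction(1)[OF E C] that] .
  show ?case using Suc i
    by (simp add: cinner_scaleR_left cinner_scaleR_right cinner_add_left cinner_add_right sa)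
qed simp

text \<open>Since \<open>Y\<^sub>k\<^sub>+\<^sub>1 - Y\<^sub>k = (Y\<^sub>k (Y\<^sub>k - Y\<^sub>k\<^sub>-\<^sub>1) + (Y\<^sub>k - Y\<^sub>k\<^sub>-\<^sub>1) Y\<^sub>k\<^sub>-\<^sub>1) / 2\<close>, the scalar iteration for
  \<open>C = 1\<close> dominates the operator iteration.\<close>

lemma sqrt_iter_step:
  assumes E: "csubspace E" and C: "contraction_op E E C" and "x \<in> E"
  shows "norm (sqrt_iter C (Suc k) x - sqrt_iter C k x) \<le> (sqrt_bound (Suc k) - sqrt_bound k) * norm x"
  using \<open>x \<in> E\<close>
proof (induction k arbitrary: x)
  case 0
  show ?case using contraction_norm[OF C 0] by simp
next
  case (Suc k)
  let ?Y = "sqrt_iter C k" and ?Z = "sqrt_iter C (Suc k)"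
  let ?b = "sqrt_bound k" and ?c = "sqrt_bound (Suc k)"
  note Y = sqrt_iter_contraction[OF E C, where k = k] and Z = sqrt_iter_contraction[OF E C, where k = "Suc k"]
  have YE: "?Y x \<in> E" and ZE: "?Z x \<in> E"
    using Suc.prems bop_in[OF Y(1)] bop_in[OF Z(1)] by blast+
  have "sqrt_iter C (Suc (Suc k)) x - ?Z x = (1 / 2) *\<^sub>R (?Z (?Z x) - ?Y (?Y x))"
    by (simp only: sqrt_iter.simps(2)[of C "Suc k" x] sqrt_iter.simps(2)[of C k x])
      (simp add: scaleR_diff_right[symmetric])
  also have "?Z (?Z x) - ?Y (?Y x) = ?Z (?Z x - ?Y x) + (?Z (?Y x) - ?Y (?Y x))"
    using bop_diff[OF Z(1) E ZE YE] by simp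
  finally have eq: "norm (sqrt_iter C (Suc (Suc k)) x - ?Z x)
      = norm (?Z (?Z x - ?Y x) + (?Z (?Y x) - ?Y (?Y x))) / 2"
    by simp
  have "norm (?Z (?Z x - ?Y x)) \<le> ?c * norm (?Z x - ?Y x)"
    by (rule Z(2)[OF csubspace_diff[OF E ZE YE]])
  also have "\<dots> \<le> ?c * ((?c - ?b) * norm x)"
    by (rule mult_left_mono[OF Suc.IH[OF Suc.prems] sqrt_bound_ge_0])
  finally have 1: "norm (?Z (?Z x - ?Y x)) \<le> ?c * ((?c - ?b) * norm x)" .
  have "norm (?Z (?Y x) - ?Y (?Y x)) \<le> (?c - ?b) * norm (?Y x)"
    by (rule Suc.IH[OF YE])
  also have "\<dots> \<le> (?c - ?b) * (?b * norm x)"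
    using Y(2)[OF Suc.prems] sqrt_bound_Suc_ge[of k] by (intro mult_left_mono) auto
  finally have "norm (?Z (?Z x - ?Y x) + (?Z (?Y x) - ?Y (?Y x)))
      \<le> ?c * ((?c - ?b) * norm x) + (?c - ?b) * (?b * norm x)"
    using 1 norm_triangle_ineq[of "?Z (?Z x - ?Y x)" "?Z (?Y x) - ?Y (?Y x)"] by linarith
  also have "\<dots> = (?c\<^sup>2 - ?b\<^sup>2) * norm x" by (simp only: power2_eq_square) (simp only: algebra_simps)
  also have "\<dots> = 2 * ((sqrt_bound (Suc (Suc k)) - ?c) * norm x)"
    unfolding sqrt_bound.simps(2)[of "Suc k"] by (simp add: algebra_simps power2_eq_square)
  finally show ?case using eq by simp
qed

definition sqrt_limit :: "('a::real_normed_vector \<Rightarrow> 'a) \<Rightarrow> 'a \<Rightarrow> 'a"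
  where "sqrt_limit C x = lim (\<lambda>k. sqrt_iter C k x)"

context
  fixes E :: "'a::chilbert_space set" and C :: "'a \<Rightarrow> 'a"
  assumes E: "closed_csubspace E" and C: "contraction_op E E C"
begin

lemma sqrt_iter_tendsto:
  assumes x: "x \<in> E"
  shows "(\<lambda>k. sqrt_iter C k x) \<longlonglongrightarrow> sqrt_limit C x"
proof -
  have cE: "csubspace E" using E by (simp add: closed_csubspace_def)
  have le: "norm (sqrt_iter C (k + d) x - sqrt_iter C k x) \<le> (sqrt_bound (k + d) - sqrt_bound k) * norm x"
    for k d
  proof (induction d)
    case (Suc d)
    have "norm (sqrt_iter C (k + Suc d) x - sqrt_iter C k x)
        \<le> norm (sqrt_iter C (Suc (k + d)) x - sqrt_iter C (k + d) x) + norm (sqrt_iter C (k + d) x - sqrt_iter C k x)"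
      using norm_triangle_ineq[of "sqrt_iter C (Suc (k + d)) x - sqrt_iter C (k + d) x"
          "sqrt_iter C (k + d) x - sqrt_iter C k x"] by simp
    also have "\<dots> \<le> (sqrt_bound (Suc (k + d)) - sqrt_bound (k + d)) * norm x
        + (sqrt_bound (k + d) - sqrt_bound k) * norm x"
      by (intro add_mono Suc.IH sqrt_iter_step[OF cE C x])
    finally show ?case by (simp add: algebra_simps)
  qed simp
  have "Cauchy (\<lambda>k. sqrt_iter C k x)"
  proof (rule CauchyI')
    fix e :: real assume e: "0 < e"
    define e' where "e' = e / (norm x + 1)"
    have e': "0 < e'" using e by (simp add: e'_def add_nonneg_pos)
    then obtain N where N: "\<And>m n. m \<ge> N \<Longrightarrow> n \<ge> N \<Longrightarrow> norm (sqrt_bound m - sqrt_bound n) < e'"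
      using CauchyD[OF sqrt_bound_Cauchy e'] by blast
    have "norm (sqrt_iter C m x - sqrt_iter C n x) < e" if "m \<ge> N" "n > m" for m n
    proof -
      have "norm (sqrt_iter C n x - sqrt_iter C m x) \<le> (sqrt_bound n - sqrt_bound m) * norm x"
        using le[of m "n - m"] that by simp
      also have "\<dots> \<le> e' * norm x" using N[of n m] that by (intro mult_right_mono) auto
      also have "\<dots> < e' * (norm x + 1)" using e' by simp
      also have "\<dots> = e" by (simp add: e'_def add_nonneg_pos less_imp_neq[symmetric])
      finally show ?thesis by (simp add: norm_minus_commute)
    qed
    then show "\<exists>M. \<forall>m\<ge>M. \<forall>n>m. dist (sqrt_iter C m x) (sqrt_iter C n x) < e"
      unfolding dist_norm by blast
  qed
  then show ?thesis unfolding sqrt_limit_def by (simp add: Cauchy_convergent_iff convergent_LIMSEQ_iff)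
qed

lemma sqrt_limit_contraction: "contraction_op E E (sqrt_limit C)"
proof (rule contraction_opI)
  have cE: "csubspace E" and clE: "closed E" using E by (auto simp: closed_csubspace_def)
  note iter = sqrt_iter_contraction[OF cE C]
  show "sqrt_limit C x \<in> E" if "x \<in> E" for x
    using closed_sequentially[OF clE _ sqrt_iter_tendsto[OF that]] bop_in[OF iter(1) that] by blast
  show "sqrt_limit C (x + y) = sqrt_limit C x + sqrt_limit C y" if "x \<in> E" "y \<in> E" for x y
    using sqrt_iter_tendsto[OF csubspace_add[OF cE that]] that
      tendsto_add[OF sqrt_iter_tendsto[OF that(1)] sqrt_iter_tendsto[OF that(2)]]
    by (simp add: bop_add[OF iter(1)] LIMSEQ_unique)
  show "sqrt_limit C (c *\<^sub>C x) = c *\<^sub>C sqrt_limit C x" if "x \<in> E" for c x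
    using sqrt_iter_tendsto[OF csubspace_scaleC[OF cE that, of c]] that
      bounded_linear.tendsto[OF bounded_linear_scaleC sqrt_iter_tendsto[OF that], of c]
    by (simp add: bop_scaleC[OF iter(1)] LIMSEQ_unique)
  show "norm (sqrt_limit C x) \<le> norm x" if "x \<in> E" for x
  proof (rule LIMSEQ_le_const2[OF tendsto_norm[OF sqrt_iter_tendsto[OF that]]])
    show "\<exists>N. \<forall>n\<ge>N. norm (sqrt_iter C n x) \<le> norm x"
      using iter(2)[OF that] sqrt_bound_le_1 mult_left_le_one_le[of "norm x"]
      by (meson norm_ge_zero order_trans sqrt_bound_ge_0)
  qed
qed

lemma sqrt_limit_equation:
  assumes x: "x \<in> E"
  shows "2 *\<^sub>R sqrt_limit C x = C x + sqrt_limit C (sqrt_limit C x)"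
proof -
  have cE: "csubspace E" using E by (simp add: closed_csubspace_def)
  note iter = sqrt_iter_contraction[OF cE C]
  let ?Y = "sqrt_limit C"
  have Yx: "?Y x \<in> E" using bop_in[OF contraction_bop[OF sqrt_limit_contraction] x] .
  have "(\<lambda>k. sqrt_iter C k (sqrt_iter C k x) - sqrt_iter C k (?Y x)) \<longlonglongrightarrow> 0"
  proof (rule Lim_null_comparison)
    show "(\<lambda>k. norm (sqrt_iter C k x - ?Y x)) \<longlonglongrightarrow> 0"
      using sqrt_iter_tendsto[OF x] by (simp add: LIM_zero tendsto_norm_zero)
    have "norm (sqrt_iter C k (sqrt_iter C k x) - sqrt_iter C k (?Y x)) \<le> norm (sqrt_iter C k x - ?Y x)" for k
    proof -
      have E': "sqrt_iter C k x \<in> E" using bop_in[OF iter(1) x] .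
      have "norm (sqrt_iter C k (sqrt_iter C k x - ?Y x)) \<le> sqrt_bound k * norm (sqrt_iter C k x - ?Y x)"
        by (rule iter(2)[OF csubspace_diff[OF cE E' Yx]])
      also have "\<dots> \<le> norm (sqrt_iter C k x - ?Y x)"
        by (simp add: mult_left_le_one_le sqrt_bound_ge_0 sqrt_bound_le_1)
      finally show ?thesis by (simp add: bop_diff[OF iter(1) cE E' Yx])
    qed
    then show "\<forall>\<^sub>F k in sequentially. norm (sqrt_iter C k (sqrt_iter C k x) - sqrt_iter C k (?Y x))
        \<le> norm (sqrt_iter C k x - ?Y x)" by simp
  qed
  from tendsto_add[OF this sqrt_iter_tendsto[OF Yx]]
  have "(\<lambda>k. sqrt_iter C k (sqrt_iter C k x)) \<longlonglongrightarrow> ?Y (?Y x)" by simp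
  then have "(\<lambda>k. sqrt_iter C (Suc k) x) \<longlonglongrightarrow> (1 / 2) *\<^sub>R (C x + ?Y (?Y x))"
    by (auto intro!: tendsto_intros)
  then have "?Y x = (1 / 2) *\<^sub>R (C x + ?Y (?Y x))"
    using LIMSEQ_unique LIMSEQ_Suc[OF sqrt_iter_tendsto[OF x]] by blast
  then show ?thesis by (metis divide_self_if scaleR_one scaleR_scaleR times_divide_eq_right mult.right_neutral zero_neq_numeral)
qed

lemma sqrt_limit_selfadjoint:
  assumes sa: "\<And>x y. x \<in> E \<Longrightarrow> y \<in> E \<Longrightarrow> cinner (C x) y = cinner x (C y)"
    and xy: "x \<in> E" "y \<in> E"
  shows "cinner (sqrt_limit C x) y = cinner x (sqrt_limit C y)"
proof -
  have cE: "csubspace E" using E by (simp add: closed_csubspace_def)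
  have "(\<lambda>k. cinner (sqrt_iter C k x) y) \<longlonglongrightarrow> cinner (sqrt_limit C x) y"
    by (rule bounded_linear.tendsto[OF bounded_linear_cinner_left sqrt_iter_tendsto[OF xy(1)]])
  moreover have "(\<lambda>k. cinner x (sqrt_iter C k y)) \<longlonglongrightarrow> cinner x (sqrt_limit C y)"
    by (rule bounded_linear.tendsto[OF bounded_linear_cinner_right sqrt_iter_tendsto[OF xy(2)]])
  ultimately show ?thesis
    using sqrt_iter_selfadjoint[OF cE C sa xy] by (simp add: LIMSEQ_unique)
qed

end

lemma sqrt_limit_intertwine:
  fixes E :: "'a::chilbert_space set" and F :: "'b::chilbert_space set"
  assumes E: "closed_csubspace E" and C: "contraction_op E E C"
    and F: "closed_csubspace F" and C': "contraction_op F F C'"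
    and X: "X \<in> bop E F" and XC: "\<And>x. x \<in> E \<Longrightarrow> X (C x) = C' (X x)" and x: "x \<in> E"
  shows "X (sqrt_limit C x) = sqrt_limit C' (X x)"
proof -
  have cE: "csubspace E" using E by (simp add: closed_csubspace_def)
  have "(\<lambda>k. X (sqrt_iter C k x)) \<longlonglongrightarrow> X (sqrt_limit C x)"
    by (rule bop_tendsto[OF X cE sqrt_iter_tendsto[OF E C x]])
      (simp_all add: bop_in[OF contraction_bop[OF sqrt_limit_contraction[OF E C]] x]
        bop_in[OF sqrt_iter_contraction(1)[OF cE C] x])
  moreover have "(\<lambda>k. sqrt_iter C' k (X x)) \<longlonglongrightarrow> sqrt_limit C' (X x)"
    by (rule sqrt_iter_tendsto[OF F C' bop_in[OF X x]])
  ultimately show ?thesis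
    using sqrt_iter_intertwine[OF X cE C XC x] by (simp add: LIMSEQ_unique)
qed

text \<open>Polarization: the sesquilinear form \<open>\<langle>g x, y\<rangle> - \<langle>x, g y\<rangle>\<close> vanishes on the diagonal, hence everywhere;
  replacing \<open>y\<close> by \<open>\<i> y\<close> separates the two terms.\<close>

lemma selfadjoint_of_real_form:
  assumes E: "csubspace E" and g: "g \<in> bop E E"
    and real: "\<And>x. x \<in> E \<Longrightarrow> cinner (g x) x \<in> \<real>" and x: "x \<in> E" and y: "y \<in> E"
  shows "cinner (g x) y = cinner x (g y)"
proof -
  define h where "h x y = cinner (g x) y - cinner x (g y)" for x y
  have h0: "h z z = 0" if "z \<in> E" for z
    using Reals_cnj_iff[THEN iffD1, OF real[OF that]] cinner_commute[of z "g z"] by (simp add: h_def)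
  have sum: "h x z + h z x = 0" if "z \<in> E" for z
    using h0[OF csubspace_add[OF E x that]] h0[OF x] h0[OF that]
    by (simp add: h_def bop_add[OF g x that] cinner_add_left cinner_add_right algebra_simps)
  have "\<i> * (h y x - h x y) = 0"
    using sum[OF csubspace_scaleC[OF E y, of \<i>]]
    by (simp add: h_def bop_scaleC[OF g y] cinner_scaleC_left cinner_scaleC_right algebra_simps)
  then have "h x y = 0" using sum[OF y] by simp
  then show ?thesis by (simp add: h_def)
qed

lemma positive_op_selfadjoint:
  assumes "csubspace E" "positive_op E g" "x \<in> E" "y \<in> E"
  shows "cinner (g x) y = cinner x (g y)"
  by (rule selfadjoint_of_real_form[of E])
    (use assms in \<open>auto simp: positive_op_def nonneg_Reals_def\<close>)

text \<open>A case of the Cauchy--Schwarz inequality for the form \<open>\<langle>g x, y\<rangle>\<close>: evaluate it at \<open>y + t g y\<close> and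
  let \<open>t\<close> be small.\<close>

lemma positive_op_zero:
  assumes E: "csubspace E" and g: "positive_op E g" and y: "y \<in> E" and 0: "cinner (g y) y = 0"
  shows "g y = 0"
proof -
  have b: "g \<in> bop E E" using g by (simp add: positive_op_def)
  have gy: "g y \<in> E" by (rule bop_in[OF b y])
  have "0 \<le> t * (2 * (norm (g y))\<^sup>2) + t\<^sup>2 * inner (g (g y)) (g y)" for t
  proof -
    have z: "y + t *\<^sub>R g y \<in> E" using y gy E by (intro csubspace_closed_ops)
    then have "cinner (g (y + t *\<^sub>R g y)) (y + t *\<^sub>R g y) \<in> \<real>\<^sub>\<ge>\<^sub>0"
      using g by (simp add: positive_op_def)
    then have "0 \<le> inner (g (y + t *\<^sub>R g y)) (y + t *\<^sub>R g y)"
      by (simp add: complex_nonneg_Reals_iff inner_eq_Re_cinner)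
    moreover have "g (y + t *\<^sub>R g y) = g y + t *\<^sub>R g (g y)"
      using bop_add[OF b y csubspace_scaleR[OF E gy]] bop_scaleR[OF b gy] by simp
    moreover have "inner (g (g y)) y = inner (g y) (g y)"
      using positive_op_selfadjoint[OF E g gy y] by (simp add: inner_eq_Re_cinner)
    moreover have "inner (g y) y = 0" using 0 by (simp add: inner_eq_Re_cinner)
    ultimately show ?thesis
      by (simp add: inner_add_left inner_add_right power2_norm_eq_inner)
        (simp add: power2_eq_square algebra_simps)
  qed
  from linear_coefficient_zero[OF this] show ?thesis by simp
qed

text \<open>For uniqueness, let \<open>R\<close> be the root obtained by iteration and \<open>g\<close> another positive root.  They
  commute, so \<open>y = R x - g x\<close> satisfies \<open>(R + g) y = R\<^sup>2 x - g\<^sup>2 x = 0\<close>.  By positivity \<open>R y = g y = 0\<close>,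
  and then \<open>\<parallel>y\<parallel>\<^sup>2 = \<langle>x, R y\<rangle> - \<langle>x, g y\<rangle> = 0\<close>.\<close>

lemma psqrt_I_minus:
  fixes E :: "'a::chilbert_space set"
  assumes E: "closed_csubspace E" and C: "contraction_op E E C"
    and sa: "\<And>x y. x \<in> E \<Longrightarrow> y \<in> E \<Longrightarrow> cinner (C x) y = cinner x (C y)"
  shows "psqrt E (\<lambda>x. x - C x) = (\<lambda>x. if x \<in> E then x - sqrt_limit C x else 0)"
  unfolding psqrt_def
proof (rule the_equality)
  let ?Y = "sqrt_limit C" and ?R = "\<lambda>x. if x \<in> E then x - sqrt_limit C x else 0"
  have cE: "csubspace E" using E by (simp add: closed_csubspace_def)
  have Y: "contraction_op E E ?Y" by (rule sqrt_limit_contraction[OF E C])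
  note Yb = contraction_bop[OF Y]
  have YE: "?Y x \<in> E" if "x \<in> E" for x using bop_in[OF Yb that] .
  have Ysa: "cinner (?Y x) y = cinner x (?Y y)" if "x \<in> E" "y \<in> E" for x y
    by (rule sqrt_limit_selfadjoint[OF E C sa that])
  have RE: "?R x \<in> E" if "x \<in> E" for x using that YE csubspace_diff[OF cE] by auto
  have Rb: "?R \<in> bop E E"
  proof (rule bopI)
    fix x assume x: "x \<in> E"
    have "norm (x - ?Y x) \<le> norm x + norm (?Y x)" by (rule norm_triangle_ineq4)
    then show "norm (?R x) \<le> 2 * norm x" using contraction_norm[OF Y x] x by simp
  qed (auto simp: csubspace_closed_ops[OF cE] YE bop_add[OF Yb] bop_scaleC[OF Yb] scaleC_diff_right)
  have Rsq: "?R (?R x) = x - C x" if x: "x \<in> E" for x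
  proof -
    have "?R (?R x) = x - 2 *\<^sub>R ?Y x + ?Y (?Y x)"
      using x RE[OF x] bop_diff[OF Yb cE x YE[OF x]]
      by (simp add: csubspace_diff[OF cE x YE[OF x]] scaleR_2 algebra_simps)
    then show ?thesis using sqrt_limit_equation[OF E C x] by simp
  qed
  have Rpos: "positive_op E ?R"
    unfolding positive_op_def
  proof (intro conjI Rb ballI)
    fix x assume x: "x \<in> E"
    have im: "Im (cinner (?Y x) x) = 0"
      using arg_cong[OF Ysa[OF x x], of Im] arg_cong[OF cinner_commute[of "?Y x" x], of Im] by simp
    have "Re (cinner (?Y x) x) \<le> norm (?Y x) * norm x"
      using norm_cauchy_schwarz[of "?Y x" x] by (simp add: inner_eq_Re_cinner)
    also have "\<dots> \<le> norm x * norm x" by (intro mult_right_mono contraction_norm[OF Y x]) simp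
    finally show "cinner (?R x) x \<in> \<real>\<^sub>\<ge>\<^sub>0"
      using x im by (simp add: cinner_diff_left cinner_self complex_nonneg_Reals_iff power2_eq_square)
  qed
  then show "positive_op E ?R \<and> (\<forall>x\<in>E. ?R (?R x) = x - C x) \<and> (\<forall>x. x \<notin> E \<longrightarrow> ?R x = 0)"
    using Rsq by auto
  fix g assume g: "positive_op E g \<and> (\<forall>x\<in>E. g (g x) = x - C x) \<and> (\<forall>x. x \<notin> E \<longrightarrow> g x = 0)"
  then have gpos: "positive_op E g" and gsq: "\<And>x. x \<in> E \<Longrightarrow> g (g x) = x - C x"
    and g0: "\<And>x. x \<notin> E \<Longrightarrow> g x = 0" by auto
  have gb: "g \<in> bop E E" using gpos by (simp add: positive_op_def)
  have gE: "g x \<in> E" if "x \<in> E" for x using bop_in[OF gb that] .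
  have CE: "C x \<in> E" if "x \<in> E" for x using bop_in[OF contraction_bop[OF C] that] .
  \<comment> \<open>\<open>g\<close> commutes with \<open>C = I - g\<^sup>2\<close>, hence with the limit of the iteration.\<close>
  have gC: "g (C x) = C (g x)" if x: "x \<in> E" for x
  proof -
    have "g (x - C x) = g x - C (g x)" using gsq[OF x] gsq[OF gE[OF x]] by simp
    then show ?thesis using bop_diff[OF gb cE x CE[OF x]] by simp
  qed
  have gY: "g (?Y x) = ?Y (g x)" if "x \<in> E" for x
    by (rule sqrt_limit_intertwine[OF E C E C gb gC that])
  show "g = ?R"
  proof
    fix x
    show "g x = ?R x"
    proof (cases "x \<in> E")
      case x: True
      define y where "y = ?R x - g x"
      have y: "y \<in> E" unfolding y_def by (rule csubspace_diff[OF cE RE[OF x] gE[OF x]])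
      have "g (?R x) = ?R (g x)"
        using x gE[OF x] gY[OF x] bop_diff[OF gb cE x YE[OF x]] by simp
      then have "?R y + g y = 0"
        using bop_diff[OF Rb cE RE[OF x] gE[OF x]] bop_diff[OF gb cE RE[OF x] gE[OF x]]
          Rsq[OF x] gsq[OF x] unfolding y_def by simp
      then have "cinner (?R y) y + cinner (g y) y = 0" by (metis cinner_add_left cinner_zero_left)
      moreover have "cinner (?R y) y \<in> \<real>\<^sub>\<ge>\<^sub>0" "cinner (g y) y \<in> \<real>\<^sub>\<ge>\<^sub>0"
        using Rpos gpos y by (simp_all add: positive_op_def)
      ultimately have "cinner (?R y) y = 0" "cinner (g y) y = 0"
        by (auto simp: complex_nonneg_Reals_iff complex_eq_iff)
      then have R0: "?R y = 0" and g0: "g y = 0"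
        using positive_op_zero[OF cE Rpos y] positive_op_zero[OF cE gpos y] by blast+
      have "cinner y y = cinner (?R x) y - cinner (g x) y"
        unfolding y_def by (simp add: cinner_diff_left)
      also have "cinner (?R x) y = cinner x (?R y)" by (rule positive_op_selfadjoint[OF cE Rpos x y])
      also have "cinner (g x) y = cinner x (g y)" by (rule positive_op_selfadjoint[OF cE gpos x y])
      finally have "cinner y y = 0" unfolding R0 g0 by simp
      then have "y = 0" by (simp add: cinner_self)
      then show ?thesis unfolding y_def by simp
    qed (simp add: g0)
  qed
qed

section \<open>Defect operators and the Julia operator\<close>

text \<open>The operators in question are only determined on \<open>E\<close>, and the square root does not see more.\<close>

lemma psqrt_cong: "(\<And>x. x \<in> E \<Longrightarrow> f x = g x) \<Longrightarrow> psqrt E f = psqrt E g"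
  unfolding psqrt_def by (rule arg_cong[where f = The]) auto

lemma adj_contraction:
  fixes E :: "'a::chilbert_space set"
  assumes "closed_csubspace E" "contraction_op E F f"
  shows "contraction_op G E (adj E f)"
  unfolding contraction_op_def
  using adj_bop[OF assms(1) contraction_bop[OF assms(2)]]
    adj_norm_le[OF assms(1) contraction_bop[OF assms(2)], of 1] contraction_norm[OF assms(2)] by auto

text \<open>The adjoint relative to \<open>F\<close> selects the representing vector inside \<open>F\<close>, and that is where \<open>f x\<close> lies.\<close>

lemma adj_adj:
  fixes E :: "'a::chilbert_space set"
  assumes E: "closed_csubspace E" and F: "csubspace F" and f: "f \<in> bop E F" and x: "x \<in> E"
  shows "adj F (adj E f) x = f x"
  by (rule adj_eqI[OF F bop_in[OF f x]]) (rule cinner_adj_left[OF E f x])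

context
  fixes E :: "'a::chilbert_space set" and F :: "'b::complex_inner set" and f
  assumes E: "closed_csubspace E" and f: "contraction_op E F f"
begin

lemma adj_compose_contraction: "contraction_op E E (\<lambda>x. adj E f (f x))"
  by (rule contraction_compose[OF f adj_contraction[OF E f]])

lemma adj_compose_selfadjoint:
  "x \<in> E \<Longrightarrow> y \<in> E \<Longrightarrow> cinner (adj E f (f x)) y = cinner x (adj E f (f y))"
  using cinner_adj[OF E contraction_bop[OF f]] cinner_adj_left[OF E contraction_bop[OF f]] by simp

lemma defect_eq: "defect E f = (\<lambda>x. if x \<in> E then x - sqrt_limit (\<lambda>x. adj E f (f x)) x else 0)"
  unfolding defect_def by (rule psqrt_I_minus[OF E adj_compose_contraction adj_compose_selfadjoint])

lemma defect_bop: "defect E f \<in> bop E E"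
proof -
  have cE: "csubspace E" using E by (simp add: closed_csubspace_def)
  note Y = sqrt_limit_contraction[OF E adj_compose_contraction]
  note Yb = contraction_bop[OF Y]
  show ?thesis unfolding defect_eq
  proof (rule bopI)
    fix x assume x: "x \<in> E"
    show "norm (if x \<in> E then x - sqrt_limit (\<lambda>x. adj E f (f x)) x else 0) \<le> 2 * norm x"
      using x contraction_norm[OF Y x]
        norm_triangle_ineq4[of x "sqrt_limit (\<lambda>x. adj E f (f x)) x"] by simp
  qed (auto simp: csubspace_closed_ops[OF cE] bop_in[OF Yb] bop_add[OF Yb] bop_scaleC[OF Yb] scaleC_diff_right)
qed

lemma defect_in: "x \<in> E \<Longrightarrow> defect E f x \<in> E"
  by (rule bop_in[OF defect_bop])

lemma defect_selfadjoint: "x \<in> E \<Longrightarrow> y \<in> E \<Longrightarrow> cinner (defect E f x) y = cinner x (defect E f y)"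
  unfolding defect_eq
  by (simp add: cinner_diff_left cinner_diff_right
      sqrt_limit_selfadjoint[OF E adj_compose_contraction adj_compose_selfadjoint])

lemma defect_defect:
  assumes x: "x \<in> E"
  shows "defect E f (defect E f x) = x - adj E f (f x)"
proof -
  let ?Y = "sqrt_limit (\<lambda>x. adj E f (f x))"
  have cE: "csubspace E" using E by (simp add: closed_csubspace_def)
  note Yb = contraction_bop[OF sqrt_limit_contraction[OF E adj_compose_contraction]]
  have "defect E f (defect E f x) = x - 2 *\<^sub>R ?Y x + ?Y (?Y x)"
    using x defect_in[OF x] bop_diff[OF Yb cE x bop_in[OF Yb x]]
    by (simp add: defect_eq scaleR_2 algebra_simps)
  then show ?thesis using sqrt_limit_equation[OF E adj_compose_contraction x] by simp
qed

lemma cinner_defect: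
  assumes x: "x \<in> E" and y: "y \<in> E"
  shows "cinner (defect E f x) (defect E f y) = cinner x y - cinner (f x) (f y)"
  using defect_selfadjoint[OF defect_in[OF x] y]
  by (simp add: defect_selfadjoint[OF x defect_in[OF y]] defect_defect[OF y] cinner_diff_right
      cinner_adj[OF E contraction_bop[OF f] x])

lemma norm_defect: "x \<in> E \<Longrightarrow> (norm (defect E f x))\<^sup>2 = (norm x)\<^sup>2 - (norm (f x))\<^sup>2"
  using arg_cong[OF cinner_defect[of x x], of Re] by (simp add: cinner_self)

lemma defect_eq_0_iff: "x \<in> E \<Longrightarrow> defect E f x = 0 \<longleftrightarrow> norm (f x) = norm x"
proof -
  assume "x \<in> E"
  from norm_defect[OF this] have "norm (defect E f x) = 0 \<longleftrightarrow> (norm x)\<^sup>2 = (norm (f x))\<^sup>2" by auto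
  also have "\<dots> \<longleftrightarrow> norm (f x) = norm x" by (auto simp: power2_eq_iff_nonneg)
  finally show ?thesis by simp
qed

lemma closed_csubspace_defect_space: "closed_csubspace (defect_space E f)"
  unfolding defect_space_def using E defect_bop
  by (intro closed_csubspace_closure csubspace_image) (auto simp: closed_csubspace_def)

lemma defect_space_subset: "defect_space E f \<subseteq> E"
  unfolding defect_space_def using E defect_in by (intro closure_minimal) (auto simp: closed_csubspace_def)

lemma defect_in_defect_space: "x \<in> E \<Longrightarrow> defect E f x \<in> defect_space E f"
  unfolding defect_space_def by (rule subsetD[OF closure_subset imageI])

end

text \<open>The defect operators are limits of polynomials in \<open>f\<^sup>* f\<close> and \<open>f'\<^sup>* f'\<close>.\<close>

lemma defect_intertwine:
  fixes E :: "'a::chilbert_space set" and E' :: "'b::chilbert_space set"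
  assumes E: "closed_csubspace E" and f: "contraction_op E F f"
    and E': "closed_csubspace E'" and f': "contraction_op E' F' f'"
    and X: "X \<in> bop E E'" and eq: "\<And>x. x \<in> E \<Longrightarrow> X (adj E f (f x)) = adj E' f' (f' (X x))" and x: "x \<in> E"
  shows "X (defect E f x) = defect E' f' (X x)"
proof -
  have cE: "csubspace E" using E by (simp add: closed_csubspace_def)
  note Y = sqrt_limit_contraction[OF E adj_compose_contraction[OF E f]]
  have "X (sqrt_limit (\<lambda>x. adj E f (f x)) x) = sqrt_limit (\<lambda>x. adj E' f' (f' x)) (X x)"
    by (rule sqrt_limit_intertwine[where C = "\<lambda>x. adj E f (f x)" and C' = "\<lambda>x. adj E' f' (f' x)" and X = X,
        OF E adj_compose_contraction[OF E f] E' adj_compose_contraction[OF E' f'] X eq x])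
  then show ?thesis
    using x bop_in[OF X x] bop_diff[OF X cE x bop_in[OF contraction_bop[OF Y] x]]
    by (simp add: defect_eq[OF E f] defect_eq[OF E' f'])
qed

context
  fixes E :: "'a::chilbert_space set" and F :: "'b::chilbert_space set" and f
  assumes E: "closed_csubspace E" and F: "closed_csubspace F" and f: "contraction_op E F f"
begin

lemma contraction_adj: "contraction_op F E (adj E f)"
  by (rule adj_contraction[OF E f])

text \<open>The two kinds of defect operator are exchanged by passing to the adjoint, so that the
  facts about \<open>defect\<close> cover both.\<close>

lemma defect_star_eq_defect_adj: "defect_star E F f = defect F (adj E f)"
  unfolding defect_star_def defect_def
  by (rule psqrt_cong) (use F in \<open>simp add: adj_adj[OF E _ contraction_bop[OF f] adj_in[OF E contraction_bop[OF f]]]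
      closed_csubspace_def\<close>)

lemma defect_star_space_eq: "defect_star_space E F f = defect_space F (adj E f)"
  by (simp add: defect_star_space_def defect_space_def defect_star_eq_defect_adj)

text \<open>The relation \<open>f D\<^sub>f = D\<^sub>f\<^sub>* f\<close>: the operator \<open>f\<close> intertwines \<open>f\<^sup>* f\<close> and \<open>f f\<^sup>*\<close>.\<close>

lemma apply_defect:
  assumes x: "x \<in> E"
  shows "f (defect E f x) = defect_star E F f (f x)"
  unfolding defect_star_eq_defect_adj
proof (rule defect_intertwine[where X = f, OF E f F contraction_adj contraction_bop[OF f] _ x])
  fix x assume "x \<in> E"
  show "f (adj E f (f x)) = adj F (adj E f) (adj E f (f x))"
    using F by (simp add: adj_adj[OF E _ contraction_bop[OF f] adj_in[OF E contraction_bop[OF f]]]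
      closed_csubspace_def)
qed

lemma apply_defect_space:
  assumes x: "x \<in> defect_space E f"
  shows "f x \<in> defect_star_space E F f"
proof -
  have cE: "csubspace E" using E by (simp add: closed_csubspace_def)
  obtain g where g: "\<And>n. g n \<in> defect E f ` E" "g \<longlonglongrightarrow> x"
    using x unfolding defect_space_def closure_sequential by blast
  have gE: "g n \<in> E" for n using g(1)[of n] defect_in[OF E f] by auto
  have "x \<in> E" using x defect_space_subset[OF E f] by blast
  then have "(\<lambda>n. f (g n)) \<longlonglongrightarrow> f x"
    using gE by (intro bop_tendsto[OF contraction_bop[OF f] cE g(2)]) auto
  moreover have "f (g n) \<in> defect_star E F f ` F" for n
    using g(1)[of n] apply_defect bop_in[OF contraction_bop[OF f]] by auto
  ultimately show ?thesis unfolding defect_star_space_def closure_sequential by (intro exI conjI) auto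
qed

text \<open>The cross terms cancel because \<open>f D\<^sub>f = D\<^sub>f\<^sub>* f\<close>.\<close>

lemma julia_isometry:
  assumes x: "x \<in> E" and h: "h \<in> F"
  shows "(norm (adj E f h + defect E f x))\<^sup>2 + (norm (defect_star E F f h - f x))\<^sup>2 = (norm h)\<^sup>2 + (norm x)\<^sup>2"
proof -
  have fb: "f \<in> bop E F" by (rule contraction_bop[OF f])
  have fx: "f x \<in> F" by (rule bop_in[OF fb x])
  have "inner (adj E f h) (defect E f x) = inner h (f (defect E f x))"
    using inner_adj[OF E fb defect_in[OF E f x]] by (simp add: inner_commute)
  also have "\<dots> = inner h (defect_star E F f (f x))" by (simp only: apply_defect[OF x])
  also have "\<dots> = inner (defect_star E F f h) (f x)"
    using defect_selfadjoint[OF F contraction_adj h fx]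
    by (simp add: inner_eq_Re_cinner defect_star_eq_defect_adj)
  finally show ?thesis
    using norm_add_square[of "adj E f h" "defect E f x"]
      norm_add_square[of "defect_star E F f h" "- f x"]
      norm_defect[OF E f x] norm_defect[OF F contraction_adj h]
    by (simp add: defect_star_eq_defect_adj)
qed

end

text \<open>If \<open>\<parallel>f y\<parallel> = \<parallel>y\<parallel>\<close>, then \<open>f\<^sup>* f y = y\<close>, so \<open>f\<^sup>*\<close> preserves the norm of the nonzero vector \<open>f y\<close>.\<close>

lemma strict_of_strict_adj:
  fixes E :: "'a::chilbert_space set"
  assumes E: "closed_csubspace E" and f: "contraction_op E F f"
    and strict: "\<And>x. x \<in> F \<Longrightarrow> x \<noteq> 0 \<Longrightarrow> norm (adj E f x) < norm x"
    and y: "y \<in> E" "y \<noteq> 0"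
  shows "norm (f y) < norm y"
proof (rule ccontr)
  assume "\<not> norm (f y) < norm y"
  then have eq: "norm (f y) = norm y" using contraction_norm[OF f y(1)] by simp
  then have "defect E f y = 0" by (simp add: defect_eq_0_iff[OF E f y(1)])
  then have "adj E f (f y) = y"
    using defect_defect[OF E f y(1)] bop_zero[OF defect_bop[OF E f]] E by (simp add: closed_csubspace_def)
  moreover have "f y \<noteq> 0" using eq y(2) norm_eq_zero by metis
  then have "norm (adj E f (f y)) < norm (f y)"
    by (rule strict[OF bop_in[OF contraction_bop[OF f] y(1)]])
  ultimately show False using eq by simp
qed

lemma julia_op_eq:
  "julia_op E F f p = (adj E f (fst p) + defect E f (snd p), defect_star E F f (fst p) - f (snd p))"
  by (simp add: julia_op_def block_op_def)

lemma julia_op_isometric: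
  fixes E :: "'a::chilbert_space set" and F :: "'b::chilbert_space set"
  assumes "closed_csubspace E" "closed_csubspace F" "contraction_op E F f" "p \<in> F \<times> E"
  shows "norm (julia_op E F f p) = norm p"
proof -
  have "(norm (julia_op E F f p))\<^sup>2 = (norm p)\<^sup>2"
    using julia_isometry[OF assms(1-3), of "snd p" "fst p"] assms(4)
    by (auto simp: julia_op_eq norm_prod_square)
  then show ?thesis by (simp add: power2_eq_iff_nonneg)
qed

lemma julia_op_contraction:
  fixes E :: "'a::chilbert_space set" and F :: "'b::chilbert_space set"
  assumes E: "closed_csubspace E" and F: "closed_csubspace F" and f: "contraction_op E F f"
  shows "contraction_op (F \<times> defect_space E f) (E \<times> defect_star_space E F f) (julia_op E F f)"
proof -
  have cE: "csubspace E" using E by (simp add: closed_csubspace_def)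
  note f' = adj_contraction[OF E f, of F]
  note fb = contraction_bop[OF f] and f'b = contraction_bop[OF f'] and Db = defect_bop[OF E f]
  have Dsb: "defect_star E F f \<in> bop F F"
    unfolding defect_star_eq_defect_adj[OF E F f] by (rule defect_bop[OF F f'])
  have sub: "x \<in> E" if "x \<in> defect_space E f" for x using that defect_space_subset[OF E f] by blast
  have Ds: "csubspace (defect_star_space E F f)"
    using closed_csubspace_defect_space[OF F f']
    by (simp add: defect_star_space_eq[OF E F f] closed_csubspace_def)
  show ?thesis
  proof (rule contraction_opI)
    fix p assume p: "p \<in> F \<times> defect_space E f"
    then have 1: "fst p \<in> F" and 2: "snd p \<in> defect_space E f" by auto
    have "adj E f (fst p) + defect E f (snd p) \<in> E"
      by (rule csubspace_add[OF cE bop_in[OF f'b 1] bop_in[OF Db sub[OF 2]]])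
    moreover have "defect_star E F f (fst p) \<in> defect_star_space E F f"
      unfolding defect_star_space_def by (rule image_in_closure[OF 1])
    ultimately show "julia_op E F f p \<in> E \<times> defect_star_space E F f"
      using csubspace_diff[OF Ds _ apply_defect_space[OF E F f 2]] by (simp add: julia_op_eq)
    show "julia_op E F f (c *\<^sub>C p) = c *\<^sub>C julia_op E F f p" for c
      using 1 sub[OF 2] by (simp add: julia_op_eq scaleC_prod_def bop_scaleC[OF f'b] bop_scaleC[OF Db]
          bop_scaleC[OF Dsb] bop_scaleC[OF fb] scaleC_add_right scaleC_diff_right)
    show "norm (julia_op E F f p) \<le> norm p"
      using julia_op_isometric[OF E F f, of p] 1 sub[OF 2] by (simp add: mem_Times_iff)
    fix q assume "q \<in> F \<times> defect_space E f"
    then have 3: "fst q \<in> F" and 4: "snd q \<in> E" using sub by auto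
    show "julia_op E F f (p + q) = julia_op E F f p + julia_op E F f q"
      using 1 3 4 sub[OF 2] by (simp add: julia_op_eq bop_add[OF f'b] bop_add[OF Db]
          bop_add[OF Dsb] bop_add[OF fb])
  qed
qed

section \<open>Dense ranges and extension by continuity\<close>

text \<open>A vector orthogonal to the range of \<open>g\<close> is annihilated by \<open>g\<^sup>* = g\<close>; apply this to \<open>y\<close> minus its
  orthogonal projection to the closure of the range.\<close>

lemma dense_range_selfadjoint:
  fixes E :: "'a::chilbert_space set"
  assumes E: "closed_csubspace E" and g: "g \<in> bop E E"
    and sa: "\<And>x y. x \<in> E \<Longrightarrow> y \<in> E \<Longrightarrow> cinner (g x) y = cinner x (g y)"
    and inj: "\<And>x. x \<in> E \<Longrightarrow> g x = 0 \<Longrightarrow> x = 0"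
  shows "closure (g ` E) = E"
proof
  have cE: "csubspace E" and clE: "closed E" using E by (auto simp: closed_csubspace_def)
  show sub: "closure (g ` E) \<subseteq> E" using bop_in[OF g] clE by (intro closure_minimal) auto
  show "E \<subseteq> closure (g ` E)"
  proof
    fix y assume y: "y \<in> E"
    \<comment> \<open>\<open>p\<close> is the orthogonal projection of \<open>y\<close>, obtained by representing \<open>\<langle>_, y\<rangle>\<close> on the closed range.\<close>
    obtain p where p: "p \<in> closure (g ` E)" and orth: "\<And>z. z \<in> closure (g ` E) \<Longrightarrow> cinner z y = cinner z p"
      using riesz_representation[OF closed_csubspace_closure[OF csubspace_image[OF cE g]], of "\<lambda>z. cinner z y" "norm y"]
      by (auto simp: cinner_add_left cinner_scaleC_left mult.commute[of "norm y"] norm_cinner_le)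
    have yp: "y - p \<in> E" using y p sub by (intro csubspace_diff[OF cE]) auto
    have "g (y - p) = 0"
    proof (rule cinner_eq_on_subspace[OF cE bop_in[OF g yp] csubspace_0[OF cE]])
      fix z assume z: "z \<in> E"
      then have "g z \<in> closure (g ` E)" by (rule image_in_closure)
      then have "cinner (g z) (y - p) = 0" using orth[of "g z"] by (simp add: cinner_diff_right)
      then show "cinner z (g (y - p)) = cinner z 0" using sa[OF z yp] by simp
    qed
    then have "y = p" using inj[OF yp] by simp
    then show "y \<in> closure (g ` E)" using p by simp
  qed
qed

text \<open>Polarization; the imaginary part comes from replacing \<open>y\<close> by \<open>\<i> y\<close>.\<close>

lemma isometry_cinner:
  assumes E: "csubspace E" and g: "g \<in> bop E F" and iso: "\<And>x. x \<in> E \<Longrightarrow> norm (g x) = norm x"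
    and x: "x \<in> E" and y: "y \<in> E"
  shows "cinner (g x) (g y) = cinner x y"
proof -
  have re: "Re (cinner (g x) (g z)) = Re (cinner x z)" if "z \<in> E" for z
    using norm_add_square[of "g x" "g z"] norm_add_square[of x z] iso[OF x] iso[OF that]
      iso[OF csubspace_add[OF E x that]] bop_add[OF g x that] by (simp add: inner_eq_Re_cinner)
  show ?thesis
  proof (rule complex_eqI)
    show "Im (cinner (g x) (g y)) = Im (cinner x y)"
      using re[OF csubspace_scaleC[OF E y, of \<i>]] bop_scaleC[OF g y, of \<i>]
      by (simp add: cinner_scaleC_right)
  qed (rule re[OF y])
qed

lemma unitary_norm: "unitary_op E F \<sigma> \<Longrightarrow> x \<in> E \<Longrightarrow> norm (\<sigma> x) = norm x"
  by (simp add: unitary_op_def norm_eq_sqrt_inner inner_eq_Re_cinner)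

lemma unitary_contraction: "unitary_op E F \<sigma> \<Longrightarrow> contraction_op E F \<sigma>"
  by (simp add: contraction_op_def unitary_norm) (simp add: unitary_op_def)

lemma unitary_inv:
  assumes \<sigma>: "unitary_op E F \<sigma>" and y: "y \<in> F"
  shows "inv_into E \<sigma> y \<in> E" "\<sigma> (inv_into E \<sigma> y) = y"
  using assms inv_into_into[of y \<sigma> E] f_inv_into_f[of y \<sigma> E] by (auto simp: unitary_op_def)

lemma unitary_inv_contraction:
  assumes \<sigma>: "unitary_op E F \<sigma>" and E: "csubspace E" and F: "csubspace F"
  shows "contraction_op F E (inv_into E \<sigma>)"
proof -
  have b: "\<sigma> \<in> bop E F" using \<sigma> by (simp add: unitary_op_def)
  have inj: "x = y" if "x \<in> E" "y \<in> E" "\<sigma> x = \<sigma> y" for x y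
    using unitary_norm[OF \<sigma> csubspace_diff[OF E that(1,2)]] that(3) by (simp add: bop_diff[OF b E that(1,2)])
  note inv = unitary_inv[OF \<sigma>]
  show ?thesis
  proof (rule contraction_opI)
    fix x assume x: "x \<in> F"
    show "inv_into E \<sigma> x \<in> E" by (rule inv(1)[OF x])
    show "norm (inv_into E \<sigma> x) \<le> norm x" using unitary_norm[OF \<sigma> inv(1)[OF x]] inv(2)[OF x] by simp
    show "inv_into E \<sigma> (c *\<^sub>C x) = c *\<^sub>C inv_into E \<sigma> x" for c
      by (rule inj) (simp_all add: inv x csubspace_scaleC[OF F] csubspace_scaleC[OF E] bop_scaleC[OF b])
    fix y assume y: "y \<in> F"
    show "inv_into E \<sigma> (x + y) = inv_into E \<sigma> x + inv_into E \<sigma> y"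
      by (rule inj) (simp_all add: inv x y csubspace_add[OF F] csubspace_add[OF E] bop_add[OF b])
  qed
qed

text \<open>If \<open>\<parallel>P x\<parallel> = \<parallel>D x\<parallel>\<close> for all \<open>x\<close>, then \<open>D x \<mapsto> P x\<close> extends uniquely to an isometry of the closure
  of the range of \<open>D\<close>; its value at \<open>lim D x\<^sub>n\<close> is \<open>lim P x\<^sub>n\<close>.  The extension is onto as soon
  as the range of \<open>P\<close> is dense, because an isometry of a complete space has closed range.\<close>

lemma isometric_extension:
  fixes D :: "'a::complex_inner \<Rightarrow> 'b::chilbert_space" and P :: "'a \<Rightarrow> 'c::chilbert_space"
  assumes E: "csubspace E" and D: "D \<in> bop E G" and P: "P \<in> bop E W" and W: "closed_csubspace W"
    and iso: "\<And>x. x \<in> E \<Longrightarrow> norm (P x) = norm (D x)"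
  shows "\<exists>!Z. Z \<in> bop (closure (D ` E)) W \<and> (\<forall>x\<in>E. Z (D x) = P x) \<and> (\<forall>y. y \<notin> closure (D ` E) \<longrightarrow> Z y = 0)"
    (is "\<exists>!Z. ?Q Z")
    and "Z \<in> bop (closure (D ` E)) W \<Longrightarrow> (\<And>x. x \<in> E \<Longrightarrow> Z (D x) = P x) \<Longrightarrow> closure (P ` E) = W \<Longrightarrow>
      unitary_op (closure (D ` E)) W Z"
proof -
  let ?V = "closure (D ` E)"
  have V: "csubspace ?V"
    using closed_csubspace_closure[OF csubspace_image[OF E D]] by (simp add: closed_csubspace_def)
  have clW: "closed W" using W by (auto simp: closed_csubspace_def)
  have seq: "\<exists>f. (\<forall>n. f n \<in> E) \<and> (\<lambda>n. D (f n)) \<longlonglongrightarrow> y" if y: "y \<in> ?V" for y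
  proof -
    obtain g where g: "\<forall>n. g n \<in> D ` E" "g \<longlonglongrightarrow> y" using y unfolding closure_sequential by blast
    then have "\<forall>n. \<exists>x. x \<in> E \<and> g n = D x" by auto
    then obtain f where f: "\<And>n. f n \<in> E \<and> g n = D (f n)" using choice by meson
    then have "g = (\<lambda>n. D (f n))" by blast
    then show ?thesis using f g(2) by (intro exI[of _ f]) simp
  qed
  have diff: "norm (P x - P y) = norm (D x - D y)" if "x \<in> E" "y \<in> E" for x y
    using iso[OF csubspace_diff[OF E that]] by (simp add: bop_diff[OF P E that] bop_diff[OF D E that])
  have conv: "\<exists>z\<in>W. (\<lambda>n. P (f n)) \<longlonglongrightarrow> z" if f: "\<And>n. f n \<in> E" and "(\<lambda>n. D (f n)) \<longlonglongrightarrow> y" for f y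
  proof -
    have "Cauchy (\<lambda>n. D (f n))" using that(2) by (rule LIMSEQ_imp_Cauchy)
    then have "Cauchy (\<lambda>n. P (f n))" by (simp add: Cauchy_def dist_norm diff f)
    then obtain z where z: "(\<lambda>n. P (f n)) \<longlonglongrightarrow> z" using Cauchy_convergent_iff convergent_def by blast
    then show ?thesis using closed_sequentially[OF clW _ z] bop_in[OF P f] by blast
  qed
  define Z where "Z y = (if y \<in> ?V then lim (\<lambda>n. P ((SOME f. (\<forall>n. f n \<in> E) \<and> (\<lambda>n. D (f n)) \<longlonglongrightarrow> y) n)) else 0)" for y
  have Z_lim: "(\<lambda>n. P (f n)) \<longlonglongrightarrow> Z y" if f: "\<And>n. f n \<in> E" and y: "(\<lambda>n. D (f n)) \<longlonglongrightarrow> y" for f y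
  proof -
    have yV: "y \<in> ?V" unfolding closure_sequential using f y by (intro exI[of _ "\<lambda>n. D (f n)"]) auto
    define g where "g = (SOME f. (\<forall>n. f n \<in> E) \<and> (\<lambda>n. D (f n)) \<longlonglongrightarrow> y)"
    have g: "\<And>n. g n \<in> E" "(\<lambda>n. D (g n)) \<longlonglongrightarrow> y" using someI_ex[OF seq[OF yV]] unfolding g_def by auto
    obtain z where z: "(\<lambda>n. P (g n)) \<longlonglongrightarrow> z" using conv[of g, OF g] by blast
    then have Zy: "Z y = z" using yV by (simp add: Z_def g_def[symmetric] limI)
    have "(\<lambda>n. norm (D (f n) - D (g n))) \<longlonglongrightarrow> 0"
      using tendsto_diff[OF y g(2)] by (simp add: tendsto_norm_zero)
    then have "(\<lambda>n. P (f n) - P (g n)) \<longlonglongrightarrow> 0"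
      by (intro tendsto_norm_zero_cancel[of "\<lambda>n. P (f n) - P (g n)"]) (simp add: diff f g(1))
    from tendsto_add[OF this z] show ?thesis by (simp add: Zy)
  qed
  have ZW: "Z y \<in> W" if y: "y \<in> ?V" for y
  proof -
    obtain f where f: "\<And>n. f n \<in> E" "(\<lambda>n. D (f n)) \<longlonglongrightarrow> y" using seq[OF y] by blast
    show ?thesis using closed_sequentially[OF clW _ Z_lim[OF f]] bop_in[OF P f(1)] by blast
  qed
  have Zbop: "Z \<in> bop ?V W"
  proof (rule bopI[OF ZW])
    fix x y assume "x \<in> ?V" "y \<in> ?V"
    then obtain f g where f: "\<And>n. f n \<in> E" "(\<lambda>n. D (f n)) \<longlonglongrightarrow> x" and g: "\<And>n. g n \<in> E" "(\<lambda>n. D (g n)) \<longlonglongrightarrow> y"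
      using seq by meson
    have "(\<lambda>n. P (f n + g n)) \<longlonglongrightarrow> Z (x + y)"
      using tendsto_add[OF f(2) g(2)] by (intro Z_lim) (simp_all add: csubspace_add[OF E] f(1) g(1) bop_add[OF D])
    moreover have "(\<lambda>n. P (f n + g n)) \<longlonglongrightarrow> Z x + Z y"
      using tendsto_add[OF Z_lim[OF f] Z_lim[OF g]] by (simp add: f(1) g(1) bop_add[OF P])
    ultimately show "Z (x + y) = Z x + Z y" by (rule LIMSEQ_unique)
  next
    fix c x assume "x \<in> ?V"
    then obtain f where f: "\<And>n. f n \<in> E" "(\<lambda>n. D (f n)) \<longlonglongrightarrow> x" using seq by meson
    have "(\<lambda>n. P (c *\<^sub>C f n)) \<longlonglongrightarrow> Z (c *\<^sub>C x)"
      using bounded_linear.tendsto[OF bounded_linear_scaleC f(2), of c]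
      by (intro Z_lim) (simp_all add: csubspace_scaleC[OF E] f(1) bop_scaleC[OF D])
    moreover have "(\<lambda>n. P (c *\<^sub>C f n)) \<longlonglongrightarrow> c *\<^sub>C Z x"
      using bounded_linear.tendsto[OF bounded_linear_scaleC Z_lim[OF f], of c]
      by (simp add: f(1) bop_scaleC[OF P])
    ultimately show "Z (c *\<^sub>C x) = c *\<^sub>C Z x" by (rule LIMSEQ_unique)
  next
    fix x assume "x \<in> ?V"
    then obtain f where f: "\<And>n. f n \<in> E" "(\<lambda>n. D (f n)) \<longlonglongrightarrow> x" using seq by meson
    have "(\<lambda>n. norm (D (f n))) \<longlonglongrightarrow> norm (Z x)" using tendsto_norm[OF Z_lim[OF f]] iso[OF f(1)] by simp
    then have "norm (Z x) = norm x" using tendsto_norm[OF f(2)] LIMSEQ_unique by blast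
    then show "norm (Z x) \<le> 1 * norm x" by simp
  qed
  have ZD: "Z (D x) = P x" if "x \<in> E" for x
    using Z_lim[of "\<lambda>_. x" "D x"] that by (simp add: LIMSEQ_const_iff)
  have unique: "Z1 y = Z2 y"
    if Z1: "Z1 \<in> bop ?V W" and Z2: "Z2 \<in> bop ?V W" and eq: "\<And>x. x \<in> E \<Longrightarrow> Z1 (D x) = P x" "\<And>x. x \<in> E \<Longrightarrow> Z2 (D x) = P x"
      and y: "y \<in> ?V" for Z1 Z2 y
  proof -
    obtain f where f: "\<And>n. f n \<in> E" "(\<lambda>n. D (f n)) \<longlonglongrightarrow> y" using seq[OF y] by blast
    have DV: "D (f n) \<in> ?V" for n using f(1) by (rule image_in_closure)
    have "(\<lambda>n. P (f n)) \<longlonglongrightarrow> Z1 y" using bop_tendsto[OF Z1 V f(2) y] DV by (simp add: eq f(1))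
    moreover have "(\<lambda>n. P (f n)) \<longlonglongrightarrow> Z2 y" using bop_tendsto[OF Z2 V f(2) y] DV by (simp add: eq f(1))
    ultimately show ?thesis by (rule LIMSEQ_unique)
  qed
  show "\<exists>!Z. ?Q Z"
  proof (rule ex1I[of _ Z])
    show "?Q Z" using Zbop ZD by (simp add: Z_def)
    fix Z' assume Z': "?Q Z'"
    show "Z' = Z"
    proof
      fix y show "Z' y = Z y"
        using unique[of Z' Z y] Z' Zbop ZD by (cases "y \<in> ?V") (auto simp: Z_def)
    qed
  qed
  show "unitary_op ?V W Z'" if Z': "Z' \<in> bop ?V W" "\<And>x. x \<in> E \<Longrightarrow> Z' (D x) = P x" and dense: "closure (P ` E) = W"
    for Z'
    unfolding unitary_op_def
  proof (intro conjI ballI Z'(1))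
    have lim: "(\<lambda>n. P (f n)) \<longlonglongrightarrow> Z' y" if f: "\<And>n. f n \<in> E" "(\<lambda>n. D (f n)) \<longlonglongrightarrow> y" for f y
    proof -
      have "y \<in> ?V" unfolding closure_sequential using f by (intro exI[of _ "\<lambda>n. D (f n)"]) auto
      then show ?thesis using Z_lim[OF f] unique[OF Z'(1) Zbop Z'(2) ZD] by simp
    qed
    fix x y assume x: "x \<in> ?V" and y: "y \<in> ?V"
    show "cinner (Z' x) (Z' y) = cinner x y"
    proof (rule isometry_cinner[OF V Z'(1) _ x y])
      fix x assume "x \<in> ?V"
      then obtain f where f: "\<And>n. f n \<in> E" "(\<lambda>n. D (f n)) \<longlonglongrightarrow> x" using seq by meson
      have "(\<lambda>n. norm (D (f n))) \<longlonglongrightarrow> norm (Z' x)" using tendsto_norm[OF lim[OF f]] iso[OF f(1)] by simp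
      then show "norm (Z' x) = norm x" using tendsto_norm[OF f(2)] LIMSEQ_unique by blast
    qed
  next
    show "Z' ` ?V = W"
    proof
      show "Z' ` ?V \<subseteq> W" using bop_in[OF Z'(1)] by auto
      show "W \<subseteq> Z' ` ?V"
      proof
        fix w assume "w \<in> W"
        then obtain g where "\<forall>n. g n \<in> P ` E" "g \<longlonglongrightarrow> w" unfolding dense[symmetric] closure_sequential by blast
        then have "\<forall>n. \<exists>x. x \<in> E \<and> g n = P x" "g \<longlonglongrightarrow> w" by auto
        then obtain f where f': "\<And>n. f n \<in> E \<and> g n = P (f n)" using choice by meson
        then have f: "\<And>n. f n \<in> E" by blast
        have "g = (\<lambda>n. P (f n))" using f' by blast
        then have fw: "(\<lambda>n. P (f n)) \<longlonglongrightarrow> w" using \<open>g \<longlonglongrightarrow> w\<close> by simp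
        have "Cauchy (\<lambda>n. P (f n))" using fw by (rule LIMSEQ_imp_Cauchy)
        then have "Cauchy (\<lambda>n. D (f n))" by (simp add: Cauchy_def dist_norm diff f)
        then obtain y where y: "(\<lambda>n. D (f n)) \<longlonglongrightarrow> y" using Cauchy_convergent_iff convergent_def by blast
        have yV: "y \<in> ?V" unfolding closure_sequential using f y by (intro exI[of _ "\<lambda>n. D (f n)"]) auto
        have "(\<lambda>n. P (f n)) \<longlonglongrightarrow> Z' y"
          using Z_lim[OF f y] unique[OF Z'(1) Zbop Z'(2) ZD yV] by simp
        then have "Z' y = w" using fw LIMSEQ_unique by blast
        then show "w \<in> Z' ` ?V" using yV by blast
      qed
    qed
  qed
qed

section \<open>Square-summable families and Fock spaces\<close>

lemma norm_ell2_le: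
  assumes K: "0 \<le> K" and le: "\<And>w. norm (coord y w) \<le> K * norm (coord x w)"
  shows "norm y \<le> K * norm x"
proof -
  have "(norm y)\<^sup>2 \<le> (\<Sum>\<^sub>\<infinity>w. K\<^sup>2 * (norm (coord x w))\<^sup>2)"
    unfolding norm_ell2_square
  proof (rule infsum_mono)
    show "(norm (coord y w))\<^sup>2 \<le> K\<^sup>2 * (norm (coord x w))\<^sup>2" for w
      using power_mono[OF le[of w], of 2] by (simp add: power_mult_distrib)
  qed (auto intro: summable_coord summable_on_cmult_right)
  also have "\<dots> = (K * norm x)\<^sup>2"
    by (simp add: norm_ell2_square infsum_cmult_right summable_coord power_mult_distrib)
  finally show ?thesis by (rule power2_le_imp_le) (use K in simp)
qed

lemma norm_ell2_eq: "(\<And>w. norm (coord y w) = norm (coord x w)) \<Longrightarrow> norm y = norm x"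
  using norm_ell2_le[of 1 x y] norm_ell2_le[of 1 y x] by (simp add: antisym)

lemma has_sum_norm_coord: "((\<lambda>w. (norm (coord x w))\<^sup>2) has_sum (norm x)\<^sup>2) UNIV"
  using summable_coord[of x] by (simp add: norm_ell2_square)

lemma coord_basis_tensor: "coord (\<e> w \<otimes> h) v = (if v = w then h else 0)"
  by (simp add: coord_tensor coord_basis_vec scaleC_one)

lemma cinner_basis_tensor: "cinner x (\<e> w \<otimes> h) = cinner (coord x w) h"
proof -
  have "cinner x (\<e> w \<otimes> h) = (\<Sum>\<^sub>\<infinity>v\<in>{w}. cinner (coord x v) (coord (\<e> w \<otimes> h) v))"
    unfolding cinner_ell2_def by (rule infsum_cong_neutral) (auto simp: coord_basis_tensor)
  then show ?thesis by (simp add: coord_basis_tensor)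
qed

lemma coord_ell2_map:
  assumes "\<sigma> \<in> bop E F" and x: "\<And>i. coord x i \<in> E"
  shows "coord (ell2_map \<sigma> x) i = \<sigma> (coord x i)"
proof -
  obtain K where "K \<ge> 0" and K: "\<And>x. x \<in> E \<Longrightarrow> norm (\<sigma> x) \<le> K * norm x"
    using bop_bound[OF assms(1)] by blast
  have "(\<lambda>i. (norm (\<sigma> (coord x i)))\<^sup>2) summable_on UNIV"
  proof (rule summable_on_comparison_test)
    show "(\<lambda>i. K\<^sup>2 * (norm (coord x i))\<^sup>2) summable_on UNIV"
      by (intro summable_on_cmult_right summable_coord)
    show "(norm (\<sigma> (coord x i)))\<^sup>2 \<le> K\<^sup>2 * (norm (coord x i))\<^sup>2" for i
      using power_mono[OF K[OF x], of _ 2] by (simp add: power_mult_distrib)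
  qed auto
  then show ?thesis by (simp add: ell2_map_def Abs_ell2_inverse)
qed

lemma fock_tensorD: "x \<in> fock_tensor E \<Longrightarrow> coord x w \<in> E"
  and fock_tensorI: "(\<And>w. coord x w \<in> E) \<Longrightarrow> x \<in> fock_tensor E"
  by (auto simp: fock_tensor_def)

lemma csubspace_fock_tensor: "csubspace E \<Longrightarrow> csubspace (fock_tensor E)"
  by (auto simp: csubspace_def fock_tensor_def)

lemma closed_csubspace_fock_tensor: "closed_csubspace E \<Longrightarrow> closed_csubspace (fock_tensor E)"
  unfolding closed_csubspace_def
proof (intro conjI)
  assume E: "csubspace E \<and> closed E"
  then show "csubspace (fock_tensor E)" by (simp add: csubspace_fock_tensor)
  show "closed (fock_tensor E)"
    unfolding fock_tensor_def using E
    by (intro closed_Collect_all closed_vimage[unfolded vimage_def]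
        linear_continuous_on bounded_linear_coord) auto
qed

lemma basis_tensor_in_fock_tensor: "csubspace E \<Longrightarrow> h \<in> E \<Longrightarrow> \<e> w \<otimes> h \<in> fock_tensor E"
  by (simp add: fock_tensor_def coord_basis_tensor csubspace_0)

lemma creation_in_fock_tensor: "csubspace E \<Longrightarrow> x \<in> fock_tensor E \<Longrightarrow> creation i x \<in> fock_tensor E"
  by (auto simp: fock_tensor_def coord_creation csubspace_0 split: list.split)

lemma partial_sum_in_fock_tensor:
  "csubspace E \<Longrightarrow> x \<in> fock_tensor E \<Longrightarrow> (\<Sum>w\<in>F. \<e> w \<otimes> coord x w) \<in> fock_tensor E"
  by (intro csubspace_sum csubspace_fock_tensor basis_tensor_in_fock_tensor fock_tensorD)

lemma partial_sums_tendsto: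
  "((\<lambda>F. \<Sum>w\<in>F. \<e> w \<otimes> coord x w) \<longlongrightarrow> x) (finite_subsets_at_top UNIV)"
  using has_sum_basis_tensor[of x] by (simp add: has_sum_def)

lemma fock_map_bop:
  assumes \<sigma>: "\<sigma> \<in> bop E F" and E: "csubspace E"
  shows "fock_map \<sigma> \<in> bop (fock_tensor E :: ('n list, _) ell2 set) (fock_tensor F)"
proof -
  obtain K where K: "K \<ge> 0" "\<And>x. x \<in> E \<Longrightarrow> norm (\<sigma> x) \<le> K * norm x"
    using bop_bound[OF \<sigma>] by blast
  have c: "coord (fock_map \<sigma> x) w = \<sigma> (coord x w)" if "x \<in> fock_tensor E" for x :: "('n list, _) ell2" and w
    by (rule coord_ell2_map[OF \<sigma> fock_tensorD[OF that]])
  note sub = csubspace_fock_tensor[OF E]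
  show ?thesis
  proof (rule bopI)
    fix x y :: "('n list, _) ell2" assume "x \<in> fock_tensor E" "y \<in> fock_tensor E"
    then show "fock_map \<sigma> (x + y) = fock_map \<sigma> x + fock_map \<sigma> y"
      by (intro ell2_eqI) (simp add: c csubspace_add[OF sub] bop_add[OF \<sigma>] fock_tensorD)
  next
    fix a and x :: "('n list, _) ell2" assume "x \<in> fock_tensor E"
    then show "fock_map \<sigma> (a *\<^sub>C x) = a *\<^sub>C fock_map \<sigma> x"
      by (intro ell2_eqI) (simp add: c csubspace_scaleC[OF sub] bop_scaleC[OF \<sigma>] fock_tensorD)
  next
    fix x :: "('n list, _) ell2" assume x: "x \<in> fock_tensor E"
    then show "norm (fock_map \<sigma> x) \<le> K * norm x"
      by (intro norm_ell2_le K(1)) (simp add: c K(2) fock_tensorD)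
    show "fock_map \<sigma> x \<in> fock_tensor F"
      using x by (intro fock_tensorI) (simp add: c bop_in[OF \<sigma>] fock_tensorD)
  qed
qed

lemma coord_fock_map: "\<sigma> \<in> bop E F \<Longrightarrow> x \<in> fock_tensor E \<Longrightarrow> coord (fock_map \<sigma> x) w = \<sigma> (coord x w)"
  using coord_ell2_map[of \<sigma> E F x] fock_tensorD by blast

lemma fock_map_contractive:
  fixes \<sigma> :: "'a::complex_inner \<Rightarrow> 'b::complex_inner"
  assumes \<sigma>: "contraction_op E F \<sigma>" and E: "csubspace E"
  shows "contractive_multi_analytic E F (fock_map \<sigma> :: ('n list, 'a) ell2 \<Rightarrow> _)"
  unfolding contractive_multi_analytic_def multi_analytic_def contraction_op_def
proof (intro conjI allI ballI)
  have b: "\<sigma> \<in> bop E F" by (rule contraction_bop[OF \<sigma>])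
  show M: "fock_map \<sigma> \<in> bop (fock_tensor E :: ('n list, 'a) ell2 set) (fock_tensor F)"
    by (rule fock_map_bop[OF b E])
  show "fock_map \<sigma> \<in> bop (fock_tensor E :: ('n list, 'a) ell2 set) (fock_tensor F)" by (rule M)
  fix x :: "('n list, 'a) ell2" assume x: "x \<in> fock_tensor E"
  show "norm (fock_map \<sigma> x) \<le> norm x"
    using norm_ell2_le[of 1 "fock_map \<sigma> x" x] x
    by (simp add: coord_fock_map[OF b] contraction_norm[OF \<sigma>] fock_tensorD)
  show "fock_map \<sigma> (creation i x) = creation i (fock_map \<sigma> x)" for i
    using x by (intro ell2_eqI)
      (auto simp: coord_fock_map[OF b] creation_in_fock_tensor[OF E] coord_creation bop_zero[OF b E] split: list.split)
qed

lemma fock_map_isometric: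
  assumes "\<sigma> \<in> bop E F" "\<And>x. x \<in> E \<Longrightarrow> norm (\<sigma> x) = norm x" "x \<in> fock_tensor E"
  shows "norm (fock_map \<sigma> x) = norm x"
  by (rule norm_ell2_eq) (simp add: coord_fock_map[OF assms(1,3)] assms(2) fock_tensorD[OF assms(3)])

lemma contractive_multi_analytic_compose:
  assumes "contractive_multi_analytic E F X" "contractive_multi_analytic F G Y"
  shows "contractive_multi_analytic E G (\<lambda>x. Y (X x))"
  using assms contraction_compose[of "fock_tensor E" "fock_tensor F" X "fock_tensor G" Y]
  unfolding contractive_multi_analytic_def multi_analytic_def
  by (auto simp: contraction_op_def bop_in)

lemma contractive_multi_analytic_cong:
  assumes "csubspace E" "\<And>x. x \<in> fock_tensor E \<Longrightarrow> X x = Y x" "contractive_multi_analytic E F X"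
  shows "contractive_multi_analytic E F Y"
  using assms bop_cong[of "fock_tensor E" X Y] csubspace_fock_tensor[OF assms(1)]
    creation_in_fock_tensor[OF assms(1)]
  unfolding contractive_multi_analytic_def multi_analytic_def contraction_op_def
  by metis

lemma contractive_multi_analytic_zero:
  "contractive_multi_analytic E F X \<Longrightarrow> csubspace E \<Longrightarrow> X 0 = 0"
  unfolding contractive_multi_analytic_def
  by (blast intro: bop_zero[OF contraction_bop csubspace_fock_tensor])

text \<open>A multi-analytic operator is determined by its symbol: commuting with the creation operators
  carries the values at \<open>e\<^sub>\<emptyset> \<otimes> h\<close> to all \<open>e\<^sub>w \<otimes> h\<close>, and these span a dense subspace.\<close>

lemma multi_analytic_eqI:
  assumes M: "multi_analytic E F M" and N: "multi_analytic E F N" and E: "csubspace E"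
    and eq: "\<And>h. h \<in> E \<Longrightarrow> M (\<e> [] \<otimes> h) = N (\<e> [] \<otimes> h)" and x: "x \<in> fock_tensor E"
  shows "M x = N x"
proof -
  note sub = csubspace_fock_tensor[OF E]
  have Mb: "M \<in> bop (fock_tensor E) (fock_tensor F)" and Nb: "N \<in> bop (fock_tensor E) (fock_tensor F)"
    using M N by (auto simp: multi_analytic_def)
  have basis: "M (\<e> w \<otimes> h) = N (\<e> w \<otimes> h)" if "h \<in> E" for w h
  proof (induction w)
    case (Cons i w)
    have "\<e> (i # w) \<otimes> h = creation i (\<e> w \<otimes> h)" by (simp add: creation_tensor creation_basis_vec)
    moreover have "\<e> w \<otimes> h \<in> fock_tensor E" by (rule basis_tensor_in_fock_tensor[OF E that])
    ultimately show ?case using Cons M N by (simp add: multi_analytic_def)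
  qed (rule eq[OF that])
  have eq': "M (\<Sum>w\<in>I. \<e> w \<otimes> coord x w) = N (\<Sum>w\<in>I. \<e> w \<otimes> coord x w)" for I
    using x by (simp add: bop_sum[OF Mb sub] bop_sum[OF Nb sub] basis_tensor_in_fock_tensor[OF E]
        fock_tensorD basis)
  have lim: "((\<lambda>I. f (\<Sum>w\<in>I. \<e> w \<otimes> coord x w)) \<longlongrightarrow> f x) (finite_subsets_at_top UNIV)"
    if "f \<in> bop (fock_tensor E) (fock_tensor F)" for f
    by (rule bop_tendsto[OF that sub partial_sums_tendsto x]) (simp add: partial_sum_in_fock_tensor[OF E x])
  show ?thesis
    by (rule tendsto_unique[OF finite_subsets_at_top_neq_bot lim[OF Mb, unfolded eq'] lim[OF Nb]])
qed

lemma norm_ell2_split: "(norm x)\<^sup>2 = (norm (fst (ell2_split x)))\<^sup>2 + (norm (snd (ell2_split x)))\<^sup>2"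
  by (simp add: norm_ell2_square coord_ell2_split norm_prod_square
      infsum_add[symmetric] summable_coord[of "fst (ell2_split x)", unfolded coord_ell2_split]
      summable_coord[of "snd (ell2_split x)", unfolded coord_ell2_split])

lemma norm_ell2_join: "(norm (ell2_join p))\<^sup>2 = (norm (fst p))\<^sup>2 + (norm (snd p))\<^sup>2"
  using norm_ell2_split[of "ell2_join p"] by simp

lemma ell2_join_add: "ell2_join (p + q) = ell2_join p + ell2_join q"
  by (rule ell2_eqI) (simp add: coord_ell2_join)

lemma norm_ell2_join_zero: "norm (ell2_join (0, g)) = norm g"
  using norm_ell2_join[of "(0, g)"] by (simp add: power2_eq_iff_nonneg)

lemma bounded_linear_ell2_join:
  "bounded_linear (ell2_join :: ('i, 'a::real_inner) ell2 \<times> ('i, 'b::real_inner) ell2 \<Rightarrow> _)"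
proof (rule bounded_linear_intro[of _ 1])
  fix p q :: "('i, 'a) ell2 \<times> ('i, 'b) ell2" and r
  show "ell2_join (p + q) = ell2_join p + ell2_join q" by (rule ell2_join_add)
  show "ell2_join (r *\<^sub>R p) = r *\<^sub>R ell2_join p" by (rule ell2_eqI) (simp add: coord_ell2_join)
  have "(norm (ell2_join p))\<^sup>2 \<le> (norm p)\<^sup>2" by (simp add: norm_ell2_join norm_prod_square)
  then have "norm (ell2_join p) \<le> norm p" by (rule power2_le_imp_le) simp
  then show "norm (ell2_join p) \<le> norm p * 1" by simp
qed

lemma ell2_split_add: "ell2_split (x + y) = ell2_split x + ell2_split y"
  by (auto intro!: prod_eqI ell2_eqI simp: coord_ell2_split)

lemma ell2_split_scaleC: "ell2_split (c *\<^sub>C x) = c *\<^sub>C ell2_split x"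
  by (auto intro!: prod_eqI ell2_eqI simp: coord_ell2_split scaleC_prod_def)

lemma ell2_split_in:
  "x \<in> fock_tensor (E \<times> G) \<longleftrightarrow> fst (ell2_split x) \<in> fock_tensor E \<and> snd (ell2_split x) \<in> fock_tensor G"
  by (auto simp: fock_tensor_def coord_ell2_split mem_Times_iff)

lemma fock_diag_id_eq: "fock_diag_id X x = ell2_join (X (fst (ell2_split x)), snd (ell2_split x))"
  by (simp add: fock_diag_id_def block_op_def)

lemma fock_diag_id_contractive:
  fixes X :: "('n list, 'a::complex_inner) ell2 \<Rightarrow> ('n list, 'b::complex_inner) ell2"
    and G :: "'c::complex_inner set"
  assumes X: "contractive_multi_analytic E F X" and E: "csubspace E" and G: "csubspace G"
  shows "contractive_multi_analytic (E \<times> G) (F \<times> G) (fock_diag_id X)"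
proof -
  have Xb: "X \<in> bop (fock_tensor E) (fock_tensor F)"
    and Xc: "\<And>i x. x \<in> fock_tensor E \<Longrightarrow> X (creation i x) = creation i (X x)"
    and Xn: "\<And>x. x \<in> fock_tensor E \<Longrightarrow> norm (X x) \<le> norm x"
    using X by (auto simp: contractive_multi_analytic_def multi_analytic_def contraction_op_def)
  have split_creation: "ell2_split (creation i x) = (creation i (fst (ell2_split x)), creation i (snd (ell2_split x)))"
    for i and x :: "('n list, 'a \<times> 'c) ell2"
    by (auto intro!: prod_eqI ell2_eqI simp: coord_ell2_split coord_creation split: list.split)
  have c: "contraction_op (fock_tensor (E \<times> G)) (fock_tensor (F \<times> G)) (fock_diag_id X)"
  proof (rule contraction_opI)
    fix x :: "('n list, 'a \<times> 'c) ell2" assume x: "x \<in> fock_tensor (E \<times> G)"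
    then have x1: "fst (ell2_split x) \<in> fock_tensor E" by (simp add: ell2_split_in)
    show "fock_diag_id X x \<in> fock_tensor (F \<times> G)"
      using x bop_in[OF Xb] by (auto simp: fock_diag_id_eq ell2_split_in)
    have "(norm (fock_diag_id X x))\<^sup>2 \<le> (norm x)\<^sup>2"
      using power_mono[OF Xn[OF x1], of 2]
      by (simp add: fock_diag_id_eq norm_ell2_join norm_ell2_split[of x])
    then show "norm (fock_diag_id X x) \<le> norm x" by (rule power2_le_imp_le) simp
    show "fock_diag_id X (c *\<^sub>C x) = c *\<^sub>C fock_diag_id X x" for c
      using x1 by (intro ell2_eqI)
        (simp add: fock_diag_id_eq coord_ell2_join ell2_split_scaleC scaleC_prod_def bop_scaleC[OF Xb])
    fix y :: "('n list, 'a \<times> 'c) ell2" assume y: "y \<in> fock_tensor (E \<times> G)"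
    then show "fock_diag_id X (x + y) = fock_diag_id X x + fock_diag_id X y"
      using x1 by (intro ell2_eqI)
        (simp add: fock_diag_id_eq coord_ell2_join ell2_split_add bop_add[OF Xb] ell2_split_in)
  qed
  have "fock_diag_id X (creation i x) = creation i (fock_diag_id X x)" if "x \<in> fock_tensor (E \<times> G)" for i x
    using that by (intro ell2_eqI)
      (auto simp: fock_diag_id_eq coord_ell2_join split_creation Xc ell2_split_in coord_creation
        zero_prod_def split: list.split)
  with c show ?thesis
    by (auto simp: contractive_multi_analytic_def multi_analytic_def contraction_op_def)
qed

lemma fock_diag_id_isometric:
  assumes "\<And>x. x \<in> fock_tensor E \<Longrightarrow> norm (X x) = norm x" "x \<in> fock_tensor (E \<times> G)"
  shows "norm (fock_diag_id X x) = norm x"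
proof -
  have "(norm (fock_diag_id X x))\<^sup>2 = (norm x)\<^sup>2"
    using assms by (simp add: fock_diag_id_eq norm_ell2_join norm_ell2_split[of x] ell2_split_in)
  then show ?thesis by (simp add: power2_eq_iff_nonneg)
qed

text \<open>The adjoint \<open>S\<^sub>i\<^sup>* \<otimes> I\<close> of the creation operator.\<close>

lift_definition annihilation :: "'n \<Rightarrow> ('n list, 'a::real_normed_vector) ell2 \<Rightarrow> ('n list, 'a) ell2"
  is "\<lambda>i f w. f (i # w)"
proof -
  fix i :: 'n and f :: "'n list \<Rightarrow> 'a"
  assume "(\<lambda>w. (norm (f w))\<^sup>2) summable_on UNIV"
  then have "(\<lambda>w. (norm (f w))\<^sup>2) summable_on range ((#) i)"
    by (rule summable_on_subset_banach) simp
  then show "(\<lambda>w. (norm (f (i # w)))\<^sup>2) summable_on UNIV"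
    by (subst (asm) summable_on_reindex) (auto simp: inj_def o_def)
qed

lemma coord_annihilation [simp]: "coord (annihilation i x) w = coord x (i # w)"
  by (simp add: annihilation.rep_eq)

lemma annihilation_zero [simp]: "annihilation i 0 = 0"
  by (rule ell2_eqI) simp

lemma annihilation_add: "annihilation i (x + y) = annihilation i x + annihilation i y"
  by (rule ell2_eqI) simp

lemma annihilation_scaleC: "annihilation i (c *\<^sub>C x) = c *\<^sub>C annihilation i x"
  by (rule ell2_eqI) simp

lemma annihilation_creation: "annihilation j (creation i x) = (if j = i then x else 0)"
  by (rule ell2_eqI) (simp add: coord_creation)

lemma annihilation_in_fock_tensor: "x \<in> fock_tensor E \<Longrightarrow> annihilation i x \<in> fock_tensor E"
  by (simp add: fock_tensor_def)

text \<open>A nonempty word is the same as a first letter together with a word.\<close>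

lemma has_sum_words_iff:
  fixes g :: "'n list \<Rightarrow> real"
  shows "(g has_sum s) UNIV \<longleftrightarrow> ((\<lambda>(i, w). g (i # w)) has_sum (s - g [])) UNIV"
proof -
  let ?h = "\<lambda>(i, w). i # w :: 'n list"
  have inj: "inj ?h" by (auto simp: inj_def)
  have U: "UNIV = insert [] (range ?h)" by (auto simp: image_iff) (metis list.exhaust)
  have "(g has_sum s) UNIV \<longleftrightarrow> (g has_sum (s - g [])) (range ?h)"
  proof
    assume "(g has_sum s) UNIV"
    then have "g summable_on range ?h"
      using has_sum_imp_summable summable_on_subset_banach by blast
    then obtain t where t: "(g has_sum t) (range ?h)" by (auto simp: summable_on_def)
    then have "(g has_sum (g [] + t)) UNIV" unfolding U by (intro has_sum_insert) auto
    then show "(g has_sum (s - g [])) (range ?h)"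
      using t has_sum_unique[OF \<open>(g has_sum s) UNIV\<close>] by simp
  next
    assume "(g has_sum (s - g [])) (range ?h)"
    then have "(g has_sum (g [] + (s - g []))) UNIV" unfolding U by (intro has_sum_insert) auto
    then show "(g has_sum s) UNIV" by simp
  qed
  also have "\<dots> \<longleftrightarrow> ((\<lambda>(i, w). g (i # w)) has_sum (s - g [])) UNIV"
    by (subst has_sum_reindex[OF inj]) (simp add: o_def case_prod_unfold)
  finally show ?thesis .
qed

text \<open>Sums of energies over words are computed letter by letter; for nonnegative terms the iterated sum
  already gives summability.\<close>

lemma has_sum_words:
  fixes g :: "'n list \<Rightarrow> real"
  assumes "\<And>w. 0 \<le> g w" and s: "\<And>i. ((\<lambda>w. g (i # w)) has_sum s i) UNIV" and S: "(s has_sum S) UNIV"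
  shows "(g has_sum (g [] + S)) UNIV"
proof -
  let ?f = "\<lambda>(i, w). g (i # w)"
  have "?f summable_on Sigma UNIV (\<lambda>_. UNIV)"
    by (rule summable_on_SigmaI[where g = s]) (use assms in \<open>auto intro: has_sum_imp_summable\<close>)
  then have "(?f has_sum S) (Sigma UNIV (\<lambda>_. UNIV))"
    by (intro has_sum_SigmaI[OF _ S]) (use s in auto)
  then show ?thesis by (simp add: has_sum_words_iff)
qed

lemma has_sum_norm_annihilation:
  "((\<lambda>i. (norm (annihilation i x))\<^sup>2) has_sum ((norm x)\<^sup>2 - (norm (coord x []))\<^sup>2)) UNIV"
proof -
  have "((\<lambda>(i, w). (norm (coord x (i # w)))\<^sup>2) has_sum ((norm x)\<^sup>2 - (norm (coord x []))\<^sup>2)) UNIV"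
    by (rule iffD1[OF has_sum_words_iff[of "\<lambda>w. (norm (coord x w))\<^sup>2" "(norm x)\<^sup>2"] has_sum_norm_coord[of x]])
  then have "((\<lambda>(i, w). (norm (coord x (i # w)))\<^sup>2) has_sum ((norm x)\<^sup>2 - (norm (coord x []))\<^sup>2))
      (Sigma UNIV (\<lambda>_. UNIV))"
    by (simp only: UNIV_Times_UNIV)
  moreover have "((\<lambda>w. (norm (coord x (i # w)))\<^sup>2) has_sum (norm (annihilation i x))\<^sup>2) UNIV" for i
    using has_sum_norm_coord[of "annihilation i x"] by (simp only: coord_annihilation)
  ultimately show ?thesis
    using has_sum_SigmaD[where f = "\<lambda>(i, w). (norm (coord x (i # w)))\<^sup>2" and A = UNIV and B = "\<lambda>_. UNIV"
      and g = "\<lambda>i. (norm (annihilation i x))\<^sup>2" and S = "(norm x)\<^sup>2 - (norm (coord x []))\<^sup>2"]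
    by (simp only: prod.case UNIV_I)
qed

text \<open>When the term at the empty word is zero, nothing has to be subtracted, so this form holds in
  any topological commutative monoid, in particular for vector-valued sums.\<close>

lemma has_sum_words_Cons:
  fixes g :: "'n list \<Rightarrow> 'a::topological_comm_monoid_add"
  assumes "g [] = 0" "(g has_sum s) UNIV"
  shows "((\<lambda>(i, w). g (i # w)) has_sum s) (Sigma UNIV (\<lambda>_. UNIV))"
proof -
  let ?h = "\<lambda>(i, w). i # w :: 'n list"
  have inj: "inj ?h" by (auto simp: inj_def)
  have zero: "g w = 0" if "w \<notin> range ?h" for w
  proof (cases w)
    case (Cons i v)
    then have "w = ?h (i, v)" by simp
    then show ?thesis using that by blast
  qed (simp add: assms)
  have "(g has_sum s) (range ?h) \<longleftrightarrow> (g has_sum s) UNIV"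
    by (rule has_sum_cong_neutral) (use zero in auto)
  then have "(g has_sum s) (range ?h)" using assms by simp
  then have "((g \<circ> ?h) has_sum s) UNIV" by (simp only: has_sum_reindex[OF inj])
  moreover have "g \<circ> ?h = (\<lambda>(i, w). g (i # w))" by auto
  ultimately show ?thesis by (simp only: UNIV_Times_UNIV)
qed

text \<open>The identity \<open>\<Sum> S\<^sub>i S\<^sub>i\<^sup>* = I - P\<close>, where \<open>P\<close> projects to the empty word.\<close>

lemma has_sum_creation_annihilation:
  fixes z :: "('n list, 'a::complex_inner) ell2"
  assumes z: "coord z [] = 0"
  shows "((\<lambda>i. creation i (annihilation i z)) has_sum z) UNIV"
proof -
  let ?f = "\<lambda>(i, w). \<e> (i # w) \<otimes> coord z (i # w)"
  have "\<e> ([] :: 'n list) \<otimes> coord z [] = 0" by (rule ell2_eqI) (simp add: z coord_basis_tensor)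
  from has_sum_words_Cons[of "\<lambda>w. \<e> w \<otimes> coord z w", OF this has_sum_basis_tensor[of z]]
  have "(?f has_sum z) (Sigma UNIV (\<lambda>_. UNIV))" .
  moreover have "((\<lambda>w. ?f (i, w)) has_sum creation i (annihilation i z)) UNIV" for i
  proof -
    let ?y = "creation i (annihilation i z)"
    have zero: "\<e> w \<otimes> coord ?y w = 0" if "w \<notin> range ((#) i)" for w
      using that by (intro ell2_eqI) (auto simp: coord_basis_tensor coord_creation split: list.split)
    have "((\<lambda>w. \<e> w \<otimes> coord ?y w) has_sum ?y) (range ((#) i))
        \<longleftrightarrow> ((\<lambda>w. \<e> w \<otimes> coord ?y w) has_sum ?y) UNIV"
      by (rule has_sum_cong_neutral) (use zero in auto)
    then have "((\<lambda>w. \<e> w \<otimes> coord ?y w) has_sum ?y) (range ((#) i))"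
      using has_sum_basis_tensor[of ?y] by simp
    then have "(((\<lambda>w. \<e> w \<otimes> coord ?y w) \<circ> (#) i) has_sum ?y) UNIV"
      by (subst (asm) has_sum_reindex) (auto simp: inj_def)
    then show ?thesis by (simp add: o_def coord_creation)
  qed
  ultimately show ?thesis
    using has_sum_SigmaD[where f = ?f and A = UNIV and B = "\<lambda>_. UNIV" and S = z
      and g = "\<lambda>i. creation i (annihilation i z)"]
    by blast
qed

section \<open>The row operator of a row contraction\<close>

text \<open>For infinitely many \<open>T\<^sub>i\<close> the convergence of \<open>\<Sum> T\<^sub>i x\<^sub>i\<close> needs an argument.  The column
  \<open>h \<mapsto> (T\<^sub>i\<^sup>* h)\<^sub>i\<close> is a contraction directly by \<open>\<Sum> T\<^sub>i T\<^sub>i\<^sup>* \<le> I\<close>, and its adjoint maps \<open>e\<^sub>i \<otimes> h\<close> to \<open>T\<^sub>i h\<close>.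
  By continuity this adjoint is the row operator.\<close>

definition column_op :: "('n \<Rightarrow> 'h::complex_inner \<Rightarrow> 'h) \<Rightarrow> 'h \<Rightarrow> ('n, 'h) ell2"
  where "column_op T h = Abs_ell2 (\<lambda>i. adj UNIV (T i) h)"

context
  fixes T :: "'n \<Rightarrow> 'h::chilbert_space \<Rightarrow> 'h"
  assumes T: "row_contraction T"
begin

lemma row_contraction_bop: "T i \<in> bop UNIV UNIV"
  using T by (simp add: row_contraction_def)

lemma column_op_exists: "\<exists>x. coord x = (\<lambda>i. adj UNIV (T i) h) \<and> norm x \<le> norm h"
proof (rule ell2_bounded_partial_sums)
  fix F :: "'n set" assume F: "finite F"
  define s where "s = (\<Sum>\<^sub>\<infinity>i. T i (adj UNIV (T i) h))"
  have "((\<lambda>i. T i (adj UNIV (T i) h)) has_sum s) UNIV"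
    using T by (simp add: row_contraction_def s_def)
  from has_sum_bounded_linear[OF bounded_linear_inner_left this, of h]
  have "((\<lambda>i. inner (T i (adj UNIV (T i) h)) h) has_sum inner s h) UNIV" .
  moreover have "inner (T i (adj UNIV (T i) h)) h = (norm (adj UNIV (T i) h))\<^sup>2" for i
    using inner_adj[OF closed_csubspace_UNIV row_contraction_bop, of "adj UNIV (T i) h" i h]
    by (simp add: power2_norm_eq_inner)
  ultimately have "((\<lambda>i. (norm (adj UNIV (T i) h))\<^sup>2) has_sum inner s h) UNIV" by simp
  then have "(\<Sum>i\<in>F. (norm (adj UNIV (T i) h))\<^sup>2) \<le> inner s h"
    by (rule finite_sum_le_has_sum) (use F in auto)
  also have "cinner (h - s) h \<in> \<real>\<^sub>\<ge>\<^sub>0"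
    using T by (simp add: row_contraction_def op_le_def positive_op_def s_def)
  then have "inner s h \<le> (norm h)\<^sup>2"
    by (simp add: complex_nonneg_Reals_iff cinner_diff_left inner_eq_Re_cinner cinner_self)
  finally show "(\<Sum>i\<in>F. (norm (adj UNIV (T i) h))\<^sup>2) \<le> (norm h)\<^sup>2" .
qed simp

lemma coord_column_op: "coord (column_op T h) i = adj UNIV (T i) h"
  and norm_column_op: "norm (column_op T h) \<le> norm h"
proof -
  obtain x where x: "coord x = (\<lambda>i. adj UNIV (T i) h)" "norm x \<le> norm h"
    using column_op_exists by blast
  then have "column_op T h = x" by (simp add: column_op_def coord_inverse flip: x(1))
  then show "coord (column_op T h) i = adj UNIV (T i) h" "norm (column_op T h) \<le> norm h"
    using x by auto
qed

lemma adj_row_bop: "adj UNIV (T i) \<in> bop UNIV UNIV"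
  by (rule adj_bop[OF closed_csubspace_UNIV row_contraction_bop])

lemma column_op_contraction: "contraction_op UNIV UNIV (column_op T)"
  by (rule contraction_opI)
    (auto intro!: ell2_eqI simp: coord_column_op norm_column_op bop_add[OF adj_row_bop] bop_scaleC[OF adj_row_bop])

lemma adj_column_op_basis: "adj UNIV (column_op T) (\<e> i \<otimes> h) = T i h"
  by (rule adj_eqI)
    (simp_all add: csubspace_def cinner_basis_tensor coord_column_op
      cinner_adj_left[OF closed_csubspace_UNIV row_contraction_bop])

lemma row_op_eq_adj_column_op: "row_op T = adj UNIV (column_op T)"
proof
  fix x
  have "bounded_linear (adj UNIV (column_op T))"
    by (rule bop_UNIV_bounded_linear[OF adj_bop[OF closed_csubspace_UNIV contraction_bop[OF column_op_contraction]]])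
  from has_sum_bounded_linear[OF this has_sum_basis_tensor[of x]]
  show "row_op T x = adj UNIV (column_op T) x"
    unfolding row_op_def adj_column_op_basis by (rule infsumI)
qed

lemma row_op_contraction: "contraction_op UNIV UNIV (row_op T)"
  unfolding row_op_eq_adj_column_op by (rule adj_contraction[OF closed_csubspace_UNIV column_op_contraction])

lemma row_op_basis: "row_op T (\<e> i \<otimes> h) = T i h"
  unfolding row_op_eq_adj_column_op by (rule adj_column_op_basis)

lemma coord_adj_row_op: "coord (adj UNIV (row_op T) h) i = adj UNIV (T i) h"
proof -
  have "adj UNIV (row_op T) h = column_op T h"
    unfolding row_op_eq_adj_column_op
    by (rule adj_adj[OF closed_csubspace_UNIV _ contraction_bop[OF column_op_contraction]])
      (simp_all add: csubspace_def)
  then show ?thesis by (simp add: coord_column_op)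
qed

end

section \<open>The characteristic function as an input-output map\<close>

text \<open>One step of the system described at the beginning: the states after the empty word followed by
  each of the letters, for input \<open>x\<close> and initial state \<open>k\<close>.\<close>

definition next_state ::
  "('n \<Rightarrow> 'h::complex_inner \<Rightarrow> 'h) \<Rightarrow> ('n list, ('n, 'h) ell2) ell2 \<Rightarrow> 'h \<Rightarrow> ('n, 'h) ell2"
  where "next_state T x k = adj UNIV (row_op T) k + row_defect T (coord x [])"

text \<open>After the first letter \<open>i\<close> the system runs on with input \<open>S\<^sub>i\<^sup>* x\<close> and state the \<open>i\<close>-th coordinate of
  the next state.  This self-similarity drives all inductions below, which is why
  the initial state is a parameter, although \<open>\<Theta>\<^sub>T\<close> corresponds to the initial state \<open>0\<close>.\<close>

fun char_output ::
  "('n \<Rightarrow> 'h::complex_inner \<Rightarrow> 'h) \<Rightarrow> ('n list, ('n, 'h) ell2) ell2 \<Rightarrow> 'h \<Rightarrow> 'n list \<Rightarrow> 'h" where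
  "char_output T x k [] = row_defect_star T k - row_op T (coord x [])"
| "char_output T x k (i # w) = char_output T (annihilation i x) (coord (next_state T x k) i) w"

text \<open>How the total energy \<open>\<parallel>k\<parallel>\<^sup>2 + \<parallel>x\<parallel>\<^sup>2\<close> is distributed after \<open>m\<close> steps: a word shorter than \<open>m\<close> carries
  the energy of the output already emitted there, a word of length \<open>m\<close> that of the state
  reached and of the input still to come.  Counting the future input keeps the total constant.\<close>

fun energy ::
  "('n \<Rightarrow> 'h::complex_inner \<Rightarrow> 'h) \<Rightarrow> nat \<Rightarrow> ('n list, ('n, 'h) ell2) ell2 \<Rightarrow> 'h \<Rightarrow> 'n list \<Rightarrow> real" where
  "energy T 0 x k w = (if w = [] then (norm k)\<^sup>2 + (norm x)\<^sup>2 else 0)"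
| "energy T (Suc m) x k [] = (norm (char_output T x k []))\<^sup>2"
| "energy T (Suc m) x k (i # w) = energy T m (annihilation i x) (coord (next_state T x k) i) w"

definition char_response ::
  "('n \<Rightarrow> 'h::complex_inner \<Rightarrow> 'h) \<Rightarrow> 'h \<Rightarrow> ('n list, ('n, 'h) ell2) ell2 \<Rightarrow> ('n list, 'h) ell2"
  where "char_response T k x = Abs_ell2 (char_output T x k)"

lemma energy_nonneg: "0 \<le> energy T m x k w"
  by (induction T m x k w rule: energy.induct) auto

lemma energy_eq_output: "length w < m \<Longrightarrow> energy T m x k w = (norm (char_output T x k w))\<^sup>2"
proof (induction w arbitrary: m x k)
  case Nil then show ?case by (cases m) auto
next
  case (Cons i w) then show ?case by (cases m) auto
qed

context
  fixes T :: "'n \<Rightarrow> 'h::chilbert_space \<Rightarrow> 'h"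
  assumes T: "row_contraction T"
begin

lemmas row_contr = row_op_contraction[OF T]
lemmas row_adj_bop = adj_bop[OF closed_csubspace_UNIV contraction_bop[OF row_contr], of UNIV]
lemmas row_defect_bop = defect_bop[OF closed_csubspace_UNIV row_contr]

lemma row_defect_star_eq: "row_defect_star T = defect UNIV (adj UNIV (row_op T))"
  by (rule defect_star_eq_defect_adj[OF closed_csubspace_UNIV closed_csubspace_UNIV row_contr])

lemma row_defect_star_bop: "row_defect_star T \<in> bop UNIV UNIV"
  unfolding row_defect_star_eq
  by (rule defect_bop[OF closed_csubspace_UNIV adj_contraction[OF closed_csubspace_UNIV row_contr]])

lemma closed_csubspace_row_defect_space: "closed_csubspace (row_defect_space T)"
  by (rule closed_csubspace_defect_space[OF closed_csubspace_UNIV row_contr])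

lemma closed_csubspace_row_defect_star_space: "closed_csubspace (row_defect_star_space T)"
  unfolding defect_star_space_eq[OF closed_csubspace_UNIV closed_csubspace_UNIV row_contr]
  by (rule closed_csubspace_defect_space[OF closed_csubspace_UNIV adj_contraction[OF closed_csubspace_UNIV row_contr]])

lemma next_state_add: "next_state T (x + y) (k + l) = next_state T x k + next_state T y l"
  by (simp add: next_state_def bop_add[OF row_adj_bop] bop_add[OF row_defect_bop])

lemma next_state_scaleC: "next_state T (c *\<^sub>C x) (c *\<^sub>C k) = c *\<^sub>C next_state T x k"
  by (simp add: next_state_def bop_scaleC[OF row_adj_bop] bop_scaleC[OF row_defect_bop] scaleC_add_right)

lemma next_state_zero: "next_state T 0 0 = 0"
  using next_state_scaleC[of 0 0 0] by simp

lemma char_output_add: "char_output T (x + y) (k + l) w = char_output T x k w + char_output T y l w"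
  by (induction w arbitrary: x y k l)
    (simp_all add: next_state_add annihilation_add bop_add[OF row_defect_star_bop]
      bop_add[OF contraction_bop[OF row_contr]])

lemma char_output_scaleC: "char_output T (c *\<^sub>C x) (c *\<^sub>C k) w = c *\<^sub>C char_output T x k w"
  by (induction w arbitrary: x k)
    (simp_all add: next_state_scaleC annihilation_scaleC bop_scaleC[OF row_defect_star_bop]
      bop_scaleC[OF contraction_bop[OF row_contr]] scaleC_diff_right)

lemma char_output_zero: "char_output T 0 0 w = 0"
  using char_output_scaleC[of 0 0 0 w] by simp

text \<open>Conservation of energy; each step conserves it because the Julia operator of the row
  operator is isometric.\<close>

lemma energy_has_sum: "(energy T m x k has_sum ((norm k)\<^sup>2 + (norm x)\<^sup>2)) UNIV"
proof (induction m arbitrary: x k)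
  case 0
  have "(energy T 0 x k has_sum ((norm k)\<^sup>2 + (norm x)\<^sup>2)) {[]}"
    by (rule has_sum_finiteI) auto
  moreover have "(energy T 0 x k has_sum ((norm k)\<^sup>2 + (norm x)\<^sup>2)) {[]}
      \<longleftrightarrow> (energy T 0 x k has_sum ((norm k)\<^sup>2 + (norm x)\<^sup>2)) UNIV"
    by (rule has_sum_cong_neutral) auto
  ultimately show ?case by blast
next
  case (Suc m)
  let ?s = "next_state T x k"
  have "((\<lambda>i. (norm (coord ?s i))\<^sup>2 + (norm (annihilation i x))\<^sup>2) has_sum
      ((norm ?s)\<^sup>2 + ((norm x)\<^sup>2 - (norm (coord x []))\<^sup>2))) UNIV"
    by (intro has_sum_add has_sum_norm_coord has_sum_norm_annihilation)
  from has_sum_words[of "energy T (Suc m) x k", OF energy_nonneg _ this]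
  have "(energy T (Suc m) x k has_sum
      ((norm (char_output T x k []))\<^sup>2 + ((norm ?s)\<^sup>2 + ((norm x)\<^sup>2 - (norm (coord x []))\<^sup>2)))) UNIV"
    using Suc by simp
  moreover have "(norm ?s)\<^sup>2 + (norm (char_output T x k []))\<^sup>2 = (norm k)\<^sup>2 + (norm (coord x []))\<^sup>2"
    using julia_isometry[OF closed_csubspace_UNIV closed_csubspace_UNIV row_contr, of "coord x []" k]
    by (simp add: next_state_def)
  ultimately show ?case by (simp add: algebra_simps)
qed

lemma char_output_ell2:
  "\<exists>y. coord y = char_output T x k \<and> norm y \<le> sqrt ((norm k)\<^sup>2 + (norm x)\<^sup>2)"
proof (rule ell2_bounded_partial_sums)
  fix F :: "'n list set" assume F: "finite F"
  \<comment> \<open>Any \<open>m\<close> above all lengths in \<open>F\<close> will do; the sum of the lengths bounds each of them.\<close>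
  define m where "m = Suc (sum length F)"
  have m: "length w < m" if "w \<in> F" for w
    using member_le_sum[of w F length] that F by (simp add: m_def)
  have "(\<Sum>w\<in>F. (norm (char_output T x k w))\<^sup>2) = sum (energy T m x k) F"
    using m by (intro sum.cong) (simp_all add: energy_eq_output)
  also have "\<dots> \<le> (norm k)\<^sup>2 + (norm x)\<^sup>2"
    by (rule finite_sum_le_has_sum[OF energy_has_sum F]) (auto simp: energy_nonneg)
  finally show "(\<Sum>w\<in>F. (norm (char_output T x k w))\<^sup>2) \<le> (sqrt ((norm k)\<^sup>2 + (norm x)\<^sup>2))\<^sup>2" by simp
qed simp

lemma coord_char_response: "coord (char_response T k x) w = char_output T x k w"
  and norm_char_response: "norm (char_response T k x) \<le> sqrt ((norm k)\<^sup>2 + (norm x)\<^sup>2)"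
proof -
  obtain y where y: "coord y = char_output T x k" "norm y \<le> sqrt ((norm k)\<^sup>2 + (norm x)\<^sup>2)"
    using char_output_ell2 by blast
  then have "char_response T k x = y" by (simp add: char_response_def coord_inverse flip: y(1))
  then show "coord (char_response T k x) w = char_output T x k w"
    "norm (char_response T k x) \<le> sqrt ((norm k)\<^sup>2 + (norm x)\<^sup>2)" using y by auto
qed

lemma annihilation_char_response:
  "annihilation i (char_response T k x) = char_response T (coord (next_state T x k) i) (annihilation i x)"
  by (rule ell2_eqI) (simp add: coord_char_response)

lemma word_op_bop: "word_op T w \<in> bop UNIV UNIV"
proof (induction w)
  case Nil then show ?case by (auto intro: bopI[of _ _ _ 1])
next
  case (Cons i w)
  then show ?case using bop_compose[OF Cons row_contraction_bop[OF T]] by (simp add: o_def)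
qed

lemma adj_word_op_Cons: "adj UNIV (word_op T (i # w)) k = adj UNIV (word_op T w) (adj UNIV (T i) k)"
  by (rule adj_eqI[OF csubspace_UNIV])
    (simp_all add: cinner_adj[OF closed_csubspace_UNIV word_op_bop]
      cinner_adj[OF closed_csubspace_UNIV row_contraction_bop[OF T]])

lemma adj_word_op_Nil: "adj UNIV (word_op T []) k = k"
  by (rule adj_eqI[OF csubspace_UNIV]) simp_all

lemma next_state_no_input: "coord (next_state T 0 k) i = adj UNIV (T i) k"
  by (simp add: next_state_def coord_adj_row_op[OF T] bop_zero[OF row_defect_bop csubspace_UNIV])

lemma char_output_no_input: "char_output T 0 k w = row_defect_star T (adj UNIV (word_op T w) k)"
  by (induction w arbitrary: k)
    (simp_all add: next_state_no_input adj_word_op_Nil adj_word_op_Cons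
      bop_zero[OF contraction_bop[OF row_contr] csubspace_UNIV] del: word_op.simps)

lemma energy_no_input:
  "energy T m 0 k w = (if length w < m then (norm (char_output T 0 k w))\<^sup>2
    else if length w = m then (norm (adj UNIV (word_op T w) k))\<^sup>2 else 0)"
proof (induction w arbitrary: m k)
  case Nil then show ?case by (cases m) (simp_all add: adj_word_op_Nil del: word_op.simps)
next
  case (Cons i w)
  then show ?case by (cases m) (simp_all add: next_state_no_input adj_word_op_Cons del: word_op.simps)
qed

text \<open>With the input concentrated in the empty word, the system runs freely after the first step,
  where the output at \<open>w\<close> for initial state \<open>k\<close> is \<open>D\<^sub>T\<^sub>* T\<^sub>w\<^sup>* k\<close>.  So the inner sum of the symbol is a
  free response, and the outer sum assembles these responses letter by letter.\<close>

lemma char_symbol_eq: "char_symbol T h = char_response T 0 (\<e> [] \<otimes> h)"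
proof -
  let ?d = "row_defect T h" and ?r = "char_response T 0 (\<e> [] \<otimes> h)"
  \<comment> \<open>The part of the response after the first step: the component at the empty word is removed.\<close>
  define z where "z = ?r + \<e> [] \<otimes> row_op T h"
  have inner: "(\<Sum>\<^sub>\<infinity>w. \<e> w \<otimes> row_defect_star T (adj UNIV (word_op T w) k)) = char_response T k 0" for k
    using has_sum_basis_tensor[of "char_response T k 0"]
    by (intro infsumI) (simp add: coord_char_response char_output_no_input)
  have ann: "annihilation i (\<e> [] \<otimes> h) = 0" for i
    by (rule ell2_eqI) (simp add: coord_basis_tensor)
  have ann': "annihilation i (\<e> [] \<otimes> row_op T h) = 0" for i
    by (rule ell2_eqI) (simp add: coord_basis_tensor)
  have ns: "next_state T (\<e> [] \<otimes> h) 0 = ?d"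
    by (simp add: next_state_def coord_basis_tensor bop_zero[OF row_adj_bop csubspace_UNIV])
  have "coord z [] = 0"
    by (simp add: z_def coord_char_response coord_basis_tensor bop_zero[OF row_defect_star_bop csubspace_UNIV])
  from has_sum_creation_annihilation[OF this]
  have "((\<lambda>i. creation i (char_response T (coord ?d i) 0)) has_sum z) UNIV"
    by (simp add: z_def annihilation_add annihilation_char_response ann ann' ns)
  then have "(\<Sum>\<^sub>\<infinity>i. creation i (char_response T (coord ?d i) 0)) = z" by (rule infsumI)
  then show ?thesis by (simp add: char_symbol_def inner z_def row_op_def)
qed

text \<open>Needed at each letter: \<open>T\<close> maps \<open>\<D>\<^sub>T\<close> into \<open>\<D>\<^sub>T\<^sub>*\<close>, a consequence of \<open>T D\<^sub>T = D\<^sub>T\<^sub>* T\<close>.\<close>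

lemma char_output_in:
  assumes "x \<in> fock_tensor (row_defect_space T)"
  shows "char_output T x k w \<in> row_defect_star_space T"
  using assms
proof (induction w arbitrary: x k)
  case Nil
  have "row_defect_star T k \<in> row_defect_star_space T"
    unfolding defect_star_space_def by (rule image_in_closure) simp
  moreover have "row_op T (coord x []) \<in> row_defect_star_space T"
    by (rule apply_defect_space[OF closed_csubspace_UNIV closed_csubspace_UNIV row_contr fock_tensorD[OF Nil]])
  ultimately show ?case using closed_csubspace_row_defect_star_space by (simp add: closed_csubspace_def csubspace_diff)
next
  case (Cons i w) then show ?case by (simp add: annihilation_in_fock_tensor)
qed

lemma char_response_contractive: "contractive_multi_analytic (row_defect_space T) (row_defect_star_space T) (char_response T 0)"
proof -
  have "contraction_op (fock_tensor (row_defect_space T)) (fock_tensor (row_defect_star_space T)) (char_response T 0)"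
  proof (rule contraction_opI)
    show "char_response T 0 x \<in> fock_tensor (row_defect_star_space T)" if "x \<in> fock_tensor (row_defect_space T)" for x
      using that by (intro fock_tensorI) (simp add: coord_char_response char_output_in)
    show "char_response T 0 (x + y) = char_response T 0 x + char_response T 0 y" for x y
      using char_output_add[of x y 0 0] by (intro ell2_eqI) (simp add: coord_char_response)
    show "char_response T 0 (c *\<^sub>C x) = c *\<^sub>C char_response T 0 x" for c x
      using char_output_scaleC[of c x 0] by (intro ell2_eqI) (simp add: coord_char_response)
    show "norm (char_response T 0 x) \<le> norm x" for x
      using norm_char_response[of 0 x] by simp
  qed
  moreover have "char_response T 0 (creation i x) = creation i (char_response T 0 x)" for i x
  proof (rule ell2_eqI)
    fix w
    have "next_state T (creation i x) 0 = 0"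
      using next_state_zero by (simp add: next_state_def coord_creation)
    then show "coord (char_response T 0 (creation i x)) w = coord (creation i (char_response T 0 x)) w"
      by (cases w) (simp_all add: coord_char_response coord_creation annihilation_creation char_output_zero
        bop_zero[OF row_defect_star_bop csubspace_UNIV] bop_zero[OF contraction_bop[OF row_contr] csubspace_UNIV])
  qed
  ultimately show ?thesis
    by (simp add: contractive_multi_analytic_def multi_analytic_def contraction_op_def)
qed

text \<open>The response to initial state \<open>0\<close> is multi-analytic and has the symbol of \<open>\<Theta>\<^sub>T\<close>, and a symbol
  determines its multi-analytic operator.  Outside \<open>\<Gamma> \<otimes> \<D>\<^sub>T\<close> the default value \<open>0\<close> takes over.\<close>

lemma char_fun_eq:
  "char_fun T = (\<lambda>x. if x \<in> fock_tensor (row_defect_space T) then char_response T 0 x else 0)" (is "_ = ?M")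
  unfolding char_fun_def
proof (rule the_equality)
  have sub: "csubspace (row_defect_space T)" using closed_csubspace_row_defect_space by (simp add: closed_csubspace_def)
  have "contractive_multi_analytic (row_defect_space T) (row_defect_star_space T) ?M"
    by (rule contractive_multi_analytic_cong[OF sub _ char_response_contractive]) simp
  then have M: "multi_analytic (row_defect_space T) (row_defect_star_space T) ?M" by (simp add: contractive_multi_analytic_def)
  have symbol: "?M (\<e> [] \<otimes> h) = char_symbol T h" if "h \<in> row_defect_space T" for h
    by (simp add: char_symbol_eq basis_tensor_in_fock_tensor[OF sub that])
  show "multi_analytic (row_defect_space T) (row_defect_star_space T) ?M \<and> (\<forall>h\<in> row_defect_space T. ?M (\<e> [] \<otimes> h) = char_symbol T h) \<and>
      (\<forall>x. x \<notin> fock_tensor (row_defect_space T) \<longrightarrow> ?M x = 0)"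
    using M symbol by auto
  fix N assume N: "multi_analytic (row_defect_space T) (row_defect_star_space T) N \<and> (\<forall>h\<in> row_defect_space T. N (\<e> [] \<otimes> h) = char_symbol T h) \<and>
      (\<forall>x. x \<notin> fock_tensor (row_defect_space T) \<longrightarrow> N x = 0)"
  show "N = ?M"
  proof
    fix x
    show "N x = ?M x"
    proof (cases "x \<in> fock_tensor (row_defect_space T)")
      case True
      show ?thesis
        by (rule multi_analytic_eqI[OF _ M sub _ True]) (use N symbol in auto)
    qed (use N in auto)
  qed
qed

lemma char_fun_contractive: "contractive_multi_analytic (row_defect_space T) (row_defect_star_space T) (char_fun T)"
  unfolding char_fun_eq
  by (rule contractive_multi_analytic_cong[OF _ _ char_response_contractive])
    (use closed_csubspace_row_defect_space in \<open>simp_all add: closed_csubspace_def\<close>)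

context
  assumes pure: "pure_row_contraction T"
begin

text \<open>The energy not emitted in the first \<open>m\<close> steps of a free run sits in the states \<open>T\<^sub>w\<^sup>* k\<close> with
  \<open>|w| = m\<close>; purity says that it tends to \<open>0\<close>.\<close>

lemma norm_char_response_no_input: "(norm (char_response T k 0))\<^sup>2 = (norm k)\<^sup>2"
proof (rule antisym)
  show "(norm (char_response T k 0))\<^sup>2 \<le> (norm k)\<^sup>2"
    using norm_char_response[of k 0] by simp
  have "(norm k)\<^sup>2 \<le> (norm (char_response T k 0))\<^sup>2 + (\<Sum>\<^sub>\<infinity>w\<in>{w. length w = m}. (norm (adj UNIV (word_op T w) k))\<^sup>2)" for m
  proof -
    let ?b = "\<lambda>w. if length w = m then (norm (adj UNIV (word_op T w) k))\<^sup>2 else 0"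
    have sb: "?b summable_on UNIV"
      by (rule summable_on_comparison_test[OF has_sum_imp_summable[OF energy_has_sum[of m 0 k]]])
        (auto simp: energy_no_input)
    have so: "(\<lambda>w. (norm (coord (char_response T k 0) w))\<^sup>2) summable_on UNIV" by (rule summable_coord)
    have "(norm k)\<^sup>2 = infsum (energy T m 0 k) UNIV"
      using infsumI[OF energy_has_sum[of m 0 k]] by simp
    also have "\<dots> \<le> (\<Sum>\<^sub>\<infinity>w. (norm (coord (char_response T k 0) w))\<^sup>2 + ?b w)"
      using has_sum_imp_summable[OF energy_has_sum] summable_on_add[OF so sb]
      by (rule infsum_mono) (simp add: energy_no_input coord_char_response)
    also have "\<dots> = (norm (char_response T k 0))\<^sup>2 + infsum ?b UNIV"
      using infsum_add[OF so sb] by (simp add: norm_ell2_square)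
    also have "infsum ?b UNIV = infsum ?b {w. length w = m}"
      by (rule infsum_cong_neutral) auto
    also have "\<dots> = (\<Sum>\<^sub>\<infinity>w\<in>{w. length w = m}. (norm (adj UNIV (word_op T w) k))\<^sup>2)"
      by (rule infsum_cong) simp
    finally show ?thesis .
  qed
  moreover have "(\<lambda>m. (norm (char_response T k 0))\<^sup>2 +
      (\<Sum>\<^sub>\<infinity>w\<in>{w. length w = m}. (norm (adj UNIV (word_op T w) k))\<^sup>2)) \<longlonglongrightarrow> (norm (char_response T k 0))\<^sup>2 + 0"
    using pure by (intro tendsto_intros) (simp add: pure_row_contraction_def)
  ultimately show "(norm k)\<^sup>2 \<le> (norm (char_response T k 0))\<^sup>2"
    using LIMSEQ_le_const by fastforce
qed

text \<open>Once the input is exhausted, each of the states reached runs freely and emits all of its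
  energy.  The induction strips off one step of input at a time.\<close>

lemma norm_char_response_finite_input:
  assumes "\<And>w. N \<le> length w \<Longrightarrow> coord x w = 0"
  shows "(norm (char_response T k x))\<^sup>2 = (norm k)\<^sup>2 + (norm x)\<^sup>2"
  using assms
proof (induction N arbitrary: x k)
  case 0
  then have "x = 0" by (intro ell2_eqI) simp
  then show ?case by (simp add: norm_char_response_no_input)
next
  case (Suc N)
  let ?s = "next_state T x k" and ?y = "char_response T k x"
  have eq: "(norm (annihilation i ?y))\<^sup>2 = (norm (coord ?s i))\<^sup>2 + (norm (annihilation i x))\<^sup>2" for i
    unfolding annihilation_char_response by (rule Suc.IH) (use Suc.prems in simp)
  have "((\<lambda>i. (norm (coord ?s i))\<^sup>2 + (norm (annihilation i x))\<^sup>2) has_sum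
      ((norm ?s)\<^sup>2 + ((norm x)\<^sup>2 - (norm (coord x []))\<^sup>2))) UNIV"
    by (intro has_sum_add has_sum_norm_coord has_sum_norm_annihilation)
  then have "(norm ?y)\<^sup>2 - (norm (coord ?y []))\<^sup>2 = (norm ?s)\<^sup>2 + ((norm x)\<^sup>2 - (norm (coord x []))\<^sup>2)"
    by (rule has_sum_unique[OF has_sum_norm_annihilation[of ?y, unfolded eq]])
  moreover have "(norm ?s)\<^sup>2 + (norm (coord ?y []))\<^sup>2 = (norm k)\<^sup>2 + (norm (coord x []))\<^sup>2"
    using julia_isometry[OF closed_csubspace_UNIV closed_csubspace_UNIV row_contr, of "coord x []" k]
    by (simp add: next_state_def coord_char_response)
  ultimately show ?case by simp
qed

text \<open>Inputs with finite support are dense, and on them energy is fully recovered at the output.\<close>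

lemma char_fun_isometric:
  assumes x: "x \<in> fock_tensor (row_defect_space T)"
  shows "norm (char_fun T x) = norm x"
proof -
  have sub: "csubspace (row_defect_space T)" using closed_csubspace_row_defect_space by (simp add: closed_csubspace_def)
  have b: "char_response T 0 \<in> bop (fock_tensor (row_defect_space T)) (fock_tensor (row_defect_star_space T))"
    using char_response_contractive by (simp add: contractive_multi_analytic_def contraction_op_def)
  let ?p = "\<lambda>I. \<Sum>w\<in>I. \<e> w \<otimes> coord x w"
  have "norm (char_response T 0 (?p I)) = norm (?p I)" if "finite I" for I
  proof -
    have c: "coord (?p I) w = (if w \<in> I then coord x w else 0)" for w
      using that by (simp add: coord_sum coord_basis_tensor sum.delta eq_commute)
    have "coord (?p I) w = 0" if "Suc (sum length I) \<le> length w" for w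
      using member_le_sum[of w I length] \<open>finite I\<close> that by (auto simp: c)
    then have "(norm (char_response T 0 (?p I)))\<^sup>2 = (norm (0::'h))\<^sup>2 + (norm (?p I))\<^sup>2"
      by (rule norm_char_response_finite_input)
    then show ?thesis by (simp add: power2_eq_iff_nonneg)
  qed
  then have ev: "\<forall>\<^sub>F I in finite_subsets_at_top UNIV. norm (?p I) = norm (char_response T 0 (?p I))"
    by (intro eventually_finite_subsets_at_top_weakI) simp
  have "((\<lambda>I. char_response T 0 (?p I)) \<longlongrightarrow> char_response T 0 x) (finite_subsets_at_top UNIV)"
    by (rule bop_tendsto[OF b csubspace_fock_tensor[OF sub] partial_sums_tendsto x])
      (simp add: partial_sum_in_fock_tensor[OF sub x])
  from tendsto_norm[OF this]
  have 1: "((\<lambda>I. norm (char_response T 0 (?p I))) \<longlongrightarrow> norm (char_response T 0 x)) (finite_subsets_at_top UNIV)" .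
  have 2: "((\<lambda>I. norm (char_response T 0 (?p I))) \<longlongrightarrow> norm x) (finite_subsets_at_top UNIV)"
    by (rule Lim_transform_eventually[OF tendsto_norm[OF partial_sums_tendsto] ev])
  show ?thesis
    using tendsto_unique[OF finite_subsets_at_top_neq_bot 1 2] x by (simp add: char_fun_eq)
qed

end

end

section \<open>Three-regular factorizations\<close>

text \<open>The hypothesis \<open>dense\<close> asks for approximation only of the triples of vectors in the ranges of the
  defect operators, whose closures make up the codomain of \<open>Z\<^sub>3\<close>.\<close>

lemma three_regularI:
  fixes E1 :: "'a::chilbert_space set" and E2 :: "'b::chilbert_space set"
    and E3 :: "'c::chilbert_space set" and E4 :: "'d::chilbert_space set"
    and \<Theta> :: "('n list, 'a) ell2 \<Rightarrow> ('n list, 'd) ell2"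
  assumes E1: "closed_csubspace E1" and E2: "closed_csubspace E2" and E3: "closed_csubspace E3"
    and T: "contractive_multi_analytic E1 E4 \<Theta>" and T3: "contractive_multi_analytic E3 E4 \<Theta>3"
    and T2: "contractive_multi_analytic E2 E3 \<Theta>2" and T1: "contractive_multi_analytic E1 E2 \<Theta>1"
    and factor: "\<And>f. f \<in> fock_tensor E1 \<Longrightarrow> \<Theta> f = \<Theta>3 (\<Theta>2 (\<Theta>1 f))"
    and dense: "\<And>a b f. a \<in> fock_tensor E3 \<Longrightarrow> b \<in> fock_tensor E2 \<Longrightarrow> f \<in> fock_tensor E1 \<Longrightarrow>
      (defect (fock_tensor E3) \<Theta>3 a, defect (fock_tensor E2) \<Theta>2 b, defect (fock_tensor E1) \<Theta>1 f)
      \<in> closure ((\<lambda>f. (defect (fock_tensor E3) \<Theta>3 (\<Theta>2 (\<Theta>1 f)), defect (fock_tensor E2) \<Theta>2 (\<Theta>1 f),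
          defect (fock_tensor E1) \<Theta>1 f)) ` fock_tensor E1)"
  shows "three_regular_factorization E1 E2 E3 E4 \<Theta> \<Theta>3 \<Theta>2 \<Theta>1"
proof -
  let ?F1 = "fock_tensor E1 :: ('n list, 'a) ell2 set"
  let ?F2 = "fock_tensor E2 :: ('n list, 'b) ell2 set"
  let ?F3 = "fock_tensor E3 :: ('n list, 'c) ell2 set"
  let ?D = "defect ?F1 \<Theta>" and ?D1 = "defect ?F1 \<Theta>1" and ?D2 = "defect ?F2 \<Theta>2" and ?D3 = "defect ?F3 \<Theta>3"
  let ?P = "\<lambda>f. (?D3 (\<Theta>2 (\<Theta>1 f)), ?D2 (\<Theta>1 f), ?D1 f)"
  let ?W = "Z3_codomain E1 E2 E3 \<Theta>3 \<Theta>2 \<Theta>1"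
  have F1: "closed_csubspace ?F1" and F2: "closed_csubspace ?F2" and F3: "closed_csubspace ?F3"
    using E1 E2 E3 by (auto intro: closed_csubspace_fock_tensor)
  have c: "contraction_op ?F1 (fock_tensor E4) \<Theta>" and c3: "contraction_op ?F3 (fock_tensor E4) \<Theta>3"
    and c2: "contraction_op ?F2 ?F3 \<Theta>2" and c1: "contraction_op ?F1 ?F2 \<Theta>1"
    using T T1 T2 T3 by (auto simp: contractive_multi_analytic_def)
  have cF1: "csubspace ?F1" using F1 by (simp add: closed_csubspace_def)
  have W: "closed_csubspace ?W"
    unfolding Z3_codomain_def
    by (intro closed_csubspace_Times closed_csubspace_defect_space[OF F1 c1]
        closed_csubspace_defect_space[OF F2 c2] closed_csubspace_defect_space[OF F3 c3])
  note b1 = contraction_bop[OF c1] and b2 = contraction_bop[OF c2]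
  have in2: "\<Theta>1 f \<in> ?F2" and in3: "\<Theta>2 (\<Theta>1 f) \<in> ?F3" if "f \<in> ?F1" for f
    using that bop_in[OF b1] bop_in[OF b2] by blast+
  have P_norm: "norm (?P f) = norm (?D f)" if f: "f \<in> ?F1" for f
  proof -
    have "(norm (?P f))\<^sup>2 = (norm (?D f))\<^sup>2"
      using norm_defect[OF F1 c f] norm_defect[OF F1 c1 f] norm_defect[OF F2 c2 in2[OF f]]
        norm_defect[OF F3 c3 in3[OF f]] factor[OF f] by (simp add: norm_prod_square)
    then show ?thesis by (simp add: power2_eq_iff_nonneg)
  qed
  have Pb: "?P \<in> bop ?F1 ?W"
  proof -
    obtain K where "K \<ge> 0" and K: "\<And>f. f \<in> ?F1 \<Longrightarrow> norm (?D f) \<le> K * norm f"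
      using bop_bound[OF defect_bop[OF F1 c]] by blast
    show ?thesis
    proof (rule bopI[where K = K])
      fix f assume f: "f \<in> ?F1"
      show "?P f \<in> ?W"
        using f in2 in3 by (simp add: Z3_codomain_def defect_in_defect_space[OF F1 c1]
            defect_in_defect_space[OF F2 c2] defect_in_defect_space[OF F3 c3])
      show "norm (?P f) \<le> K * norm f" using P_norm[OF f] K[OF f] by simp
      show "?P (a *\<^sub>C f) = a *\<^sub>C ?P f" for a
        using f in2 in3 by (simp add: scaleC_prod_def bop_scaleC[OF b1] bop_scaleC[OF b2]
            bop_scaleC[OF defect_bop[OF F1 c1]] bop_scaleC[OF defect_bop[OF F2 c2]] bop_scaleC[OF defect_bop[OF F3 c3]])
      fix g assume "g \<in> ?F1"
      then show "?P (f + g) = ?P f + ?P g"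
        using f in2 in3 by (simp add: bop_add[OF b1] bop_add[OF b2]
            bop_add[OF defect_bop[OF F1 c1]] bop_add[OF defect_bop[OF F2 c2]] bop_add[OF defect_bop[OF F3 c3]])
    qed
  qed
  have P_dense: "closure (?P ` ?F1) = ?W"
  proof
    show "closure (?P ` ?F1) \<subseteq> ?W"
      using bop_in[OF Pb] W by (intro closure_minimal) (auto simp: closed_csubspace_def)
    have "?W = closure (?D3 ` ?F3 \<times> ?D2 ` ?F2 \<times> ?D1 ` ?F1)"
      by (simp add: Z3_codomain_def defect_space_def closure_Times)
    also have "\<dots> \<subseteq> closure (?P ` ?F1)"
      using dense by (intro closure_minimal) auto
    finally show "?W \<subseteq> closure (?P ` ?F1)" .
  qed
  let ?Z = "Z3 E1 E2 E3 \<Theta> \<Theta>3 \<Theta>2 \<Theta>1"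
  have "\<exists>!Z. Z \<in> bop (defect_space ?F1 \<Theta>) ?W \<and> (\<forall>f\<in>?F1. Z (?D f) = ?P f) \<and>
      (\<forall>x. x \<notin> defect_space ?F1 \<Theta> \<longrightarrow> Z x = 0)"
    unfolding defect_space_def by (rule isometric_extension(1)[OF cF1 defect_bop[OF F1 c] Pb W P_norm])
  from theI'[OF this] have Z: "?Z \<in> bop (defect_space ?F1 \<Theta>) ?W" "\<forall>f\<in>?F1. ?Z (?D f) = ?P f"
    unfolding Z3_def by blast+
  have "unitary_op (defect_space ?F1 \<Theta>) ?W ?Z"
    using Z unfolding defect_space_def
    by (intro isometric_extension(2)[OF cF1 defect_bop[OF F1 c] Pb W P_norm _ _ P_dense]) auto
  then show ?thesis
    unfolding three_regular_factorization_def using T T1 T2 T3 factor by blast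
qed

section \<open>The factorization for a block upper triangular row contraction\<close>

text \<open>The second component of \<open>T\<^sub>w z\<close> is \<open>B\<^sub>w\<close> applied to that of \<open>z\<close>; dually, \<open>T\<^sub>w\<^sup>*\<close> acts on \<open>0 \<oplus> k\<close> as
  \<open>B\<^sub>w\<^sup>*\<close>.\<close>

lemma pure_compression:
  fixes A :: "'n \<Rightarrow> 'a::chilbert_space \<Rightarrow> 'a" and B :: "'n \<Rightarrow> 'b::chilbert_space \<Rightarrow> 'b"
    and T :: "'n \<Rightarrow> 'a \<times> 'b \<Rightarrow> 'a \<times> 'b"
  assumes B: "row_contraction B" and T: "pure_row_contraction T"
    and block: "row_op T = block_op p q (\<lambda>_. 0) (row_op B) \<circ> ell2_split"
  shows "pure_row_contraction B"
proof -
  have rT: "row_contraction T" using T by (simp add: pure_row_contraction_def)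
  have "snd (T i z) = B i (snd z)" for i z
  proof -
    have s: "snd (ell2_split (\<e> i \<otimes> z)) = \<e> i \<otimes> snd z"
      by (rule ell2_eqI) (simp add: coord_ell2_split coord_basis_tensor)
    have "T i z = row_op T (\<e> i \<otimes> z)" by (simp add: row_op_basis[OF rT])
    then have "snd (T i z) = row_op B (\<e> i \<otimes> snd z)" by (simp add: block block_op_def s)
    then show ?thesis by (simp add: row_op_basis[OF B])
  qed
  then have word: "snd (word_op T w z) = word_op B w (snd z)" for w z
    by (induction w) simp_all
  have "adj UNIV (word_op T w) (0, k) = (0, adj UNIV (word_op B w) k)" for w k
    by (rule adj_eqI[OF csubspace_UNIV])
      (simp_all add: cinner_prod_def word cinner_adj[OF closed_csubspace_UNIV word_op_bop[OF B]])
  then have "norm (adj UNIV (word_op T w) (0, k)) = norm (adj UNIV (word_op B w) k)" for w k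
    by (simp add: norm_prod_def)
  moreover have "(\<lambda>m. \<Sum>\<^sub>\<infinity>w\<in>{w. length w = m}. (norm (adj UNIV (word_op T w) (0, k)))\<^sup>2) \<longlonglongrightarrow> 0" for k
    using T by (simp add: pure_row_contraction_def)
  ultimately show ?thesis using B by (simp add: pure_row_contraction_def)
qed

text \<open>Self-adjointness and injectivity pass from \<open>g\<close> to \<open>I \<otimes> g\<close> coordinate by coordinate.\<close>

lemma fock_map_dense_range:
  fixes E :: "'a::chilbert_space set"
  assumes E: "closed_csubspace E" and g: "g \<in> bop E E"
    and sa: "\<And>x y. x \<in> E \<Longrightarrow> y \<in> E \<Longrightarrow> cinner (g x) y = cinner x (g y)"
    and inj: "\<And>x. x \<in> E \<Longrightarrow> g x = 0 \<Longrightarrow> x = 0"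
  shows "closure (fock_map g ` fock_tensor E) = fock_tensor E"
proof (rule dense_range_selfadjoint[OF closed_csubspace_fock_tensor[OF E]])
  have cE: "csubspace E" using E by (simp add: closed_csubspace_def)
  show "fock_map g \<in> bop (fock_tensor E) (fock_tensor E)" by (rule fock_map_bop[OF g cE])
  fix x assume x: "x \<in> fock_tensor E"
  show "cinner (fock_map g x) y = cinner x (fock_map g y)" if y: "y \<in> fock_tensor E" for y
    unfolding cinner_ell2_def
    by (rule infsum_cong) (simp add: coord_fock_map[OF g x] coord_fock_map[OF g y] sa fock_tensorD x y)
  show "x = 0" if "fock_map g x = 0"
    using inj[OF fock_tensorD[OF x]] coord_fock_map[OF g x] that by (intro ell2_eqI) (metis coord_zero)
qed

theorem theorem5p5:
  fixes A :: "'n::countable \<Rightarrow> 'a::{chilbert_space, second_countable_topology} \<Rightarrow> 'a"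
    and B :: "'n \<Rightarrow> 'b::{chilbert_space, second_countable_topology} \<Rightarrow> 'b"
    and T :: "'n \<Rightarrow> 'a \<times> 'b \<Rightarrow> 'a \<times> 'b"
    and L :: "('n, 'b) ell2 \<Rightarrow> 'a"
    and \<sigma> :: "('n, 'a \<times> 'b) ell2 \<Rightarrow> ('n, 'a) ell2 \<times> ('n, 'b) ell2"
    and \<sigma>\<^sub>s :: "'a \<times> 'b \<Rightarrow> 'b \<times> 'a"
    and D\<^sub>L :: "('n, 'b) ell2 set"
    and D\<^sub>L\<^sub>s :: "'a set"
    and \<Theta>\<^sub>3 :: "('n list, ('n, 'b) ell2 \<times> 'a) ell2 \<Rightarrow> ('n list, 'a \<times> 'b) ell2"
    and \<Theta>\<^sub>2 :: "('n list, 'a \<times> ('n, 'b) ell2) ell2 \<Rightarrow> ('n list, ('n, 'b) ell2 \<times> 'a) ell2"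
    and \<Theta>\<^sub>1 :: "('n list, ('n, 'a \<times> 'b) ell2) ell2 \<Rightarrow> ('n list, 'a \<times> ('n, 'b) ell2) ell2"
  assumes "row_contraction A" and "row_contraction B" and "row_contraction T"
    and "D\<^sub>L = defect_space (row_defect_space B) L"
    and "D\<^sub>L\<^sub>s = defect_star_space (row_defect_space B) (row_defect_star_space A) L"
    and "contraction_op (row_defect_space B) (row_defect_star_space A) L"
    and "row_op T =
      block_op (row_op A) (row_defect_star A \<circ> L \<circ> row_defect B) (\<lambda>_. 0) (row_op B) \<circ> ell2_split"
    and "unitary_op (row_defect_space T) (row_defect_space A \<times> D\<^sub>L) \<sigma>"
    and "unitary_op (row_defect_star_space T) (row_defect_star_space B \<times> D\<^sub>L\<^sub>s) \<sigma>\<^sub>s"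
    and "\<Theta>\<^sub>3 = fock_map (inv_into (row_defect_star_space T) \<sigma>\<^sub>s) \<circ> fock_diag_id (char_fun B)"
    and "\<Theta>\<^sub>2 = fock_map (julia_op (row_defect_space B) (row_defect_star_space A) L)"
    and "\<Theta>\<^sub>1 = fock_diag_id (char_fun A) \<circ> fock_map \<sigma>"
    and "\<forall>f\<in>fock_tensor (row_defect_space T). char_fun T f = \<Theta>\<^sub>3 (\<Theta>\<^sub>2 (\<Theta>\<^sub>1 f))"
    and "pure_row_contraction B \<or>
      pure_row_contraction T \<or>
      (\<forall>x\<in>row_defect_star_space A. x \<noteq> 0 \<longrightarrow> norm (adj (row_defect_space B) L x) < norm x) \<or>
      (\<forall>y\<in>row_defect_space B. y \<noteq> 0 \<longrightarrow> norm (L y) < norm y)"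
  shows "three_regular_factorization (row_defect_space T) (row_defect_star_space A \<times> D\<^sub>L)
    (row_defect_space B \<times> D\<^sub>L\<^sub>s) (row_defect_star_space T) (char_fun T) \<Theta>\<^sub>3 \<Theta>\<^sub>2 \<Theta>\<^sub>1"
proof -
  note A = assms(1) and B = assms(2) and T = assms(3) and L = assms(6) and block = assms(7)
    and \<sigma> = assms(8) and \<sigma>\<^sub>s = assms(9) and cases = assms(14)
  let ?E1 = "row_defect_space T" and ?DA = "row_defect_space A" and ?EA = "row_defect_star_space A"
    and ?EB = "row_defect_space B" and ?DBs = "row_defect_star_space B" and ?E4 = "row_defect_star_space T"
  have EA: "closed_csubspace ?EA" by (rule closed_csubspace_row_defect_star_space[OF A])
  have EB: "closed_csubspace ?EB" by (rule closed_csubspace_row_defect_space[OF B])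
  have DA: "closed_csubspace ?DA" by (rule closed_csubspace_row_defect_space[OF A])
  have E1: "closed_csubspace ?E1" by (rule closed_csubspace_row_defect_space[OF T])
  have DL: "closed_csubspace D\<^sub>L"
    unfolding assms(4) by (rule closed_csubspace_defect_space[OF EB L])
  have DLs: "closed_csubspace D\<^sub>L\<^sub>s"
    unfolding assms(5) defect_star_space_eq[OF EB EA L]
    by (rule closed_csubspace_defect_space[OF EA adj_contraction[OF EB L]])
  have E2: "closed_csubspace (?EA \<times> D\<^sub>L)" by (rule closed_csubspace_Times[OF EA DL])
  have E3: "closed_csubspace (?EB \<times> D\<^sub>L\<^sub>s)" by (rule closed_csubspace_Times[OF EB DLs])
  note [simp] = EA[unfolded closed_csubspace_def, THEN conjunct1] EB[unfolded closed_csubspace_def, THEN conjunct1]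
    DA[unfolded closed_csubspace_def, THEN conjunct1] E1[unfolded closed_csubspace_def, THEN conjunct1]
    DL[unfolded closed_csubspace_def, THEN conjunct1] DLs[unfolded closed_csubspace_def, THEN conjunct1]
    E2[unfolded closed_csubspace_def, THEN conjunct1] E3[unfolded closed_csubspace_def, THEN conjunct1]
    closed_csubspace_row_defect_star_space[OF B, unfolded closed_csubspace_def, THEN conjunct1]
    closed_csubspace_row_defect_star_space[OF T, unfolded closed_csubspace_def, THEN conjunct1]
  let ?F1 = "fock_tensor ?E1 :: ('n list, ('n, 'a \<times> 'b) ell2) ell2 set"
    and ?F2 = "fock_tensor (?EA \<times> D\<^sub>L) :: ('n list, 'a \<times> ('n, 'b) ell2) ell2 set"
    and ?F3 = "fock_tensor (?EB \<times> D\<^sub>L\<^sub>s) :: ('n list, ('n, 'b) ell2 \<times> 'a) ell2 set"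
  have DBs_DLs: "csubspace (?DBs \<times> D\<^sub>L\<^sub>s)"
    using closed_csubspace_Times[OF closed_csubspace_row_defect_star_space[OF B] DLs] by (simp add: closed_csubspace_def)
  have DA_DL: "csubspace (?DA \<times> D\<^sub>L)"
    using closed_csubspace_Times[OF DA DL] by (simp add: closed_csubspace_def)
  have \<sigma>b: "\<sigma> \<in> bop ?E1 (?DA \<times> D\<^sub>L)" by (rule contraction_bop[OF unitary_contraction[OF \<sigma>]])
  note \<sigma>s_inv = unitary_inv_contraction[OF \<sigma>\<^sub>s _ DBs_DLs]
  have Lj: "contraction_op (?EA \<times> D\<^sub>L) (?EB \<times> D\<^sub>L\<^sub>s) (julia_op ?EB ?EA L)"
    unfolding assms(4,5) by (rule julia_op_contraction[OF EB EA L])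
  have T1: "contractive_multi_analytic ?E1 (?EA \<times> D\<^sub>L) \<Theta>\<^sub>1"
    unfolding assms(12) comp_def
    by (rule contractive_multi_analytic_compose[OF fock_map_contractive[OF unitary_contraction[OF \<sigma>]]
          fock_diag_id_contractive[OF char_fun_contractive[OF A]]]) simp_all
  have T2: "contractive_multi_analytic (?EA \<times> D\<^sub>L) (?EB \<times> D\<^sub>L\<^sub>s) \<Theta>\<^sub>2"
    unfolding assms(11) by (rule fock_map_contractive[OF Lj]) simp
  have T3: "contractive_multi_analytic (?EB \<times> D\<^sub>L\<^sub>s) ?E4 \<Theta>\<^sub>3"
    unfolding assms(10) comp_def
    by (rule contractive_multi_analytic_compose[OF fock_diag_id_contractive[OF char_fun_contractive[OF B]]
          fock_map_contractive[OF \<sigma>s_inv]]) (simp_all add: DBs_DLs)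
  have c1: "contraction_op ?F1 ?F2 \<Theta>\<^sub>1" and c2: "contraction_op ?F2 ?F3 \<Theta>\<^sub>2"
    and c3: "contraction_op ?F3 (fock_tensor ?E4) \<Theta>\<^sub>3"
    using T1 T2 T3 by (auto simp: contractive_multi_analytic_def)
  note b1 = contraction_bop[OF c1] and b2 = contraction_bop[OF c2]
  have F1: "closed_csubspace ?F1" and F2: "closed_csubspace ?F2" and F3: "closed_csubspace ?F3"
    using E1 E2 E3 by (auto intro: closed_csubspace_fock_tensor)
  note [simp] = F1[unfolded closed_csubspace_def, THEN conjunct1] F2[unfolded closed_csubspace_def, THEN conjunct1]
    F3[unfolded closed_csubspace_def, THEN conjunct1]
  let ?D1 = "defect ?F1 \<Theta>\<^sub>1" and ?D2 = "defect ?F2 \<Theta>\<^sub>2" and ?D3 = "defect ?F3 \<Theta>\<^sub>3"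
  note d1b = defect_bop[OF F1 c1] and d3b = defect_bop[OF F3 c3]
  have julia_norm: "norm (julia_op ?EB ?EA L p) = norm p" if "p \<in> ?EA \<times> D\<^sub>L" for p
    using julia_op_isometric[OF EB EA L, of p] that defect_space_subset[OF EB L] by (auto simp: assms(4))
  have D2_zero: "?D2 x = 0" if x: "x \<in> ?F2" for x
  proof -
    have "norm (\<Theta>\<^sub>2 x) = norm x"
      unfolding assms(11) by (rule fock_map_isometric[OF contraction_bop[OF Lj] julia_norm x])
    then show ?thesis by (rule defect_eq_0_iff[OF F2 c2 x, THEN iffD2])
  qed
  have inv_norm: "norm (inv_into ?E4 \<sigma>\<^sub>s y) = norm y" if "y \<in> ?DBs \<times> D\<^sub>L\<^sub>s" for y
    using unitary_norm[OF \<sigma>\<^sub>s unitary_inv(1)[OF \<sigma>\<^sub>s that]] unitary_inv(2)[OF \<sigma>\<^sub>s that] by simp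
  have dB: "fock_diag_id (char_fun B) x \<in> fock_tensor (?DBs \<times> D\<^sub>L\<^sub>s)" if "x \<in> ?F3" for x
    using fock_diag_id_contractive[OF char_fun_contractive[OF B], of D\<^sub>L\<^sub>s] that bop_in
    by (fastforce simp: contractive_multi_analytic_def contraction_op_def)
  have \<Theta>3_norm: "norm (\<Theta>\<^sub>3 x) = norm (fock_diag_id (char_fun B) x)" if "x \<in> ?F3" for x
    using fock_map_isometric[OF contraction_bop[OF \<sigma>s_inv] inv_norm dB[OF that]] by (simp add: assms(10))
  show ?thesis
  proof (rule three_regularI[OF E1 E2 E3 char_fun_contractive[OF T] T3 T2 T1])
    show "char_fun T f = \<Theta>\<^sub>3 (\<Theta>\<^sub>2 (\<Theta>\<^sub>1 f))" if "f \<in> ?F1" for f using assms(13) that by blast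
    fix a b f assume a: "a \<in> ?F3" and b: "b \<in> ?F2" and f: "f \<in> ?F1"
    let ?P = "\<lambda>f. (?D3 (\<Theta>\<^sub>2 (\<Theta>\<^sub>1 f)), ?D2 (\<Theta>\<^sub>1 f), ?D1 f)"
    show "(?D3 a, ?D2 b, ?D1 f) \<in> closure (?P ` ?F1)"
    \<comment> \<open>Purity of \<open>T\<close> implies purity of \<open>B\<close>, so the second case leaves only a proper contraction \<open>L\<close>.\<close>
    proof (cases "pure_row_contraction B")
      case pure: True
      have D3_zero: "?D3 x = 0" if "x \<in> ?F3" for x
        using \<Theta>3_norm[OF that] fock_diag_id_isometric[OF char_fun_isometric[OF B pure] that] that
        by (simp add: defect_eq_0_iff[OF F3 c3])
      have eq: "(?D3 a, ?D2 b, ?D1 f) = ?P f"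
        using a b f by (simp add: D2_zero D3_zero bop_in[OF b1] bop_in[OF b2])
      show ?thesis unfolding eq by (rule image_in_closure[where g = ?P, OF f])
    next
      case False
      then have "\<not> pure_row_contraction T" using pure_compression[OF B _ block] by blast
      with False cases have strict: "norm (L y) < norm y" if "y \<in> ?EB" "y \<noteq> 0" for y
        using strict_of_strict_adj[OF EB L _ that] that by blast
      let ?DL = "defect ?EB L"
      have DL_inj: "y = 0" if "y \<in> ?EB" "?DL y = 0" for y
        using that strict[OF that(1)] by (auto simp: defect_eq_0_iff[OF EB L])
      note DL_sa = defect_selfadjoint[OF EB L] and DL_bop = defect_bop[OF EB L]
      have DL_eq: "D\<^sub>L = ?EB"
        unfolding assms(4) defect_space_def[of ?EB] by (rule dense_range_selfadjoint[OF EB DL_bop DL_sa DL_inj])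
      have fock_dense: "closure (fock_map ?DL ` fock_tensor ?EB) = (fock_tensor ?EB :: ('n list, ('n, 'b) ell2) ell2 set)"
        by (rule fock_map_dense_range[OF EB DL_bop DL_sa DL_inj])
      have join_diff: "u = ell2_join (fst (ell2_split u), 0) + ell2_join (0, snd (ell2_split u))"
        for u :: "('n list, ('n, 'b) ell2 \<times> 'a) ell2"
        by (rule ell2_eqI) (simp add: coord_ell2_join coord_ell2_split)
      have zero_in: "0 \<in> fock_tensor E" if "csubspace E" for E :: "'z::complex_inner set"
        by (rule csubspace_0[OF csubspace_fock_tensor[OF that]])
      have charB0: "char_fun B 0 = 0" and charA0: "char_fun A 0 = 0"
        by (rule contractive_multi_analytic_zero[OF char_fun_contractive[OF B]], simp)
          (rule contractive_multi_analytic_zero[OF char_fun_contractive[OF A]], simp)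
      \<comment> \<open>\<open>\<Theta>\<^sub>3\<close> is isometric on the vectors \<open>0 \<oplus> u\<^sub>2\<close>, so \<open>\<Delta>\<^sub>3 u\<close> depends only on the first component of \<open>u\<close>.\<close>
      have D3_first: "?D3 u = ?D3 (ell2_join (fst (ell2_split u), 0))" if u: "u \<in> ?F3" for u
      proof -
        have 1: "ell2_join (fst (ell2_split u), 0) \<in> ?F3" and 2: "ell2_join (0, snd (ell2_split u)) \<in> ?F3"
          using u by (simp_all add: ell2_split_in zero_in)
        have "norm (fock_diag_id (char_fun B) (ell2_join (0, snd (ell2_split u)))) = norm (ell2_join (0, snd (ell2_split u)))"
          by (simp add: fock_diag_id_eq charB0 norm_ell2_join_zero)
        then have "?D3 (ell2_join (0, snd (ell2_split u))) = 0"
          using \<Theta>3_norm[OF 2] by (simp add: defect_eq_0_iff[OF F3 c3 2])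
        then show ?thesis using bop_add[OF d3b 1 2] join_diff[of u] by simp
      qed
      \<comment> \<open>\<open>v\<close> approximates, in the range of \<open>I \<otimes> D\<^sub>L\<close>, the change wanted in the first component of \<open>c\<close>.\<close>
      define c where "c = \<Theta>\<^sub>2 (\<Theta>\<^sub>1 f)"
      have c: "c \<in> ?F3" unfolding c_def by (rule bop_in[OF b2 bop_in[OF b1 f]])
      let ?a1 = "fst (ell2_split a)" and ?c1 = "fst (ell2_split c)"
      have "?a1 - ?c1 \<in> fock_tensor ?EB"
        using a c by (intro csubspace_diff csubspace_fock_tensor) (simp_all add: ell2_split_in)
      then have "?a1 - ?c1 \<in> closure (fock_map ?DL ` fock_tensor ?EB)" by (simp only: fock_dense)
      then obtain v where v: "\<And>k. v k \<in> fock_map ?DL ` fock_tensor ?EB" and v_lim: "v \<longlonglongrightarrow> ?a1 - ?c1"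
        by (auto simp only: closure_sequential)
      \<comment> \<open>\<open>f' = f + h\<close>, where \<open>I \<otimes> \<sigma>\<close> maps \<open>h\<close> to \<open>0 \<oplus> g\<close>: this leaves \<open>\<Delta>\<^sub>1 f\<close> unchanged and adds \<open>(I \<otimes> D\<^sub>L) g\<close>.\<close>
      have "\<exists>f'\<in>?F1. ?P f' = (?D3 (ell2_join (?c1 + v k, 0)), 0, ?D1 f)" for k
      proof -
        obtain g where g: "g \<in> fock_tensor ?EB" and vg: "v k = fock_map ?DL g" using v[of k] by (rule imageE)
        have j: "ell2_join (0, g) \<in> fock_tensor (?DA \<times> D\<^sub>L)" and j2: "ell2_join (0, g) \<in> ?F2"
          using g by (simp_all add: ell2_split_in zero_in DL_eq)
        define h where "h = fock_map (inv_into ?E1 \<sigma>) (ell2_join (0, g))"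
        have \<sigma>_inv: "inv_into ?E1 \<sigma> \<in> bop (?DA \<times> D\<^sub>L) ?E1"
          by (rule contraction_bop[OF unitary_inv_contraction[OF \<sigma> _ DA_DL]]) simp
        have h: "h \<in> ?F1" unfolding h_def by (rule bop_in[OF fock_map_bop[OF \<sigma>_inv] j]) (simp_all add: DA_DL)
        have "fock_map \<sigma> h = ell2_join (0, g)"
        proof (rule ell2_eqI)
          fix w
          have "coord (fock_map \<sigma> h) w = \<sigma> (coord h w)" by (rule coord_fock_map[OF \<sigma>b h])
          also have "\<dots> = \<sigma> (inv_into ?E1 \<sigma> (coord (ell2_join (0, g)) w))"
            by (simp only: h_def coord_fock_map[OF \<sigma>_inv j])
          also have "\<dots> = coord (ell2_join (0, g)) w" by (rule unitary_inv(2)[OF \<sigma> fock_tensorD[OF j]])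
          finally show "coord (fock_map \<sigma> h) w = coord (ell2_join (0, g)) w" .
        qed
        then have \<Theta>1h: "\<Theta>\<^sub>1 h = ell2_join (0, g)" and nh: "norm h = norm g"
          using fock_map_isometric[OF \<sigma>b unitary_norm[OF \<sigma>] h]
          by (simp_all add: assms(12) fock_diag_id_eq charA0 norm_ell2_join_zero)
        have D1h: "?D1 h = 0" using \<Theta>1h nh by (simp add: defect_eq_0_iff[OF F1 c1 h] norm_ell2_join_zero)
        have "fst (ell2_split (\<Theta>\<^sub>2 (ell2_join (0, g)))) = v k"
          by (rule ell2_eqI) (simp add: assms(11) coord_ell2_split coord_fock_map[OF contraction_bop[OF Lj] j2]
              julia_op_eq coord_ell2_join vg coord_fock_map[OF DL_bop g]
              bop_zero[OF adj_bop[OF EB contraction_bop[OF L], of UNIV] csubspace_UNIV])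
        moreover have "\<Theta>\<^sub>2 (\<Theta>\<^sub>1 (f + h)) = c + \<Theta>\<^sub>2 (ell2_join (0, g))"
          unfolding c_def bop_add[OF b1 f h] \<Theta>1h by (rule bop_add[OF b2 bop_in[OF b1 f] j2])
        ultimately have fst_eq: "fst (ell2_split (\<Theta>\<^sub>2 (\<Theta>\<^sub>1 (f + h)))) = ?c1 + v k"
          by (simp add: ell2_split_add)
        have fh: "f + h \<in> ?F1" using f h by (simp add: csubspace_add)
        have "?P (f + h) = (?D3 (ell2_join (?c1 + v k, 0)), 0, ?D1 f)"
          using D3_first[OF bop_in[OF b2 bop_in[OF b1 fh]]] D2_zero[OF bop_in[OF b1 fh]] D1h
          by (simp add: fst_eq bop_add[OF d1b f h])
        then show ?thesis using fh by blast
      qed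
      then have in_range: "(?D3 (ell2_join (?c1 + v k, 0)), 0, ?D1 f) \<in> ?P ` ?F1" for k by (metis (no_types, lifting) imageI)
      have join_lim: "(\<lambda>k. ell2_join (?c1 + v k, 0)) \<longlonglongrightarrow> ell2_join (?a1, 0 :: ('n list, 'a) ell2)"
      proof (rule bounded_linear.tendsto[OF bounded_linear_ell2_join], rule tendsto_Pair)
        show "(\<lambda>k. ?c1 + v k) \<longlonglongrightarrow> ?a1"
          using tendsto_add[OF tendsto_const[of ?c1] v_lim] by simp
      qed (rule tendsto_const)
      have vF: "v k \<in> fock_tensor ?EB" for k
        using v[of k] bop_in[OF fock_map_bop[OF DL_bop]] by auto
      have "(\<lambda>k. ?D3 (ell2_join (?c1 + v k, 0))) \<longlonglongrightarrow> ?D3 (ell2_join (?a1, 0))"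
        by (rule bop_tendsto[OF d3b _ join_lim])
          (use a c vF in \<open>auto simp: ell2_split_in zero_in csubspace_add csubspace_fock_tensor\<close>)
      then have "(\<lambda>k. (?D3 (ell2_join (?c1 + v k, 0)), 0, ?D1 f)) \<longlonglongrightarrow> (?D3 a, ?D2 b, ?D1 f)"
        by (simp only: D3_first[OF a, symmetric] D2_zero[OF b]) (intro tendsto_intros)
      then show ?thesis
        unfolding closure_sequential
        by (intro exI[of _ "\<lambda>k. (?D3 (ell2_join (?c1 + v k, 0)), 0, ?D1 f)"] conjI allI in_range)
    qed
  qed
qed

end
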